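(* Let $\mathbf A(t)\in\mathbb R^{m\times n}$, $0\le t\le T$, denote the solution of the matrix differential equation $\dot{\mathbf A}(t)=\mathbf F(t,\mathbf A(t))$, $\mathbf A(0)=\mathbf A_0$. Let $h>0$, $t_n=nh$, and let $\mathbf Y_n$ be the low-rank approximation to $\mathbf A(t_n)$ obtained after $n$ steps of the midpoint BUG integrator with stepsize $h$, starting from the low-rank matrix $\mathbf Y_0$, with rank truncation after each step with tolerance $\vartheta$, as defined in the context. Let $r_n$ be the rank of $\mathbf Y_n$ and $\hat r_n$ the rank of the augmented bases in the midpoint approximation of the step starting from $\mathbf Y_n$. Assume, in the Frobenius norm $\|\cdot\|$: (i) for all $\mathbf Y,\mathbf Z\in\mathbb R^{m\times n}$ and $0\le t\le T$, $\|\mathbf F(t,\mathbf Y)-\mathbf F(t,\mathbf Z)\|\le L\|\mathbf Y-\mathbf Z\|$ and $\|\mathbf F(t,\mathbf Y)\|\le B$; (ii) for each $n$ with $0\le t_n\le T$, with $r=r_n$ and $\hat r=\hat r_n$, $$\|P_r^\perp(\mathbf Y)\mathbf F(t,\mathbf Y)\|\le\varepsilon\quad\text{and}\quad\|P_{\hat r}^\perp(\widehat{\mathbf Y})\mathbf F(t,\widehat{\mathbf Y})\|\le\widehat\varepsilon$$ for all $t$ in a neighbourhood of $t_n$ in $[0,T]$ that contains the time interval $[t_n,t_{n+1}]\cap[0,T]$, and all $\mathbf Y\in\mathcal M_r$ and $\widehat{\mathbf Y}\in\mathcal M_{\hat r}$ in a neighbourhood of $\mathbf A(t)$ (the ball of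 radius $\rho>0$ around $\mathbf A(t)$); (iii) the error in the initial value is $\delta$-small: $\|\mathbf Y_0-\mathbf A_0\|\le\delta$. Then, under the conventions on neighbourhoods and stepsize stated in the context, the error satisfies for all $n$ with $t_n=nh\le T$ $$\|\mathbf Y_n-\mathbf A(t_n)\|\le c_0\delta+c_1\widehat\varepsilon+c_2h\varepsilon+c_3h^2+c_4n\vartheta,$$ where the constants $c_i$ depend only on $B$, $L$ and $T$ and on a bound of the derivatives up to order three of exact solutions of the matrix differential equation with initial values in a neighbourhood of $\mathbf A_0$.
   Context: Throughout, $\mathbf F:[0,T]\times\mathbb R^{m\times n}\to\mathbb R^{m\times n}$ is continuous, and $\|\cdot\|$ is the Frobenius norm. $\mathcal M_r$ is the manifold of real $m\times n$ matrices of rank $r$. For $\mathbf Y=\mathbf U\mathbf S\mathbf V^\top\in\mathcal M_r$ with $\mathbf U\in\mathbb R^{m\times r}$, $\mathbf V\in\mathbb R^{n\times r}$ having orthonormal columns and $\mathbf S\in\mathbb R^{r\times r}$ invertible, $P_r(\mathbf Y)$ is the orthogonal projection onto the tangent space of $\mathcal M_r$ at $\mathbf Y$, $$P_r(\mathbf Y)\mathbf Z=\mathbf Z\mathbf V\mathbf V^\top-\mathbf U\mathbf U^\top\mathbf Z\mathbf V\mathbf V^\top+\mathbf U\mathbf U^\top\mathbf Z,\qquad P_r^\perp(\mathbf Y)=I-P_r(\mathbf Y).$$ Conventions on neighbourhoods and stepsize. The numerical approximations are understood to stay in the neighbourhoods where the assumptions hold: $\|\mathbf Y_n-\mathbf A(t_n)\|\le\rho/2$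 for all $n$ with $t_n\le T$; the stepsize satisfies $h\le h_0$ with $h_0$ sufficiently small in terms of $B$ and $\rho$ only; and the neighbourhood of $\mathbf A_0$ referred to in the dependence of the constants contains the values at time $0$ of the exact solutions of the differential equation that pass through $\mathbf Y_n$ at time $t_n$. For matrices $\mathbf X_1,\dots,\mathbf X_k$ with the same number of rows, $\mathrm{orth}(\mathbf X_1,\dots,\mathbf X_k)$ denotes a matrix whose columns form an orthonormal basis of the range of the block matrix $(\mathbf X_1,\dots,\mathbf X_k)$. One step of the midpoint BUG integrator (version with intermediate rank at most $4r$), described for the first step from $t_0=0$ to $t_1=t_0+h$, with $t_{1/2}=t_0+h/2$, starting from $\mathbf Y_0=\mathbf U_0\mathbf S_0\mathbf V_0^\top$ of rank $r=r_0$, where $\mathbf U_0\in\mathbb R^{m\times r}$, $\mathbf V_0\in\mathbb R^{n\times r}$ have orthonormal columns and $\mathbf S_0\in\mathbb R^{r\times r}$ is invertible (all matrix differential equations in the substeps are taken to be solved exactly): Step 1 (midpoint approximation by the augmented BUG integrator with stepsize $h/2$). - K-step: solve on $[t_0,t_{1/2}]$ the $m\times r$ equation $\dot{\mathbf K}(t)=\mathbf F(t,\mathbf K(t)\mathbf V_0^\top)\mathbf V_0$, $\mathbf K(t_0)=\mathbf U_0\mathbf S_0$; set $\widehat{\mathbf U}_{1/2}=\mathrm{orth}(\mathbf U_0,\mathbf K(t_{1/2}))\in\mathbb R^{m\times\hat r}$ and $\widehat{\mathbf M}=\widehat{\mathbf U}_{1/2}^\top\mathbf U_0$. - L-step: solve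 on $[t_0,t_{1/2}]$ the $n\times r$ equation $\dot{\mathbf L}(t)=\mathbf F(t,\mathbf U_0\mathbf L(t)^\top)^\top\mathbf U_0$, $\mathbf L(t_0)=\mathbf V_0\mathbf S_0^\top$; set $\widehat{\mathbf V}_{1/2}=\mathrm{orth}(\mathbf V_0,\mathbf L(t_{1/2}))\in\mathbb R^{n\times\hat r}$ and $\widehat{\mathbf N}=\widehat{\mathbf V}_{1/2}^\top\mathbf V_0$. - S-step: solve on $[t_0,t_{1/2}]$ the $\hat r\times\hat r$ equation $\dot{\widehat{\mathbf S}}(t)=\widehat{\mathbf U}_{1/2}^\top\mathbf F(t,\widehat{\mathbf U}_{1/2}\widehat{\mathbf S}(t)\widehat{\mathbf V}_{1/2}^\top)\widehat{\mathbf V}_{1/2}$, $\widehat{\mathbf S}(t_0)=\widehat{\mathbf M}\mathbf S_0\widehat{\mathbf N}^\top$; set $\widehat{\mathbf Y}_{1/2}=\widehat{\mathbf U}_{1/2}\widehat{\mathbf S}(t_{1/2})\widehat{\mathbf V}_{1/2}^\top$ (no truncation). Step 2 (Galerkin step). Compute the augmented orthonormal bases, of rank $\bar r\le4r$, $$\overline{\mathbf U}=\mathrm{orth}\big(\widehat{\mathbf U}_{1/2},\,h\mathbf F(t_{1/2},\widehat{\mathbf Y}_{1/2})\widehat{\mathbf V}_{1/2}\big),\qquad \overline{\mathbf V}=\mathrm{orth}\big(\widehat{\mathbf V}_{1/2},\,h\mathbf F(t_{1/2},\widehat{\mathbf Y}_{1/2})^\top\widehat{\mathbf U}_{1/2}\big),$$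 and $\overline{\mathbf M}=\overline{\mathbf U}^\top\mathbf U_0$, $\overline{\mathbf N}=\overline{\mathbf V}^\top\mathbf V_0$. Solve on $[t_0,t_1]$ the $\bar r\times\bar r$ equation $$\dot{\overline{\mathbf S}}(t)=\overline{\mathbf U}^\top\mathbf F(t,\overline{\mathbf U}\,\overline{\mathbf S}(t)\overline{\mathbf V}^\top)\overline{\mathbf V},\qquad\overline{\mathbf S}(t_0)=\overline{\mathbf M}\mathbf S_0\overline{\mathbf N}^\top,$$ and set $\overline{\mathbf Y}_1=\overline{\mathbf U}\,\overline{\mathbf S}(t_1)\overline{\mathbf V}^\top$. Truncation with tolerance $\vartheta$. Compute an SVD of $\overline{\mathbf S}(t_1)$ with singular values $\sigma_1\ge\sigma_2\ge\dots$, choose the new rank $r_1$ as the smallest integer with $\big(\sum_{k>r_1}\sigma_k^2\big)^{1/2}\le\vartheta$, and let $\mathbf Y_1=\mathbf U_1\mathbf S_1\mathbf V_1^\top$ be obtained from $\overline{\mathbf Y}_1$ by retaining only the $r_1$ largest singular values and their singular vectors; thus $\|\mathbf Y_1-\overline{\mathbf Y}_1\|\le\vartheta$. Then $\mathbf Y_1$ in factored form is the starting value for the next step from $t_1$ to $t_2$, which computes $\mathbf Y_2$, and so on. As in the algorithm's formulation, in each step the two bases in Step 1 are taken to have the same number $\hat r\le2r$ of columns, and the two bases in Step 2 the same number $\bar r\le4r$ of columns. *)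

theory Defs
  imports Complex_Main "Jordan_Normal_Form.DL_Rank"
begin

text \<open>Matrices are those of \<open>Jordan_Normal_Form.Matrix\<close>: the dimensions are natural numbers, so
  that ranks may vary from step to step and constants can be quantified before the dimensions.\<close>

definition frob :: "real mat \<Rightarrow> real" where
  "frob A = sqrt (\<Sum>i<dim_row A. \<Sum>j<dim_col A. (A $$ (i, j))\<^sup>2)"

definition mat_field_continuous ::
    "nat \<Rightarrow> nat \<Rightarrow> real \<Rightarrow> (real \<Rightarrow> real mat \<Rightarrow> real mat) \<Rightarrow> bool" where
  "mat_field_continuous m n T F \<longleftrightarrow>
     (\<forall>t\<in>{0..T}. \<forall>Y\<in>carrier_mat m n. \<forall>e>0. \<exists>d>0. \<forall>s\<in>{0..T}. \<forall>Z\<in>carrier_mat m n.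
        \<bar>s - t\<bar> < d \<longrightarrow> frob (Z - Y) < d \<longrightarrow> frob (F s Z - F t Y) < e)"

subsection \<open>Matrix differential equations\<close>

text \<open>Derivatives are taken entrywise and relative to the interval, hence one-sided at its end
  points.\<close>

definition has_mat_derivative ::
    "nat \<Rightarrow> nat \<Rightarrow> (real \<Rightarrow> real mat) \<Rightarrow> real mat \<Rightarrow> real \<Rightarrow> real set \<Rightarrow> bool" where
  "has_mat_derivative p q X D t I \<longleftrightarrow>
     (\<forall>i<p. \<forall>j<q. ((\<lambda>s. X s $$ (i, j)) has_real_derivative D $$ (i, j)) (at t within I))"

definition solves_mat_ode ::
    "nat \<Rightarrow> nat \<Rightarrow> real \<Rightarrow> real \<Rightarrow> (real \<Rightarrow> real mat \<Rightarrow> real mat) \<Rightarrow> (real \<Rightarrow> real mat) \<Rightarrow> bool" where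
  "solves_mat_ode p q a b G X \<longleftrightarrow>
     (\<forall>t\<in>{a..b}. X t \<in> carrier_mat p q \<and> has_mat_derivative p q X (G t (X t)) t {a..b})"

definition derivs_bounded ::
    "nat \<Rightarrow> nat \<Rightarrow> real \<Rightarrow> real \<Rightarrow> (real \<Rightarrow> real mat) \<Rightarrow> bool" where
  "derivs_bounded m n T D X \<longleftrightarrow>
     (\<exists>d :: nat \<Rightarrow> real \<Rightarrow> real mat. d 0 = X \<and>
        (\<forall>k<3. \<forall>t\<in>{0..T}.
           d (Suc k) t \<in> carrier_mat m n \<and>
           has_mat_derivative m n (d k) (d (Suc k) t) t {0..T} \<and>
           frob (d (Suc k) t) \<le> D))"

subsection \<open>Fixed-rank matrices and the tangent space projection\<close>

definition fixed_rank_mats :: "nat \<Rightarrow> nat \<Rightarrow> nat \<Rightarrow> real mat set" where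
  "fixed_rank_mats m n r = {Y \<in> carrier_mat m n. vec_space.rank m Y = r}"

definition orthonormal_cols :: "nat \<Rightarrow> nat \<Rightarrow> real mat \<Rightarrow> bool" where
  "orthonormal_cols p k W \<longleftrightarrow> W \<in> carrier_mat p k \<and> W\<^sup>T * W = 1\<^sub>m k"

definition low_rank_fact ::
    "nat \<Rightarrow> nat \<Rightarrow> nat \<Rightarrow> real mat \<Rightarrow> real mat \<Rightarrow> real mat \<Rightarrow> real mat \<Rightarrow> bool" where
  "low_rank_fact m n r U S V Y \<longleftrightarrow>
     orthonormal_cols m r U \<and> orthonormal_cols n r V \<and>
     S \<in> carrier_mat r r \<and> invertible_mat S \<and> Y = U * S * V\<^sup>T"

text \<open>The value does not depend on the chosen factorization, see \<open>tangent_proj_eq\<close> below.\<close>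

definition tangent_proj :: "nat \<Rightarrow> real mat \<Rightarrow> real mat \<Rightarrow> real mat" where
  "tangent_proj r Y Z =
     (let (U, S, V) = (SOME (U, S, V). low_rank_fact (dim_row Y) (dim_col Y) r U S V Y)
      in Z * V * V\<^sup>T - U * U\<^sup>T * Z * V * V\<^sup>T + U * U\<^sup>T * Z)"

definition tangent_proj_perp :: "nat \<Rightarrow> real mat \<Rightarrow> real mat \<Rightarrow> real mat" where
  "tangent_proj_perp r Y Z = Z - tangent_proj r Y Z"

subsection \<open>The midpoint BUG integrator\<close>

text \<open>\<open>is_orth p k Xs W\<close>: the \<open>k\<close> columns of \<open>W\<close> form an orthonormal basis of the range of the block
  matrix formed by the matrices in \<open>Xs\<close>, all of which have \<open>p\<close> rows.\<close>

definition is_orth :: "nat \<Rightarrow> nat \<Rightarrow> real mat list \<Rightarrow> real mat \<Rightarrow> bool" where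
  "is_orth p k Xs W \<longleftrightarrow>
     orthonormal_cols p k W \<and>
     vec_space.col_space p W = vec_space.col_space p (mat_of_cols p (concat (map cols Xs)))"

text \<open>The projected equation for given bases \<open>U\<close>, \<open>V\<close> with \<open>k\<close> columns, started from the
  factored matrix with factors \<open>U0\<close>, \<open>S0\<close>, \<open>V0\<close>.\<close>

definition galerkin_solution ::
    "(real \<Rightarrow> real mat \<Rightarrow> real mat) \<Rightarrow> real \<Rightarrow> real \<Rightarrow> nat \<Rightarrow> real mat \<Rightarrow> real mat \<Rightarrow>
     real mat \<Rightarrow> real mat \<Rightarrow> real mat \<Rightarrow> (real \<Rightarrow> real mat) \<Rightarrow> bool" where
  "galerkin_solution F a b k U V U0 S0 V0 S \<longleftrightarrow>
     solves_mat_ode k k a b (\<lambda>t S. U\<^sup>T * F t (U * S * V\<^sup>T) * V) S \<and>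
     S a = (U\<^sup>T * U0) * S0 * (V\<^sup>T * V0)\<^sup>T"

definition midpoint_approx ::
    "nat \<Rightarrow> nat \<Rightarrow> (real \<Rightarrow> real mat \<Rightarrow> real mat) \<Rightarrow> real \<Rightarrow> real \<Rightarrow>
     real mat \<Rightarrow> real mat \<Rightarrow> real mat \<Rightarrow> nat \<Rightarrow> real mat \<Rightarrow> real mat \<Rightarrow> real mat \<Rightarrow> bool" where
  "midpoint_approx m n F t0 h U0 S0 V0 rhat Uh Vh Yh \<longleftrightarrow>
     (\<exists>K L S.
        solves_mat_ode m (dim_col U0) t0 (t0 + h/2) (\<lambda>t K. F t (K * V0\<^sup>T) * V0) K \<and>
        K t0 = U0 * S0 \<and>
        is_orth m rhat [U0, K (t0 + h/2)] Uh \<and>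
        solves_mat_ode n (dim_col V0) t0 (t0 + h/2) (\<lambda>t L. (F t (U0 * L\<^sup>T))\<^sup>T * U0) L \<and>
        L t0 = V0 * S0\<^sup>T \<and>
        is_orth n rhat [V0, L (t0 + h/2)] Vh \<and>
        galerkin_solution F t0 (t0 + h/2) rhat Uh Vh U0 S0 V0 S \<and>
        Yh = Uh * S (t0 + h/2) * Vh\<^sup>T)"

definition first_cols :: "nat \<Rightarrow> real mat \<Rightarrow> real mat" where
  "first_cols k A = mat (dim_row A) k (\<lambda>(i, j). A $$ (i, j))"

text \<open>\<open>\<sigma>\<close> is indexed from \<open>0\<close>, so that the singular values beyond the \<open>k\<close> largest ones are
  \<open>\<sigma> k, \<dots>, \<sigma> (s - 1)\<close>.\<close>

definition svd_truncation ::
    "real \<Rightarrow> nat \<Rightarrow> real mat \<Rightarrow> real mat \<Rightarrow> real mat \<Rightarrow> real mat \<Rightarrow> real mat \<Rightarrow> real mat \<Rightarrow> bool" where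
  "svd_truncation \<theta> s U S V U1 S1 V1 \<longleftrightarrow>
     (\<exists>P Q \<sigma> r1.
        orthonormal_cols s s P \<and> orthonormal_cols s s Q \<and>
        (\<forall>i<s. 0 \<le> \<sigma> i) \<and> (\<forall>i j. i \<le> j \<longrightarrow> j < s \<longrightarrow> \<sigma> j \<le> \<sigma> i) \<and>
        S = P * mat_diag s \<sigma> * Q\<^sup>T \<and>
        r1 = (LEAST k. sqrt (\<Sum>i\<in>{k..<s}. (\<sigma> i)\<^sup>2) \<le> \<theta>) \<and>
        U1 = first_cols r1 (U * P) \<and> S1 = mat_diag r1 \<sigma> \<and> V1 = first_cols r1 (V * Q))"

definition midpoint_bug_step ::
    "nat \<Rightarrow> nat \<Rightarrow> (real \<Rightarrow> real mat \<Rightarrow> real mat) \<Rightarrow> real \<Rightarrow> real \<Rightarrow> real \<Rightarrow>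
     real mat \<Rightarrow> real mat \<Rightarrow> real mat \<Rightarrow> nat \<Rightarrow> real mat \<Rightarrow> real mat \<Rightarrow> real mat \<Rightarrow> bool" where
  "midpoint_bug_step m n F t0 h \<theta> U0 S0 V0 rhat U1 S1 V1 \<longleftrightarrow>
     (\<exists>Uh Vh Yh rbar Ub Vb S.
        midpoint_approx m n F t0 h U0 S0 V0 rhat Uh Vh Yh \<and>
        is_orth m rbar [Uh, h \<cdot>\<^sub>m (F (t0 + h/2) Yh * Vh)] Ub \<and>
        is_orth n rbar [Vh, h \<cdot>\<^sub>m ((F (t0 + h/2) Yh)\<^sup>T * Uh)] Vb \<and>
        galerkin_solution F t0 (t0 + h) rbar Ub Vb U0 S0 V0 S \<and>
        svd_truncation \<theta> rbar Ub (S (t0 + h)) Vb U1 S1 V1)"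

text \<open>\<open>F\<close> is only considered on \<open>{0..T}\<close>, so only steps ending before or at time \<open>T\<close> are
  performed; \<open>Y k\<close> is meaningful for \<open>k * h \<le> T\<close> and \<open>rhat k\<close> for \<open>(k + 1) * h \<le> T\<close>.\<close>

definition midpoint_bug_run ::
    "nat \<Rightarrow> nat \<Rightarrow> (real \<Rightarrow> real mat \<Rightarrow> real mat) \<Rightarrow> real \<Rightarrow> real \<Rightarrow> real \<Rightarrow>
     (nat \<Rightarrow> real mat) \<Rightarrow> (nat \<Rightarrow> nat) \<Rightarrow> bool" where
  "midpoint_bug_run m n F T h \<theta> Y rhat \<longleftrightarrow>
     (\<exists>U S V.
        low_rank_fact m n (dim_col (U 0)) (U 0) (S 0) (V 0) (Y 0) \<and>
        (\<forall>k. real (Suc k) * h \<le> T \<longrightarrow>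
           midpoint_bug_step m n F (real k * h) h \<theta> (U k) (S k) (V k) (rhat k)
             (U (Suc k)) (S (Suc k)) (V (Suc k)) \<and>
           Y (Suc k) = U (Suc k) * S (Suc k) * (V (Suc k))\<^sup>T))"

subsection \<open>The tangent space projection is well defined\<close>

lemma low_rank_fact_transpose:
  assumes "low_rank_fact m n r U S V Y"
  shows "low_rank_fact n m r V S\<^sup>T U Y\<^sup>T"
proof -
  have U: "U \<in> carrier_mat m r" and V: "V \<in> carrier_mat n r" and S: "S \<in> carrier_mat r r"
    and inv: "invertible_mat S" and Y: "Y = U * S * V\<^sup>T"
    using assms by (auto simp: low_rank_fact_def orthonormal_cols_def)
  from inv obtain B where B: "S * B = 1\<^sub>m r" "B * S = 1\<^sub>m (dim_row B)"
    using S by (auto simp: invertible_mat_def inverts_mat_def)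
  then have Bc: "B \<in> carrier_mat r r"
    using S by (metis carrier_matI carrier_matD(2) index_mult_mat(3) index_one_mat(3))
  have "S\<^sup>T * B\<^sup>T = 1\<^sub>m r" "B\<^sup>T * S\<^sup>T = 1\<^sub>m r"
    using B Bc S by (metis carrier_matD(1) transpose_mult transpose_one)+
  then have "invertible_mat S\<^sup>T"
    using S Bc by (auto simp: invertible_mat_def inverts_mat_def intro!: exI[of _ "B\<^sup>T"])
  moreover have "Y\<^sup>T = V * S\<^sup>T * U\<^sup>T"
  proof -
    have "Y\<^sup>T = V\<^sup>T\<^sup>T * (U * S)\<^sup>T"
      unfolding Y using U V S by (intro transpose_mult) auto
    also have "(U * S)\<^sup>T = S\<^sup>T * U\<^sup>T" using U S by (rule transpose_mult)
    finally show ?thesis using U V S by simp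
  qed
  ultimately show ?thesis
    using assms S by (auto simp: low_rank_fact_def)
qed

lemma low_rank_fact_projector:
  assumes f: "low_rank_fact m n r U S V Y" and f': "low_rank_fact m n r U' S' V' Y"
  shows "U * U\<^sup>T = U' * U'\<^sup>T"
proof -
  have U: "U \<in> carrier_mat m r" and UU: "U\<^sup>T * U = 1\<^sub>m r"
    and V: "V \<in> carrier_mat n r" and VV: "V\<^sup>T * V = 1\<^sub>m r"
    and S: "S \<in> carrier_mat r r" and inv: "invertible_mat S" and Y: "Y = U * S * V\<^sup>T"
    using f by (auto simp: low_rank_fact_def orthonormal_cols_def)
  have U': "U' \<in> carrier_mat m r" and UU': "U'\<^sup>T * U' = 1\<^sub>m r" and V': "V' \<in> carrier_mat n r"
    and S': "S' \<in> carrier_mat r r" and Y': "Y = U' * S' * V'\<^sup>T"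
    using f' by (auto simp: low_rank_fact_def orthonormal_cols_def)
  from inv obtain B where B: "S * B = 1\<^sub>m r" "B * S = 1\<^sub>m (dim_row B)"
    using S by (auto simp: invertible_mat_def inverts_mat_def)
  then have Bc: "B \<in> carrier_mat r r"
    using S by (metis carrier_matI carrier_matD(2) index_mult_mat(3) index_one_mat(3))
  define A where "A = S' * (V'\<^sup>T * (V * B))"
  have A: "A \<in> carrier_mat r r"
    using S' V' V Bc by (auto simp: A_def)
  have VB: "V * B \<in> carrier_mat n r" using V Bc by simp
  have "Y * (V * B) = U * S * (V\<^sup>T * (V * B))"
    unfolding Y by (rule assoc_mult_mat[of _ m r _ n _ r]) (use U S V VB in auto)
  also have "V\<^sup>T * (V * B) = V\<^sup>T * V * B"
    by (rule assoc_mult_mat[of _ r n _ r _ r, symmetric]) (use V Bc in auto)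
  also have "\<dots> = B" using VV Bc by simp
  also have "U * S * B = U"
    using U S Bc B(1) by (simp add: assoc_mult_mat[of U m r S r B r])
  finally have "U = Y * (V * B)" ..
  also have "\<dots> = U' * S' * (V'\<^sup>T * (V * B))"
    unfolding Y' by (rule assoc_mult_mat[of _ m r _ n _ r]) (use U' S' V' VB in auto)
  also have "\<dots> = U' * A"
    unfolding A_def by (rule assoc_mult_mat[of _ m r _ r _ r]) (use U' S' V' VB in auto)
  finally have UA: "U = U' * A" .
  have "A\<^sup>T * A = A\<^sup>T * ((U'\<^sup>T * U') * A)" using UU' A by simp
  also have "(U'\<^sup>T * U') * A = U'\<^sup>T * (U' * A)"
    by (rule assoc_mult_mat[of _ r m _ r _ r]) (use U' A in auto)
  also have "A\<^sup>T * (U'\<^sup>T * (U' * A)) = A\<^sup>T * U'\<^sup>T * (U' * A)"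
    by (rule assoc_mult_mat[of _ r r _ m _ r, symmetric]) (use U' A in auto)
  also have "A\<^sup>T * U'\<^sup>T = U\<^sup>T" unfolding UA using U' A by (simp add: transpose_mult)
  finally have "A\<^sup>T * A = 1\<^sub>m r" unfolding UA[symmetric] UU .
  then have AA: "A * A\<^sup>T = 1\<^sub>m r"
    using A by (intro mat_mult_left_right_inverse[of "A\<^sup>T" r A]) auto
  have "U * U\<^sup>T = U' * A * (A\<^sup>T * U'\<^sup>T)" unfolding UA using U' A by (simp add: transpose_mult)
  also have "\<dots> = U' * (A * (A\<^sup>T * U'\<^sup>T))" by (rule assoc_mult_mat[of _ m r _ r _ m]) (use U' A in auto)
  also have "A * (A\<^sup>T * U'\<^sup>T) = A * A\<^sup>T * U'\<^sup>T"
    by (rule assoc_mult_mat[of _ r r _ r _ m, symmetric]) (use U' A in auto)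
  also have "\<dots> = U'\<^sup>T" using AA U' by simp
  finally show ?thesis .
qed

lemma tangent_proj_eq:
  assumes f: "low_rank_fact m n r U S V Y" and Z: "Z \<in> carrier_mat m n"
  shows "tangent_proj r Y Z = Z * V * V\<^sup>T - U * U\<^sup>T * Z * V * V\<^sup>T + U * U\<^sup>T * Z"
proof -
  have dims: "dim_row Y = m" "dim_col Y = n"
    using f by (auto simp: low_rank_fact_def orthonormal_cols_def)
  define p where "p = (SOME (U, S, V). low_rank_fact m n r U S V Y)"
  obtain U' S' V' where p: "p = (U', S', V')" by (cases p)
  have "case p of (U, S, V) \<Rightarrow> low_rank_fact m n r U S V Y"
    unfolding p_def by (rule someI[of _ "(U, S, V)"]) (use f in simp)
  then have f': "low_rank_fact m n r U' S' V' Y" by (simp add: p)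
  have UU: "U' * U'\<^sup>T = U * U\<^sup>T"
    by (rule low_rank_fact_projector[OF f' f])
  have VV: "V' * V'\<^sup>T = V * V\<^sup>T"
    by (rule low_rank_fact_projector[OF low_rank_fact_transpose[OF f']
          low_rank_fact_transpose[OF f]])
  have c: "U \<in> carrier_mat m r" "V \<in> carrier_mat n r" "V' \<in> carrier_mat n r"
    using f f' by (auto simp: low_rank_fact_def orthonormal_cols_def)
  have *: "X * V' * V'\<^sup>T = X * V * V\<^sup>T" if "X \<in> carrier_mat m n" for X
    using that c VV by (simp add: assoc_mult_mat[of X m n _ r _ n])
  have ZZ: "U * U\<^sup>T * Z \<in> carrier_mat m n" using Z c by auto
  have "tangent_proj r Y Z = Z * V' * V'\<^sup>T - U' * U'\<^sup>T * Z * V' * V'\<^sup>T + U' * U'\<^sup>T * Z"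
    unfolding tangent_proj_def dims p_def[symmetric] p by simp
  then show ?thesis
    unfolding UU *[OF Z] *[OF ZZ] .
qed

end

theory Submission
  imports Defs "HOL-Analysis.L2_Norm" "Jordan_Normal_Form.Char_Poly"
begin

text \<open>The error is estimated against the exact solution \<open>A\<close> itself, not against the exact solutions
  through the numerical values. Put \<open>e = frob (A t0 - Y0)\<close> at the start of a step of size \<open>h\<close>, and let
  \<open>Y\<close> be a Galerkin solution with orthonormal bases \<open>U\<close>, \<open>V\<close> whose ranges contain those of the factors
  of \<open>Y0\<close>. With \<open>\<Phi> X = U U\<^sup>T X V V\<^sup>T\<close> the error is the sum of three parts,
  \<open>A t - Y t = (A t0 - Y0) + (\<Delta> - \<Phi> \<Delta>) + r t\<close>, where \<open>\<Delta> = A t - A t0\<close> and the derivative of \<open>r\<close> is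
  \<open>\<Phi>\<close> applied to a difference of values of \<open>F\<close>. So the initial error is propagated with factor one,
  the Lipschitz constant enters with a factor \<open>h\<close>, and only the part of the increment \<open>\<Delta>\<close>
  outside the ranges of the bases matters (\<open>galerkin_error\<close>).

  In the midpoint step this part is \<open>O(h e + h\<^sup>2 + h \<epsilon>)\<close>: the range of the new basis contains \<open>U0\<close> and the
  result of the K-step, hence the increment of the K-step, whose right-hand side differs from that of
  the exact equation by a Lipschitz term and the normal component of \<open>F\<close> at \<open>Y0\<close>
  (\<open>K_step_increment_residual\<close>; the L-step is its transpose). So the midpoint value has error
  \<open>\<mu> = e + O(h e + h\<^sup>2 + h \<epsilon>)\<close> (\<open>midpoint_approx_error\<close>).

  In the second step the bases contain \<open>F V\<close> and \<open>F\<^sup>T U\<close> at the computed midpoint value, so of \<open>F\<close> at that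
  value only its normal component, bounded by \<open>\<epsilon>hat\<close>, survives the projection off either range. The
  midpoint rule replaces \<open>\<Delta>\<close> over the full step by \<open>h\<close> times the derivative at the midpoint up to
  \<open>O(h\<^sup>3)\<close>, and exchanging \<open>A\<close> for the computed value costs \<open>L * \<mu>\<close>. The error of order \<open>h\<^sup>2\<close> at the
  other times of the step only enters multiplied by \<open>L * h\<close>. Altogether one step maps \<open>e\<close> to at most
  \<open>(1 + O(h)) e + h O(\<epsilon>hat + h \<epsilon> + h\<^sup>2) + \<theta>\<close> (\<open>midpoint_bug_step_error\<close>, \<open>step_error_collect\<close>), and
  \<open>discrete_gronwall\<close> sums this up.

  All constants have to be independent of the dimensions \<open>m\<close> and \<open>n\<close>. Therefore no estimate is
  made entry by entry: differentiable curves are compared by a mean value inequality in the Frobenius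
  norm, and the projections act as contractions of that norm.\<close>

declare minus_carrier_mat [simp]

section \<open>The Frobenius inner product\<close>

definition frob_inner :: "real mat \<Rightarrow> real mat \<Rightarrow> real" where
  "frob_inner A B = (\<Sum>i<dim_row A. \<Sum>j<dim_col A. A $$ (i, j) * B $$ (i, j))"

text \<open>This form gives access to the triangle and Cauchy-Schwarz inequalities for square sums.\<close>

lemma frob_L2_set:
  assumes "A \<in> carrier_mat m n"
  shows "frob A = L2_set (\<lambda>p. A $$ p) ({..<m} \<times> {..<n})"
  using assms by (simp add: frob_def L2_set_def sum.cartesian_product case_prod_unfold)

lemma frob_nonneg [simp]: "0 \<le> frob A"
  by (simp add: frob_def sum_nonneg)

lemma frob_power2: "(frob A)\<^sup>2 = frob_inner A A"
  by (simp add: frob_def frob_inner_def sum_nonneg power2_eq_square)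

lemma frob_inner_le:
  assumes "A \<in> carrier_mat m n" "B \<in> carrier_mat m n"
  shows "frob_inner A B \<le> frob A * frob B"
proof -
  let ?I = "{..<m} \<times> {..<n}"
  have "frob_inner A B = (\<Sum>p\<in>?I. A $$ p * B $$ p)"
    using assms by (simp add: frob_inner_def sum.cartesian_product case_prod_unfold)
  also have "\<dots> \<le> (\<Sum>p\<in>?I. \<bar>A $$ p\<bar> * \<bar>B $$ p\<bar>)"
    by (rule sum_mono) (metis abs_ge_self abs_mult)
  also have "\<dots> \<le> frob A * frob B"
    unfolding frob_L2_set[OF assms(1)] frob_L2_set[OF assms(2)] by (rule L2_set_mult_ineq)
  finally show ?thesis .
qed

lemma frob_triangle:
  assumes "A \<in> carrier_mat m n" "B \<in> carrier_mat m n"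
  shows "frob (A + B) \<le> frob A + frob B"
proof -
  have "frob (A + B) = L2_set (\<lambda>p. (A + B) $$ p) ({..<m} \<times> {..<n})"
    using assms by (intro frob_L2_set) auto
  also have "\<dots> = L2_set (\<lambda>p. A $$ p + B $$ p) ({..<m} \<times> {..<n})"
    using assms by (intro L2_set_cong) auto
  also have "\<dots> \<le> frob A + frob B"
    unfolding frob_L2_set[OF assms(1)] frob_L2_set[OF assms(2)] by (rule L2_set_triangle_ineq)
  finally show ?thesis .
qed

lemma frob_smult: "frob (c \<cdot>\<^sub>m A) = \<bar>c\<bar> * frob A"
proof -
  have "(\<Sum>i<dim_row A. \<Sum>j<dim_col A. ((c \<cdot>\<^sub>m A) $$ (i, j))\<^sup>2)
      = c\<^sup>2 * (\<Sum>i<dim_row A. \<Sum>j<dim_col A. (A $$ (i, j))\<^sup>2)"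
    by (simp add: sum_distrib_left power_mult_distrib)
  then show ?thesis by (simp add: frob_def real_sqrt_mult)
qed

lemma frob_transpose [simp]: "frob A\<^sup>T = frob A"
proof -
  have "(\<Sum>i<dim_col A. \<Sum>j<dim_row A. (A\<^sup>T $$ (i, j))\<^sup>2)
      = (\<Sum>i<dim_col A. \<Sum>j<dim_row A. (A $$ (j, i))\<^sup>2)"
    by (intro sum.cong refl) auto
  then show ?thesis by (simp add: frob_def sum.swap[of _ "{..<dim_row A}"])
qed

lemma frob_zero [simp]: "frob (0\<^sub>m m n) = 0"
  by (simp add: frob_def)

lemma frob_minus_commute:
  assumes "A \<in> carrier_mat m n" "B \<in> carrier_mat m n"
  shows "frob (A - B) = frob (B - A)"
proof -
  have "A - B = (-1) \<cdot>\<^sub>m (B - A)" using assms by auto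
  then have "frob (A - B) = \<bar>- 1\<bar> * frob (B - A)" by (simp only: frob_smult)
  then show ?thesis by simp
qed

lemma frob_minus_triangle:
  assumes "A \<in> carrier_mat m n" "B \<in> carrier_mat m n" "C \<in> carrier_mat m n"
  shows "frob (A - C) \<le> frob (A - B) + frob (B - C)"
proof -
  have "A - C = (A - B) + (B - C)" using assms by auto
  then show ?thesis using frob_triangle[of "A - B" m n "B - C"] assms by auto
qed

lemma frob_le_add_minus:
  assumes "A \<in> carrier_mat m n" "B \<in> carrier_mat m n"
  shows "frob A \<le> frob B + frob (A - B)"
proof -
  have "A = B + (A - B)" using assms by auto
  then show ?thesis using frob_triangle[of B m n "A - B"] assms by auto
qed

lemma frob_inner_mult_left:
  assumes "W \<in> carrier_mat p q" "X \<in> carrier_mat q n" "Y \<in> carrier_mat p n"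
  shows "frob_inner (W * X) Y = frob_inner X (W\<^sup>T * Y)"
proof -
  have "frob_inner (W * X) Y
      = (\<Sum>i<p. \<Sum>j<n. \<Sum>k<q. W $$ (i, k) * X $$ (k, j) * Y $$ (i, j))"
    using assms by (auto simp: frob_inner_def scalar_prod_def sum_distrib_right atLeast0LessThan
        intro!: sum.cong)
  also have "\<dots> = (\<Sum>i<p. \<Sum>k<q. \<Sum>j<n. W $$ (i, k) * X $$ (k, j) * Y $$ (i, j))"
    by (rule sum.cong[OF refl], rule sum.swap)
  also have "\<dots> = (\<Sum>k<q. \<Sum>i<p. \<Sum>j<n. W $$ (i, k) * X $$ (k, j) * Y $$ (i, j))"
    by (rule sum.swap)
  also have "\<dots> = (\<Sum>k<q. \<Sum>j<n. \<Sum>i<p. W $$ (i, k) * X $$ (k, j) * Y $$ (i, j))"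
    by (rule sum.cong[OF refl], rule sum.swap)
  also have "\<dots> = frob_inner X (W\<^sup>T * Y)"
    using assms by (auto simp: frob_inner_def scalar_prod_def sum_distrib_left atLeast0LessThan
        mult.assoc mult.left_commute intro!: sum.cong)
  finally show ?thesis .
qed

lemma frob_inner_commute:
  assumes "A \<in> carrier_mat m n" "B \<in> carrier_mat m n"
  shows "frob_inner A B = frob_inner B A"
  using assms by (simp add: frob_inner_def mult.commute)

lemma frob_inner_minus_right:
  assumes "A \<in> carrier_mat m n" "B \<in> carrier_mat m n" "C \<in> carrier_mat m n"
  shows "frob_inner A (B - C) = frob_inner A B - frob_inner A C"
  using assms by (simp add: frob_inner_def sum_subtractf[symmetric] right_diff_distrib)

section \<open>Contractions and orthogonal projections\<close>

text \<open>The bound is required for any number of columns of the second factor; this is the operator norm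
  bound \<open>\<le> 1\<close>, in the form in which it is applied to products of matrices.\<close>

definition contraction :: "nat \<Rightarrow> nat \<Rightarrow> real mat \<Rightarrow> bool" where
  "contraction p q W \<longleftrightarrow>
     W \<in> carrier_mat p q \<and> (\<forall>n. \<forall>X\<in>carrier_mat q n. frob (W * X) \<le> frob X)"

lemma contraction_frob_left:
  "contraction p q W \<Longrightarrow> X \<in> carrier_mat q n \<Longrightarrow> frob (W * X) \<le> frob X"
  by (auto simp: contraction_def)

lemma contraction_frob_right:
  assumes "contraction p q W" "X \<in> carrier_mat n q"
  shows "frob (X * W\<^sup>T) \<le> frob X"
proof -
  have "frob (X * W\<^sup>T) = frob (W * X\<^sup>T)"
    using assms frob_transpose[of "X * W\<^sup>T"] transpose_mult[of X n q "W\<^sup>T" p]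
    by (auto simp: contraction_def)
  then show ?thesis
    using contraction_frob_left[OF assms(1), of "X\<^sup>T" n] assms(2) by simp
qed

lemma contraction_mult:
  assumes "contraction p q W" "contraction q r W'"
  shows "contraction p r (W * W')"
  unfolding contraction_def
proof (intro conjI allI ballI)
  show "W * W' \<in> carrier_mat p r" using assms by (auto simp: contraction_def)
  fix n and X :: "real mat" assume X: "X \<in> carrier_mat r n"
  have "W * W' * X = W * (W' * X)"
    using assms X by (intro assoc_mult_mat) (auto simp: contraction_def)
  moreover have "W' * X \<in> carrier_mat q n" using assms(2) X by (auto simp: contraction_def)
  ultimately show "frob (W * W' * X) \<le> frob X"
    using contraction_frob_left[OF assms(1)] contraction_frob_left[OF assms(2) X]
    by (metis order_trans)
qed

lemma orthonormal_colsD: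
  assumes "orthonormal_cols p k W"
  shows "W \<in> carrier_mat p k" "W\<^sup>T * W = 1\<^sub>m k"
  using assms by (auto simp: orthonormal_cols_def)

lemma contraction_orthonormal:
  assumes "orthonormal_cols p k W"
  shows "contraction p k W"
  unfolding contraction_def
proof (intro conjI allI ballI)
  note W = orthonormal_colsD[OF assms]
  show "W \<in> carrier_mat p k" by fact
  fix n and X :: "real mat" assume X: "X \<in> carrier_mat k n"
  have "(frob (W * X))\<^sup>2 = frob_inner X (W\<^sup>T * (W * X))"
    unfolding frob_power2 by (rule frob_inner_mult_left) (use W X in auto)
  also have "W\<^sup>T * (W * X) = W\<^sup>T * W * X"
    by (rule assoc_mult_mat[symmetric]) (use W X in auto)
  finally have "(frob (W * X))\<^sup>2 = (frob X)\<^sup>2" using W X by (simp add: frob_power2)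
  then show "frob (W * X) \<le> frob X" by (simp add: power2_le_imp_le)
qed

text \<open>The Cauchy-Schwarz inequality for \<open>(W W\<^sup>T X, X)\<close>, which equals the square of the norm of
  \<open>W\<^sup>T X\<close>, leaves one factor \<open>frob (W\<^sup>T X)\<close> to cancel.\<close>

lemma contraction_orthonormal_transpose:
  assumes "orthonormal_cols p k W"
  shows "contraction k p W\<^sup>T"
  unfolding contraction_def
proof (intro conjI allI ballI)
  note W = orthonormal_colsD[OF assms]
  show "W\<^sup>T \<in> carrier_mat k p" using W by simp
  fix n and X :: "real mat" assume X: "X \<in> carrier_mat p n"
  have "(frob (W\<^sup>T * X))\<^sup>2 = frob_inner (W * (W\<^sup>T * X)) X"
    unfolding frob_power2 using frob_inner_mult_left[of W p k "W\<^sup>T * X" n X] W X by auto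
  also have "\<dots> \<le> frob (W * (W\<^sup>T * X)) * frob X"
    by (rule frob_inner_le) (use W X in auto)
  also have "\<dots> \<le> frob (W\<^sup>T * X) * frob X"
    by (intro mult_right_mono contraction_frob_left[OF contraction_orthonormal[OF assms]])
      (use W X in auto)
  finally show "frob (W\<^sup>T * X) \<le> frob X"
    by (metis frob_nonneg mult_le_cancel_left_pos order_le_less power2_eq_square)
qed

text \<open>For orthonormal columns these are the orthogonal projections onto the range of \<open>W\<close> and onto its
  orthogonal complement.\<close>

definition range_proj :: "real mat \<Rightarrow> real mat" where
  "range_proj W = W * W\<^sup>T"

definition range_coproj :: "real mat \<Rightarrow> real mat" where
  "range_coproj W = 1\<^sub>m (dim_row W) - W * W\<^sup>T"

lemma range_proj_carrier:
  "W \<in> carrier_mat p k \<Longrightarrow> range_proj W \<in> carrier_mat p p"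
  "W \<in> carrier_mat p k \<Longrightarrow> range_coproj W \<in> carrier_mat p p"
  by (auto simp: range_proj_def range_coproj_def)

lemma range_proj_transpose [simp]:
  "(range_proj W)\<^sup>T = range_proj W"
  by (simp add: range_proj_def transpose_mult[OF carrier_matI carrier_matI])

lemma range_coproj_transpose [simp]:
  "(range_coproj W)\<^sup>T = range_coproj W"
proof -
  have c: "W * W\<^sup>T \<in> carrier_mat (dim_row W) (dim_row W)" by (intro carrier_matI) auto
  have "(W * W\<^sup>T)\<^sup>T = W * W\<^sup>T" using range_proj_transpose[of W] unfolding range_proj_def .
  then show ?thesis
    unfolding range_coproj_def by (subst transpose_minus[OF one_carrier_mat c]) simp
qed

lemma range_coproj_mult:
  assumes "W \<in> carrier_mat p k" "X \<in> carrier_mat p n"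
  shows "range_coproj W * X = X - range_proj W * X"
  using assms minus_mult_distrib_mat[of "1\<^sub>m p" p p "W * W\<^sup>T" X n]
  by (auto simp: range_proj_def range_coproj_def)

lemma contraction_range_proj:
  assumes "orthonormal_cols p k W"
  shows "contraction p p (range_proj W)"
  unfolding range_proj_def
  by (rule contraction_mult[OF contraction_orthonormal[OF assms]
        contraction_orthonormal_transpose[OF assms]])

text \<open>Pythagoras: the residual \<open>X - R\<close> of the projection \<open>R\<close> is orthogonal to \<open>R\<close>.\<close>

lemma contraction_range_coproj:
  assumes "orthonormal_cols p k W"
  shows "contraction p p (range_coproj W)"
  unfolding contraction_def
proof (intro conjI allI ballI)
  note W = orthonormal_colsD[OF assms]
  note c = range_proj_carrier[OF W(1)]
  show "range_coproj W \<in> carrier_mat p p" by (fact c)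
  fix n and X :: "real mat" assume X: "X \<in> carrier_mat p n"
  define R where "R = range_proj W * X"
  have R: "R \<in> carrier_mat p n" using c X by (auto simp: R_def)
  have R': "R = W * (W\<^sup>T * X)"
    unfolding R_def range_proj_def by (rule assoc_mult_mat) (use W X in auto)
  have "W\<^sup>T * R = W\<^sup>T * W * (W\<^sup>T * X)"
    unfolding R' by (rule assoc_mult_mat[symmetric]) (use W X in auto)
  then have WR: "W\<^sup>T * R = W\<^sup>T * X" using W X by auto
  have XR: "frob_inner Z R = frob_inner (W\<^sup>T * X) (W\<^sup>T * Z)" if "Z \<in> carrier_mat p n" for Z
  proof -
    have "frob_inner Z R = frob_inner (W * (W\<^sup>T * X)) Z"
      unfolding R' by (rule frob_inner_commute) (use W X that in auto)
    also have "\<dots> = frob_inner (W\<^sup>T * X) (W\<^sup>T * Z)"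
      by (rule frob_inner_mult_left) (use W X that in auto)
    finally show ?thesis .
  qed
  have c: "frob_inner (X - R) X = frob_inner X (X - R)"
    by (rule frob_inner_commute) (use X R in auto)
  have "(frob (X - R))\<^sup>2 = frob_inner (X - R) X - frob_inner (X - R) R"
    unfolding frob_power2 by (rule frob_inner_minus_right) (use X R in auto)
  also have "frob_inner (X - R) R = 0"
  proof -
    have "W\<^sup>T * (X - R) = W\<^sup>T * X - W\<^sup>T * R"
      by (rule mult_minus_distrib_mat) (use W X R in auto)
    then have "W\<^sup>T * (X - R) = 0\<^sub>m k n" using WR W X by auto
    then show ?thesis using XR[of "X - R"] X R W by (simp add: frob_inner_def)
  qed
  also have "frob_inner (X - R) X = frob_inner X X - frob_inner X R"
    unfolding c by (rule frob_inner_minus_right) (use X R in auto)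
  also have "frob_inner X R = (frob (W\<^sup>T * X))\<^sup>2"
    unfolding frob_power2 by (rule XR[OF X])
  finally have "(frob (X - R))\<^sup>2 \<le> (frob X)\<^sup>2"
    using zero_le_power2[of "frob (W\<^sup>T * X)"] frob_power2[of X] by linarith
  then have "frob (X - R) \<le> frob X" by (rule power2_le_imp_le) simp
  then show "frob (range_coproj W * X) \<le> frob X"
    using range_coproj_mult[OF W(1) X] by (simp add: R_def)
qed

lemma mult_range_coproj:
  assumes "V \<in> carrier_mat n k" "X \<in> carrier_mat p n"
  shows "X * range_coproj V = X - X * range_proj V"
  using assms mult_minus_distrib_mat[of X p n "1\<^sub>m n" n "V * V\<^sup>T"]
  by (auto simp: range_proj_def range_coproj_def)

lemma range_coproj_self:
  assumes "orthonormal_cols p k W"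
  shows "range_coproj W * W = 0\<^sub>m p k"
proof -
  note W = orthonormal_colsD[OF assms]
  have "W * W\<^sup>T * W = W * (W\<^sup>T * W)" by (rule assoc_mult_mat) (use W in auto)
  then show ?thesis using W range_coproj_mult[of W p k W k] by (auto simp: range_proj_def)
qed

text \<open>Typically \<open>Q\<close> is the complementary projection of a basis larger than \<open>U\<close>; read from right to left,
  the equation then brings the complementary projection of \<open>U\<close> into an expression.\<close>

lemma range_coproj_absorb:
  assumes "Q \<in> carrier_mat q p" "U \<in> carrier_mat p k" "Q * U = 0\<^sub>m q k"
  shows "Q * range_coproj U = Q"
proof -
  have "Q * (U * U\<^sup>T) = Q * U * U\<^sup>T" by (rule assoc_mult_mat[symmetric]) (use assms in auto)
  then show ?thesis using mult_range_coproj[of U p k Q q] assms by (auto simp: range_proj_def)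
qed

lemma minus_zero_mat:
  fixes X :: "real mat"
  assumes "X \<in> carrier_mat p q"
  shows "X - 0\<^sub>m p q = X"
  using assms by (intro eq_matI) auto

lemma range_proj_id:
  assumes W: "W \<in> carrier_mat p k" and X: "X \<in> carrier_mat p n" and 0: "range_coproj W * X = 0\<^sub>m p n"
  shows "range_proj W * X = X"
proof (rule eq_matI)
  note P = range_proj_carrier(1)[OF W]
  have PX: "range_proj W * X \<in> carrier_mat p n" using P X by auto
  fix i j assume "i < dim_row X" "j < dim_col X"
  then have ij: "i < p" "j < n" using X by auto
  have "(X - range_proj W * X) $$ (i, j) = 0"
    unfolding range_coproj_mult[OF W X, symmetric] 0 using ij by simp
  moreover have "(X - range_proj W * X) $$ (i, j) = X $$ (i, j) - (range_proj W * X) $$ (i, j)"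
    by (rule index_minus_mat) (use PX ij in auto)
  ultimately show "(range_proj W * X) $$ (i, j) = X $$ (i, j)" by simp
qed (use X range_proj_carrier(1)[OF W] in auto)

lemma sandwich_minus:
  fixes P :: "real mat"
  assumes "P \<in> carrier_mat p m" "Q \<in> carrier_mat n q" "X \<in> carrier_mat m n" "Z \<in> carrier_mat m n"
  shows "P * (X - Z) * Q = P * X * Q - P * Z * Q"
proof -
  have "P * (X - Z) = P * X - P * Z" by (rule mult_minus_distrib_mat) (use assms in auto)
  then show ?thesis
    using minus_mult_distrib_mat[of "P * X" p n "P * Z" Q q] assms by auto
qed

lemma frob_sandwich_le:
  assumes "contraction p m P" "contraction q n Q" "X \<in> carrier_mat m n"
  shows "frob (P * X * Q\<^sup>T) \<le> frob X"
proof -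
  have "frob (P * X * Q\<^sup>T) \<le> frob (P * X)"
    using assms by (intro contraction_frob_right[OF assms(2), where n = p])
      (auto simp: contraction_def)
  also have "\<dots> \<le> frob X" by (rule contraction_frob_left[OF assms(1,3)])
  finally show ?thesis .
qed

lemma frob_proj_sandwich_le:
  assumes "orthonormal_cols m k U" "orthonormal_cols n l V" "X \<in> carrier_mat m n"
  shows "frob (range_proj U * X * range_proj V) \<le> frob X"
  using frob_sandwich_le[OF contraction_range_proj[OF assms(1)] contraction_range_proj[OF assms(2)]
      assms(3)] by simp

text \<open>The defect of the two-sided projection splits into a left and a right defect; the latter is
  transposed, so that one-sided estimates for the row space follow from those for the column space.\<close>

lemma frob_proj_defect_le:
  assumes U: "orthonormal_cols m k U" and V: "orthonormal_cols n l V" and X: "X \<in> carrier_mat m n"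
  shows "frob (X - range_proj U * X * range_proj V)
    \<le> frob (range_coproj U * X) + frob (range_coproj V * X\<^sup>T)"
proof -
  note Uc = orthonormal_colsD(1)[OF U] and Vc = orthonormal_colsD(1)[OF V]
  note c = range_proj_carrier[OF Uc] range_proj_carrier[OF Vc]
  have PX: "range_proj U * X \<in> carrier_mat m n" "X * range_proj V \<in> carrier_mat m n"
    using c X by auto
  have "range_proj U * (X - X * range_proj V) = range_proj U * X - range_proj U * (X * range_proj V)"
    by (rule mult_minus_distrib_mat) (use c X PX in auto)
  also have "range_proj U * (X * range_proj V) = range_proj U * X * range_proj V"
    by (rule assoc_mult_mat[symmetric]) (use c X in auto)
  finally have "X - range_proj U * X * range_proj V
      = range_coproj U * X + range_proj U * (X * range_coproj V)"
    unfolding range_coproj_mult[OF Uc X] mult_range_coproj[OF Vc X] using c X PX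
    by (intro eq_matI) auto
  then have "frob (X - range_proj U * X * range_proj V)
      \<le> frob (range_coproj U * X) + frob (range_proj U * (X * range_coproj V))"
    using c X frob_triangle[of "range_coproj U * X" m n "range_proj U * (X * range_coproj V)"] by auto
  also have "frob (range_proj U * (X * range_coproj V)) \<le> frob (X * range_coproj V)"
    by (rule contraction_frob_left[OF contraction_range_proj[OF U], where n = n]) (use c X in auto)
  also have "frob (X * range_coproj V) = frob (range_coproj V * X\<^sup>T)"
    using frob_transpose[of "X * range_coproj V"] transpose_mult[OF X c(4)] by simp
  finally show ?thesis by simp
qed

lemma mult_transpose_sandwich:
  fixes X :: "real mat"
  assumes U: "U \<in> carrier_mat m k" and V: "V \<in> carrier_mat n l" and X: "X \<in> carrier_mat m n"
  shows "U * (U\<^sup>T * X * V) * V\<^sup>T = range_proj U * X * range_proj V"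
proof -
  have "U * (U\<^sup>T * X * V) = U * (U\<^sup>T * X) * V"
    by (rule assoc_mult_mat[symmetric]) (use U V X in auto)
  also have "U * (U\<^sup>T * X) = range_proj U * X"
    unfolding range_proj_def by (rule assoc_mult_mat[symmetric]) (use U X in auto)
  also have "range_proj U * X * V * V\<^sup>T = range_proj U * X * (V * V\<^sup>T)"
    by (rule assoc_mult_mat) (use U V X range_proj_carrier(1)[OF U] in auto)
  finally show ?thesis by (simp add: range_proj_def)
qed

lemma frob_transpose_triple:
  assumes "P \<in> carrier_mat m m" "X \<in> carrier_mat m n" "Q \<in> carrier_mat n n"
  shows "frob (Q\<^sup>T * X\<^sup>T * P\<^sup>T) = frob (P * X * Q)"
proof -
  have "(P * X * Q)\<^sup>T = Q\<^sup>T * (P * X)\<^sup>T" by (rule transpose_mult) (use assms in auto)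
  also have "(P * X)\<^sup>T = X\<^sup>T * P\<^sup>T" by (rule transpose_mult) (use assms in auto)
  also have "Q\<^sup>T * (X\<^sup>T * P\<^sup>T) = Q\<^sup>T * X\<^sup>T * P\<^sup>T"
    by (rule assoc_mult_mat[symmetric]) (use assms in auto)
  finally show ?thesis using frob_transpose by metis
qed

lemma smult_eq_0_mat:
  fixes X :: "real mat"
  assumes "X \<in> carrier_mat p q" "h \<noteq> 0" "h \<cdot>\<^sub>m X = 0\<^sub>m p q"
  shows "X = 0\<^sub>m p q"
proof (rule eq_matI)
  fix i j assume ij: "i < dim_row (0\<^sub>m p q :: real mat)" "j < dim_col (0\<^sub>m p q :: real mat)"
  have "(h \<cdot>\<^sub>m X) $$ (i, j) = 0" unfolding assms(3) using ij by simp
  then show "X $$ (i, j) = 0\<^sub>m p q $$ (i, j)" using assms(1,2) ij by simp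
qed (use assms in auto)

section \<open>Bases of ranges, rank and the normal component of the field\<close>

lemma range_coproj_eq_0:
  assumes W: "orthonormal_cols p k W" and X: "X \<in> carrier_mat p n"
    and cols: "\<And>x. x \<in> set (cols X) \<Longrightarrow> x \<in> vec_space.col_space p W"
  shows "range_coproj W * X = 0\<^sub>m p n"
proof (rule mat_col_eqI)
  note Wc = orthonormal_colsD(1)[OF W]
  note Q = range_proj_carrier(2)[OF Wc]
  show "dim_row (range_coproj W * X) = dim_row (0\<^sub>m p n)"
    "dim_col (range_coproj W * X) = dim_col (0\<^sub>m p n)" using Q X by auto
  fix j assume j: "j < dim_col (0\<^sub>m p n :: real mat)"
  then have "col X j \<in> set (cols X)" using X by (auto simp: cols_def)
  from cols[OF this] obtain c where c: "c \<in> carrier_vec k" "W *\<^sub>v c = col X j"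
    using vec_space.col_space_eq[OF Wc] Wc by auto
  have "col (range_coproj W * X) j = range_coproj W *\<^sub>v col X j"
    by (rule col_mult2) (use Q X j in auto)
  also have "\<dots> = range_coproj W * W *\<^sub>v c"
    unfolding c(2)[symmetric] by (rule assoc_mult_mat_vec[symmetric]) (use Q Wc c in auto)
  also have "\<dots> = col (0\<^sub>m p n) j" using c j by (auto simp: range_coproj_self[OF W] scalar_prod_def)
  finally show "col (range_coproj W * X) j = col (0\<^sub>m p n) j" .
qed

lemma low_rank_factD:
  assumes "low_rank_fact m n r U S V Y"
  shows "orthonormal_cols m r U" "orthonormal_cols n r V" "U \<in> carrier_mat m r"
    "V \<in> carrier_mat n r" "S \<in> carrier_mat r r" "Y \<in> carrier_mat m n" "Y = U * S * V\<^sup>T"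
  using assms by (auto simp: low_rank_fact_def orthonormal_cols_def)

text \<open>\<open>U = Y V S\<inverse>\<close> shows that \<open>Y\<close> and \<open>U\<close> have the same column space, and the orthonormal columns of \<open>U\<close>
  are linearly independent.\<close>

lemma low_rank_fact_rank:
  assumes f: "low_rank_fact m n r U S V Y"
  shows "vec_space.rank m Y = r"
proof -
  interpret vec_space "TYPE(real)" m .
  note d = low_rank_factD[OF f]
  note U = orthonormal_colsD[OF d(1)]
  note V = orthonormal_colsD[OF d(2)]
  have entry: "col U i \<bullet> col U j = (if i = j then 1 else 0)" if "i < r" "j < r" for i j
  proof -
    have "(U\<^sup>T * U) $$ (i, j) = col U i \<bullet> col U j" using U(1) that by simp
    then show ?thesis using that by (simp add: U(2))
  qed
  have dist: "distinct (cols U)"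
    unfolding distinct_conv_nth
  proof (intro allI impI)
    fix i j assume "i < length (cols U)" "j < length (cols U)" and ij: "i \<noteq> j"
    then have "i < r" "j < r" using U(1) by auto
    then show "cols U ! i \<noteq> cols U ! j"
      using entry[of i j] entry[of i i] ij U(1) by auto
  qed
  have "lin_indpt (set (cols U))"
  proof (rule ccontr)
    assume "\<not> lin_indpt (set (cols U))"
    then obtain v where v: "v \<in> carrier_vec r" "v \<noteq> 0\<^sub>v r" "U *\<^sub>v v = 0\<^sub>v m"
      using lin_depE[OF U(1) _ dist] by auto
    have "v = U\<^sup>T * U *\<^sub>v v" using v(1) by (simp add: U(2))
    also have "\<dots> = U\<^sup>T *\<^sub>v (U *\<^sub>v v)" by (rule assoc_mult_mat_vec) (use U v in auto)
    also have "\<dots> = 0\<^sub>v r" using v(3) U(1) by auto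
    finally show False using v(2) by simp
  qed
  then have rU: "rank U = r" by (rule lin_indpt_full_rank[OF U(1) dist])
  obtain B where B: "B \<in> carrier_mat r r" "S * B = 1\<^sub>m r"
  proof -
    from f obtain B where B: "S * B = 1\<^sub>m r" "B * S = 1\<^sub>m (dim_row B)"
      using d(5) by (auto simp: low_rank_fact_def invertible_mat_def inverts_mat_def)
    then have "B \<in> carrier_mat r r"
      using d(5) by (metis carrier_matI carrier_matD(2) index_mult_mat(3) index_one_mat(3))
    with B(1) that show ?thesis by blast
  qed
  have Y: "Y = U * (S * V\<^sup>T)"
    unfolding d(7) by (rule assoc_mult_mat) (use d in auto)
  have VB: "V\<^sup>T * (V * B) = B"
    using assoc_mult_mat[of "V\<^sup>T" r n V r B r] V B by simp
  have UY: "U = Y * (V * B)"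
  proof -
    have "Y * (V * B) = U * S * (V\<^sup>T * (V * B))"
      unfolding d(7) by (rule assoc_mult_mat) (use d B in auto)
    also have "\<dots> = U * (S * B)" unfolding VB by (rule assoc_mult_mat) (use d B in auto)
    finally show ?thesis using B(2) d(3) by simp
  qed
  have "col_space Y = col_space U"
  proof
    show "col_space Y \<subseteq> col_space U"
    proof
      fix y assume "y \<in> col_space Y"
      then obtain x where x: "x \<in> carrier_vec n" "Y *\<^sub>v x = y" "y \<in> carrier_vec m"
        using col_space_eq[OF d(6)] d(6) by auto
      have "Y *\<^sub>v x = U *\<^sub>v ((S * V\<^sup>T) *\<^sub>v x)"
        unfolding Y by (rule assoc_mult_mat_vec) (use d x in auto)
      moreover have "(S * V\<^sup>T) *\<^sub>v x \<in> carrier_vec r" using d x by auto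
      ultimately show "y \<in> col_space U" using col_space_eq[OF U(1)] U(1) x by auto
    qed
    show "col_space U \<subseteq> col_space Y"
    proof
      fix y assume "y \<in> col_space U"
      then obtain x where x: "x \<in> carrier_vec r" "U *\<^sub>v x = y" "y \<in> carrier_vec m"
        using col_space_eq[OF U(1)] U(1) by auto
      have "Y * (V * B) *\<^sub>v x = Y *\<^sub>v ((V * B) *\<^sub>v x)"
        by (rule assoc_mult_mat_vec) (use d B x in auto)
      then have "Y *\<^sub>v ((V * B) *\<^sub>v x) = y" using UY x(2) by simp
      moreover have "(V * B) *\<^sub>v x \<in> carrier_vec n" using d B x by auto
      ultimately show "y \<in> col_space Y" using col_space_eq[OF d(6)] d(6) x by auto
    qed
  qed
  then have "rank Y = rank U" by (simp add: rank_def col_space_def)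
  then show ?thesis using rU by simp
qed

text \<open>The normal component is the projection off the column space and off the row space. In this form
  it makes sense for any two orthonormal bases, whether or not the matrix between them is invertible.\<close>

lemma tangent_proj_perp_eq:
  assumes f: "low_rank_fact m n r U S V Y" and Z: "Z \<in> carrier_mat m n"
  shows "tangent_proj_perp r Y Z = range_coproj U * Z * range_coproj V"
proof -
  note d = low_rank_factD[OF f]
  note c = range_proj_carrier[OF d(3)] range_proj_carrier[OF d(4)]
  have a: "X * V * V\<^sup>T = X * range_proj V" if "X \<in> carrier_mat m n" for X
    unfolding range_proj_def by (rule assoc_mult_mat) (use that d in auto)
  have PZ: "range_proj U * Z \<in> carrier_mat m n" using c Z by auto
  have "range_coproj U * Z * range_coproj V
      = (Z - range_proj U * Z) - (Z - range_proj U * Z) * range_proj V"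
    using range_coproj_mult[OF d(3) Z] mult_range_coproj[OF d(4), of "Z - range_proj U * Z" m] PZ
    by simp
  also have "(Z - range_proj U * Z) * range_proj V = Z * range_proj V - range_proj U * Z * range_proj V"
    by (rule minus_mult_distrib_mat) (use Z PZ c in auto)
  also have "(Z - range_proj U * Z) - (Z * range_proj V - range_proj U * Z * range_proj V)
      = Z - (Z * range_proj V - range_proj U * Z * range_proj V + range_proj U * Z)"
    by (rule eq_matI) (use Z PZ c in auto)
  finally show ?thesis
    unfolding tangent_proj_perp_def tangent_proj_eq[OF f Z]
    using a[OF Z] a[OF PZ] by (simp add: range_proj_def)
qed

text \<open>The range of \<open>W\<close> contains that of \<open>U\<close>, so projecting off the former leaves no more than
  projecting off the latter.\<close>

lemma frob_coproj_residual:
  assumes W: "orthonormal_cols m k W" and U: "U \<in> carrier_mat m r" and V: "V \<in> carrier_mat n s"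
    and Z: "Z \<in> carrier_mat m n" and WU: "range_coproj W * U = 0\<^sub>m m r"
  shows "frob (range_coproj W * (Z * range_coproj V)) \<le> frob (range_coproj U * Z * range_coproj V)"
proof -
  note c = range_proj_carrier(2)[OF U] range_proj_carrier(2)[OF V]
    range_proj_carrier(2)[OF orthonormal_colsD(1)[OF W]]
  have "range_coproj W * (Z * range_coproj V)
      = range_coproj W * range_coproj U * (Z * range_coproj V)"
    using range_coproj_absorb[OF c(3) U WU] by simp
  also have "\<dots> = range_coproj W * (range_coproj U * (Z * range_coproj V))"
    by (rule assoc_mult_mat) (use c Z in auto)
  also have "range_coproj U * (Z * range_coproj V) = range_coproj U * Z * range_coproj V"
    by (rule assoc_mult_mat[symmetric]) (use c Z in auto)
  finally show ?thesis
    using contraction_frob_left[OF contraction_range_coproj[OF W],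
        of "range_coproj U * Z * range_coproj V" n] c Z by auto
qed

text \<open>If moreover the range of \<open>W\<close> contains that of \<open>Z V\<close>, the row space part is already annihilated.
  This is why the second step augments the bases by \<open>F V\<close> and \<open>F\<^sup>T U\<close>.\<close>

lemma frob_coproj_residual_range:
  assumes W: "orthonormal_cols m k W" and U: "U \<in> carrier_mat m r" and V: "V \<in> carrier_mat n s"
    and Z: "Z \<in> carrier_mat m n" and WU: "range_coproj W * U = 0\<^sub>m m r"
    and WZ: "range_coproj W * (Z * V) = 0\<^sub>m m s"
  shows "frob (range_coproj W * Z) \<le> frob (range_coproj U * Z * range_coproj V)"
proof -
  note c = range_proj_carrier(2)[OF U] range_proj_carrier(2)[OF V]
    range_proj_carrier(2)[OF orthonormal_colsD(1)[OF W]]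
  have "range_coproj W * (Z * range_coproj V) = range_coproj W * Z * range_coproj V"
    by (rule assoc_mult_mat[symmetric]) (use c Z in auto)
  also have "\<dots> = range_coproj W * Z"
    using WZ assoc_mult_mat[OF c(3) Z V] c Z by (intro range_coproj_absorb[OF _ V]) auto
  finally show ?thesis using frob_coproj_residual[OF W U V Z WU] by simp
qed

lemma is_orthD:
  assumes "is_orth p k Xs W" shows "orthonormal_cols p k W"
  using assms by (simp add: is_orth_def)

lemma is_orth_annihilates:
  assumes W: "is_orth p k Xs W" and Xs: "\<And>X. X \<in> set Xs \<Longrightarrow> dim_row X = p"
    and X: "X \<in> set Xs"
  shows "range_coproj W * X = 0\<^sub>m p (dim_col X)"
proof (rule range_coproj_eq_0[OF is_orthD[OF W]])
  let ?L = "concat (map cols Xs)"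
  interpret vec_space "TYPE(real)" p .
  show "X \<in> carrier_mat p (dim_col X)" using Xs[OF X] by auto
  have L: "set ?L \<subseteq> carrier_vec p"
    using Xs by (fastforce simp: cols_def)
  fix x assume "x \<in> set (cols X)"
  then have "x \<in> set ?L" using X by auto
  then have "x \<in> span (set ?L)" using L by (rule span_mem[rotated])
  moreover have "col_space W = col_space (mat_of_cols p ?L)" using W by (simp add: is_orth_def)
  ultimately show "x \<in> col_space W" unfolding col_space_def using L by simp
qed

lemma is_orth_pair_annihilates:
  assumes W: "is_orth p k [X, Z] W" and X: "X \<in> carrier_mat p q" and Z: "Z \<in> carrier_mat p s"
  shows "range_coproj W * X = 0\<^sub>m p q" "range_coproj W * Z = 0\<^sub>m p s"
  using is_orth_annihilates[OF W, of X] is_orth_annihilates[OF W, of Z] X Z by auto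

text \<open>Only finitely many shifts are excluded, the negatives of the eigenvalues of \<open>S\<close>.\<close>

lemma exists_invertible_shift:
  fixes S :: "real mat"
  assumes S: "S \<in> carrier_mat k k" and d: "0 < d"
  shows "\<exists>\<eta>. 0 < \<eta> \<and> \<eta> < d \<and> invertible_mat (S + \<eta> \<cdot>\<^sub>m 1\<^sub>m k)"
proof -
  let ?bad = "uminus ` {x. poly (char_poly S) x = 0}"
  have "char_poly S \<noteq> 0" using degree_monic_char_poly[OF S] by auto
  then have "finite ?bad" by (simp add: poly_roots_finite)
  then have "\<not> {0<..<d} \<subseteq> ?bad" using d by (metis finite_subset infinite_Ioo)
  then obtain \<eta> where "\<eta> \<in> {0<..<d}" and \<eta>': "\<eta> \<notin> ?bad" by blast
  then have \<eta>: "0 < \<eta>" "\<eta> < d" "\<eta> \<notin> ?bad" by auto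
  let ?M = "S + \<eta> \<cdot>\<^sub>m 1\<^sub>m k"
  have M: "?M \<in> carrier_mat k k" using S by simp
  have "poly (char_poly S) (- \<eta>) \<noteq> 0"
    using \<eta>(3) by (metis (mono_tags, lifting) image_eqI mem_Collect_eq minus_minus)
  then have "det (char_matrix S (- \<eta>)) \<noteq> 0"
    using eigenvalue_root_char_poly[OF S] eigenvalue_det[OF S] by auto
  then have "det ?M \<noteq> 0" using S by (simp add: char_matrix_def)
  from det_non_zero_imp_unit[OF M this, unfolded Units_def, of "()"]
  obtain B where "B \<in> carrier_mat k k" "B * ?M = 1\<^sub>m k" "?M * B = 1\<^sub>m k"
    by (auto simp: ring_mat_def)
  then have "invertible_mat ?M"
    unfolding invertible_mat_def inverts_mat_def using M by (intro conjI exI[of _ B]) auto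
  with \<eta> show ?thesis by blast
qed

text \<open>The middle factor \<open>S\<close> of the computed midpoint value may be singular, and then that value does not
  belong to the manifold of rank \<open>k\<close> on which the normal component is assumed to be small. It is
  however a limit of matrices \<open>U (S + \<eta> I) V\<^sup>T\<close> of rank \<open>k\<close> with the same bases, and hence the same
  projections, and \<open>G\<close> is continuous.\<close>

lemma frob_normal_component_le:
  assumes U: "orthonormal_cols m k U" and V: "orthonormal_cols n k V" and S: "S \<in> carrier_mat k k"
    and G: "\<And>X. X \<in> carrier_mat m n \<Longrightarrow> G X \<in> carrier_mat m n"
    and Lip: "\<And>X Z. X \<in> carrier_mat m n \<Longrightarrow> Z \<in> carrier_mat m n \<Longrightarrow>
      frob (G X - G Z) \<le> L * frob (X - Z)"
    and C: "C \<in> carrier_mat m n" and near: "frob (U * S * V\<^sup>T - C) < \<rho>"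
    and small: "\<And>X. X \<in> fixed_rank_mats m n k \<Longrightarrow> frob (X - C) < \<rho> \<Longrightarrow>
      frob (tangent_proj_perp k X (G X)) \<le> \<epsilon>"
  shows "frob (range_coproj U * G (U * S * V\<^sup>T) * range_coproj V) \<le> \<epsilon>"
proof (rule field_le_epsilon)
  fix e :: real assume e: "0 < e"
  note Uc = orthonormal_colsD(1)[OF U] and Vc = orthonormal_colsD(1)[OF V]
  note cU = range_proj_carrier(2)[OF Uc] and cV = range_proj_carrier(2)[OF Vc]
  define Y where "Y = U * S * V\<^sup>T"
  define E where "E = U * V\<^sup>T"
  define gap where "gap = \<rho> - frob (Y - C)"
  have Y: "Y \<in> carrier_mat m n" and E: "E \<in> carrier_mat m n"
    using Uc Vc S by (auto simp: Y_def E_def)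
  have gap: "0 < gap" using near by (simp add: gap_def Y_def)
  define d where "d = min (e / (\<bar>L\<bar> * frob E + 1)) (gap / (frob E + 1))"
  have pos: "0 < \<bar>L\<bar> * frob E + 1" "0 < frob E + 1"
    by (simp_all add: add_nonneg_pos)
  \<comment> \<open>The first bound on the shift keeps the change of \<open>G\<close> below \<open>e\<close>, the second keeps the shifted matrix
    inside the ball of radius \<open>\<rho>\<close>.\<close>
  have "0 < d" using e gap pos by (simp add: d_def)
  from exists_invertible_shift[OF S this] obtain \<eta>
    where \<eta>: "0 < \<eta>" "\<eta> < d" and inv: "invertible_mat (S + \<eta> \<cdot>\<^sub>m 1\<^sub>m k)" by blast
  define S' where "S' = S + \<eta> \<cdot>\<^sub>m 1\<^sub>m k"
  define Y' where "Y' = U * S' * V\<^sup>T"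
  have S': "S' \<in> carrier_mat k k" using S by (simp add: S'_def)
  have Y': "Y' \<in> carrier_mat m n" using Uc Vc S' by (auto simp: Y'_def)
  have f: "low_rank_fact m n k U S' V Y'"
    using U V S' inv by (auto simp: low_rank_fact_def Y'_def S'_def)
  have "U * S' = U * S + \<eta> \<cdot>\<^sub>m U"
    unfolding S'_def using Uc S
    by (simp add: mult_add_distrib_mat[of U m k S k] mult_smult_distrib[of U m k "1\<^sub>m k" k])
  then have "Y' = U * S * V\<^sup>T + \<eta> \<cdot>\<^sub>m E"
    unfolding Y'_def E_def using Uc Vc S
    by (simp add: add_mult_distrib_mat[of "U * S" m k "\<eta> \<cdot>\<^sub>m U" "V\<^sup>T" n]
        mult_smult_assoc_mat[of U m k "V\<^sup>T" n])
  then have "Y' - Y = \<eta> \<cdot>\<^sub>m E" using Y E Uc Vc unfolding Y_def by (intro eq_matI) auto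
  then have dist: "frob (Y' - Y) = \<eta> * frob E" using \<eta> by (simp add: frob_smult)
  have "\<eta> * (frob E + 1) < gap" using \<eta> pos by (simp add: d_def pos_less_divide_eq)
  then have "frob (Y' - Y) < gap" using dist \<eta> by (simp add: algebra_simps)
  then have "frob (Y' - C) < \<rho>"
    using frob_minus_triangle[OF Y' Y C] by (simp add: gap_def)
  moreover have "Y' \<in> fixed_rank_mats m n k"
    using Y' low_rank_fact_rank[OF f] by (simp add: fixed_rank_mats_def)
  ultimately have "frob (tangent_proj_perp k Y' (G Y')) \<le> \<epsilon>" by (rule small[rotated])
  then have le: "frob (range_coproj U * G Y' * range_coproj V) \<le> \<epsilon>"
    using tangent_proj_perp_eq[OF f G[OF Y']] by simp
  have GY: "G Y \<in> carrier_mat m n" "G Y' \<in> carrier_mat m n" using G Y Y' by auto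
  have "range_coproj U * (G Y - G Y') = range_coproj U * G Y - range_coproj U * G Y'"
    by (rule mult_minus_distrib_mat) (use cU GY in auto)
  then have "range_coproj U * (G Y - G Y') * range_coproj V
      = range_coproj U * G Y * range_coproj V - range_coproj U * G Y' * range_coproj V"
    using minus_mult_distrib_mat[of "range_coproj U * G Y" m n "range_coproj U * G Y'" "range_coproj V" n]
      cU cV GY by auto
  moreover have "frob (range_coproj U * (G Y - G Y') * range_coproj V) \<le> frob (G Y - G Y')"
  proof -
    have "frob (range_coproj U * (G Y - G Y') * range_coproj V) \<le> frob (range_coproj U * (G Y - G Y'))"
      using contraction_frob_right[OF contraction_range_coproj[OF V],
          of "range_coproj U * (G Y - G Y')" m] cU GY by auto
    also have "\<dots> \<le> frob (G Y - G Y')"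
      by (rule contraction_frob_left[OF contraction_range_coproj[OF U]]) (use GY in auto)
    finally show ?thesis .
  qed
  moreover have "frob (G Y - G Y') \<le> e"
  proof -
    have "frob (G Y - G Y') \<le> L * frob (Y - Y')" by (rule Lip[OF Y Y'])
    also have "\<dots> \<le> \<bar>L\<bar> * (\<eta> * frob E)"
      unfolding frob_minus_commute[OF Y Y'] dist by (intro mult_right_mono) (use \<eta> in auto)
    also have "\<dots> \<le> \<eta> * (\<bar>L\<bar> * frob E + 1)" using \<eta> by (simp add: algebra_simps)
    also have "\<dots> \<le> e" using \<eta> pos by (simp add: d_def pos_less_divide_eq less_imp_le)
    finally show ?thesis .
  qed
  ultimately have "frob (range_coproj U * G Y * range_coproj V) \<le> \<epsilon> + e"
    using le frob_le_add_minus[of "range_coproj U * G Y * range_coproj V" m n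
        "range_coproj U * G Y' * range_coproj V"] cU cV GY by auto
  then show "frob (range_coproj U * G (U * S * V\<^sup>T) * range_coproj V) \<le> \<epsilon> + e"
    by (simp add: Y_def)
qed

section \<open>Truncation\<close>

lemma orthonormal_cols_mult:
  assumes "orthonormal_cols p k U" "orthonormal_cols k l P"
  shows "orthonormal_cols p l (U * P)"
proof -
  note U = orthonormal_colsD[OF assms(1)] and P = orthonormal_colsD[OF assms(2)]
  have "(U * P)\<^sup>T * (U * P) = P\<^sup>T * U\<^sup>T * (U * P)" using transpose_mult[OF U(1) P(1)] by simp
  also have "\<dots> = P\<^sup>T * (U\<^sup>T * (U * P))" by (rule assoc_mult_mat) (use U P in auto)
  also have "U\<^sup>T * (U * P) = U\<^sup>T * U * P" by (rule assoc_mult_mat[symmetric]) (use U P in auto)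
  finally show ?thesis using U P by (auto simp: orthonormal_cols_def)
qed

lemma orthonormal_cols_first_cols:
  assumes "orthonormal_cols p k W" "r \<le> k"
  shows "orthonormal_cols p r (first_cols r W)"
proof -
  note W = orthonormal_colsD[OF assms(1)]
  have "((first_cols r W)\<^sup>T * first_cols r W) $$ (i, j) = (W\<^sup>T * W) $$ (i, j)"
    if "i < r" "j < r" for i j
    using that assms(2) W(1) by (auto simp: first_cols_def scalar_prod_def intro!: sum.cong)
  then have "(first_cols r W)\<^sup>T * first_cols r W = 1\<^sub>m r"
    using W assms(2) by (intro eq_matI) (auto simp: first_cols_def)
  then show ?thesis using W(1) by (auto simp: orthonormal_cols_def first_cols_def)
qed

lemma mult_diag_transpose_index:
  assumes "G \<in> carrier_mat m s" "H \<in> carrier_mat n s" "i < m" "j < n"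
  shows "(G * mat_diag s \<sigma> * H\<^sup>T) $$ (i, j) = (\<Sum>k<s. G $$ (i, k) * \<sigma> k * H $$ (j, k))"
  using assms
  by (simp add: mat_diag_mult_right[of G m s] scalar_prod_def atLeast0LessThan)

lemma frob_mat_diag: "frob (mat_diag s \<tau>) = sqrt (\<Sum>k<s. (\<tau> k)\<^sup>2)"
proof -
  have "(\<Sum>j<s. (mat_diag s \<tau> $$ (i, j))\<^sup>2) = (\<tau> i)\<^sup>2" if "i < s" for i
  proof -
    have "(\<Sum>j<s. (mat_diag s \<tau> $$ (i, j))\<^sup>2) = (\<Sum>j<s. if i = j then (\<tau> i)\<^sup>2 else 0)"
      using that by (intro sum.cong) (auto simp: mat_diag_def)
    then show ?thesis using that by simp
  qed
  then show ?thesis by (simp add: frob_def mat_diag_def)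
qed

text \<open>Minimality of the new rank forces the retained singular values to be nonzero: otherwise all later
  ones vanish too and a smaller rank would meet the tolerance. So the truncated value is again
  given by an invertible middle factor. The truncation error has norm at most that of the diagonal
  matrix of the discarded singular values, as the outer factors are contractions.\<close>

lemma svd_truncation_bounds:
  assumes tr: "svd_truncation \<theta> s U S V U1 S1 V1" and \<theta>: "0 \<le> \<theta>"
    and U: "orthonormal_cols m s U" and V: "orthonormal_cols n s V"
  shows "low_rank_fact m n (dim_col U1) U1 S1 V1 (U1 * S1 * V1\<^sup>T)"
    and "frob (U1 * S1 * V1\<^sup>T - U * S * V\<^sup>T) \<le> \<theta>"
proof -
  from tr obtain P Q \<sigma> r where P: "orthonormal_cols s s P" and Q: "orthonormal_cols s s Q"
    and pos: "\<And>i. i < s \<Longrightarrow> 0 \<le> \<sigma> i" and mono: "\<And>i j. i \<le> j \<Longrightarrow> j < s \<Longrightarrow> \<sigma> j \<le> \<sigma> i"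
    and S: "S = P * mat_diag s \<sigma> * Q\<^sup>T"
    and r: "r = (LEAST k. sqrt (\<Sum>i\<in>{k..<s}. (\<sigma> i)\<^sup>2) \<le> \<theta>)"
    and U1: "U1 = first_cols r (U * P)" and S1: "S1 = mat_diag r \<sigma>"
    and V1: "V1 = first_cols r (V * Q)"
    unfolding svd_truncation_def by blast
  have all: "sqrt (\<Sum>i\<in>{s..<s}. (\<sigma> i)\<^sup>2) \<le> \<theta>" using \<theta> by simp
  have rs: "r \<le> s" unfolding r using all by (rule Least_le)
  have tail: "sqrt (\<Sum>i\<in>{r..<s}. (\<sigma> i)\<^sup>2) \<le> \<theta>" unfolding r using all by (rule LeastI)
  have nz: "\<sigma> i \<noteq> 0" if "i < r" for i
  proof
    assume z: "\<sigma> i = 0"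
    have "\<sigma> j = 0" if "j \<in> {i..<s}" for j
      using mono[of i j] pos[of j] z that by auto
    then have "sqrt (\<Sum>j\<in>{i..<s}. (\<sigma> j)\<^sup>2) \<le> \<theta>" using \<theta> by simp
    then have "r \<le> i" unfolding r by (rule Least_le)
    then show False using that by simp
  qed
  define G where "G = U * P"
  define H where "H = V * Q"
  have G: "orthonormal_cols m s G" and H: "orthonormal_cols n s H"
    unfolding G_def H_def by (rule orthonormal_cols_mult[OF U P], rule orthonormal_cols_mult[OF V Q])
  note Gc = orthonormal_colsD(1)[OF G] and Hc = orthonormal_colsD(1)[OF H]
  have U1o: "orthonormal_cols m r U1" and V1o: "orthonormal_cols n r V1"
    unfolding U1 V1 using orthonormal_cols_first_cols[OF G rs] orthonormal_cols_first_cols[OF H rs]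
    by (simp_all add: G_def H_def)
  note U1c = orthonormal_colsD(1)[OF U1o] and V1c = orthonormal_colsD(1)[OF V1o]
  have eq: "mat_diag r (\<lambda>i. \<sigma> i * (1 / \<sigma> i)) = 1\<^sub>m r" "mat_diag r (\<lambda>i. 1 / \<sigma> i * \<sigma> i) = 1\<^sub>m r"
    using nz by (auto simp: mat_diag_def intro!: eq_matI)
  have S1c: "S1 \<in> carrier_mat r r" by (simp add: S1)
  have "S1 * mat_diag r (\<lambda>i. 1 / \<sigma> i) = 1\<^sub>m r" "mat_diag r (\<lambda>i. 1 / \<sigma> i) * S1 = 1\<^sub>m r"
    unfolding S1 mat_diag_diag by (rule eq)+
  then have "invertible_mat S1"
    unfolding invertible_mat_def inverts_mat_def using S1c
      carrier_matD(1)[OF mat_diag_dim[of r "\<lambda>i. 1 / \<sigma> i"]]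
    by (intro conjI exI[of _ "mat_diag r (\<lambda>i. 1 / \<sigma> i)"]) auto
  then show "low_rank_fact m n (dim_col U1) U1 S1 V1 (U1 * S1 * V1\<^sup>T)"
    using U1o V1o U1c S1c by (simp add: low_rank_fact_def)
  note Pc = orthonormal_colsD(1)[OF P] and Qc = orthonormal_colsD(1)[OF Q]
    and Uc = orthonormal_colsD(1)[OF U] and Vc = orthonormal_colsD(1)[OF V]
  note D = mat_diag_dim[of s \<sigma>]
  have "U * S * V\<^sup>T = U * (P * mat_diag s \<sigma> * Q\<^sup>T) * V\<^sup>T" by (simp add: S)
  also have "U * (P * mat_diag s \<sigma> * Q\<^sup>T) = U * (P * mat_diag s \<sigma>) * Q\<^sup>T"
    by (rule assoc_mult_mat[of U m s _ s _ s, symmetric]) (use Uc Pc Qc D in auto)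
  also have "U * (P * mat_diag s \<sigma>) = G * mat_diag s \<sigma>"
    unfolding G_def by (rule assoc_mult_mat[of U m s _ s _ s, symmetric]) (use Uc Pc in auto)
  also have "G * mat_diag s \<sigma> * Q\<^sup>T * V\<^sup>T = G * mat_diag s \<sigma> * (Q\<^sup>T * V\<^sup>T)"
    by (rule assoc_mult_mat[of _ m s _ s _ n]) (use Gc Qc Vc D in auto)
  also have "Q\<^sup>T * V\<^sup>T = H\<^sup>T" unfolding H_def by (rule transpose_mult[symmetric]) (use Qc Vc in auto)
  finally have USV: "U * S * V\<^sup>T = G * mat_diag s \<sigma> * H\<^sup>T" .
  define \<tau> where "\<tau> = (\<lambda>k. if k < r then 0 else \<sigma> k)"
  have "U * S * V\<^sup>T - U1 * S1 * V1\<^sup>T = G * mat_diag s \<tau> * H\<^sup>T"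
  proof (rule eq_matI)
    note D' = mat_diag_dim[of s \<tau>]
    show "dim_row (U * S * V\<^sup>T - U1 * S1 * V1\<^sup>T) = dim_row (G * mat_diag s \<tau> * H\<^sup>T)"
      "dim_col (U * S * V\<^sup>T - U1 * S1 * V1\<^sup>T) = dim_col (G * mat_diag s \<tau> * H\<^sup>T)"
      using Gc Hc U1c V1c by auto
    fix i j assume "i < dim_row (G * mat_diag s \<tau> * H\<^sup>T)" "j < dim_col (G * mat_diag s \<tau> * H\<^sup>T)"
    then have ij: "i < m" "j < n" using Gc Hc by auto
    have "(U1 * S1 * V1\<^sup>T) $$ (i, j) = (\<Sum>k<r. U1 $$ (i, k) * \<sigma> k * V1 $$ (j, k))"
      unfolding S1 by (rule mult_diag_transpose_index[OF U1c V1c ij])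
    also have "\<dots> = (\<Sum>k<r. G $$ (i, k) * \<sigma> k * H $$ (j, k))"
      using ij Gc Hc Uc Vc by (intro sum.cong) (auto simp: U1 V1 first_cols_def G_def H_def)
    also have "\<dots> = (\<Sum>k\<in>{..<s}. if k < r then G $$ (i, k) * \<sigma> k * H $$ (j, k) else 0)"
      using rs by (intro sum.mono_neutral_cong_left) auto
    finally have "(U * S * V\<^sup>T) $$ (i, j) - (U1 * S1 * V1\<^sup>T) $$ (i, j)
        = (\<Sum>k<s. G $$ (i, k) * \<sigma> k * H $$ (j, k)
            - (if k < r then G $$ (i, k) * \<sigma> k * H $$ (j, k) else 0))"
      unfolding USV mult_diag_transpose_index[OF Gc Hc ij] by (simp add: sum_subtractf)
    also have "\<dots> = (\<Sum>k<s. G $$ (i, k) * \<tau> k * H $$ (j, k))"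
      by (intro sum.cong) (auto simp: \<tau>_def)
    also have "\<dots> = (G * mat_diag s \<tau> * H\<^sup>T) $$ (i, j)"
      by (rule mult_diag_transpose_index[OF Gc Hc ij, symmetric])
    finally show "(U * S * V\<^sup>T - U1 * S1 * V1\<^sup>T) $$ (i, j) = (G * mat_diag s \<tau> * H\<^sup>T) $$ (i, j)"
      using ij U1c V1c S1c by simp
  qed
  moreover have "frob (G * mat_diag s \<tau> * H\<^sup>T) \<le> frob (mat_diag s \<tau>)"
  proof -
    have "frob (G * mat_diag s \<tau> * H\<^sup>T) \<le> frob (G * mat_diag s \<tau>)"
      by (rule contraction_frob_right[OF contraction_orthonormal[OF H], where n = m])
        (use Gc in \<open>auto intro!: mult_carrier_mat\<close>)
    also have "\<dots> \<le> frob (mat_diag s \<tau>)"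
      by (rule contraction_frob_left[OF contraction_orthonormal[OF G] mat_diag_dim])
    finally show ?thesis .
  qed
  moreover have "frob (mat_diag s \<tau>) = sqrt (\<Sum>k\<in>{r..<s}. (\<sigma> k)\<^sup>2)"
  proof -
    have "(\<Sum>k<s. (\<tau> k)\<^sup>2) = (\<Sum>k\<in>{r..<s}. (\<sigma> k)\<^sup>2)"
      using rs by (intro sum.mono_neutral_cong_right) (auto simp: \<tau>_def)
    then show ?thesis by (simp add: frob_mat_diag)
  qed
  moreover have "frob (U1 * S1 * V1\<^sup>T - U * S * V\<^sup>T) = frob (U * S * V\<^sup>T - U1 * S1 * V1\<^sup>T)"
  proof (rule frob_minus_commute)
    show "U1 * S1 * V1\<^sup>T \<in> carrier_mat m n" using U1c S1c V1c by auto
    show "U * S * V\<^sup>T \<in> carrier_mat m n" unfolding USV using Gc Hc D by auto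
  qed
  ultimately show "frob (U1 * S1 * V1\<^sup>T - U * S * V\<^sup>T) \<le> \<theta>" using tail by simp
qed

section \<open>Differentiable matrix curves\<close>

text \<open>The domain \<open>I\<close> is used both for the base points and for the (possibly one-sided) limits.\<close>

definition mat_curve ::
    "nat \<Rightarrow> nat \<Rightarrow> (real \<Rightarrow> real mat) \<Rightarrow> (real \<Rightarrow> real mat) \<Rightarrow> real set \<Rightarrow> bool" where
  "mat_curve p q X X' I \<longleftrightarrow>
     (\<forall>t\<in>I. X t \<in> carrier_mat p q \<and> X' t \<in> carrier_mat p q \<and> has_mat_derivative p q X (X' t) t I)"

lemma mat_curve_carrier:
  assumes "mat_curve p q X X' I" "t \<in> I"
  shows "X t \<in> carrier_mat p q" "X' t \<in> carrier_mat p q"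
  using assms by (auto simp: mat_curve_def)

lemma mat_curve_entry:
  assumes "mat_curve p q X X' I" "t \<in> I" "i < p" "j < q"
  shows "((\<lambda>s. X s $$ (i, j)) has_real_derivative X' t $$ (i, j)) (at t within I)"
  using assms by (auto simp: mat_curve_def has_mat_derivative_def)

lemma mat_curveI:
  assumes "\<And>t. t \<in> I \<Longrightarrow> X t \<in> carrier_mat p q" "\<And>t. t \<in> I \<Longrightarrow> X' t \<in> carrier_mat p q"
    and f: "\<And>t i j. t \<in> I \<Longrightarrow> i < p \<Longrightarrow> j < q \<Longrightarrow> X t $$ (i, j) = f i j t"
    and d: "\<And>t i j. t \<in> I \<Longrightarrow> i < p \<Longrightarrow> j < q \<Longrightarrow>
      (f i j has_real_derivative X' t $$ (i, j)) (at t within I)"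
  shows "mat_curve p q X X' I"
  unfolding mat_curve_def has_mat_derivative_def
proof (intro ballI conjI allI impI)
  fix t i j assume t: "t \<in> I" and ij: "i < p" "j < q"
  show "((\<lambda>s. X s $$ (i, j)) has_real_derivative X' t $$ (i, j)) (at t within I)"
    unfolding has_field_derivative_def
    by (rule has_derivative_transform[OF t f[OF _ ij] d[OF t ij, unfolded has_field_derivative_def]])
qed (use assms in auto)

lemma mat_curve_subset:
  assumes "mat_curve p q X X' I" "J \<subseteq> I"
  shows "mat_curve p q X X' J"
  using assms has_field_derivative_subset
  unfolding mat_curve_def has_mat_derivative_def by (meson subsetD)

lemma mat_curve_solves_ode:
  assumes "solves_mat_ode p q a b G X" "\<And>t. t \<in> {a..b} \<Longrightarrow> G t (X t) \<in> carrier_mat p q"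
  shows "mat_curve p q X (\<lambda>t. G t (X t)) {a..b}"
  using assms by (simp add: mat_curve_def solves_mat_ode_def)

lemma mat_curve_minus:
  assumes X: "mat_curve p q X X' I" and Y: "mat_curve p q Y Y' I"
  shows "mat_curve p q (\<lambda>t. X t - Y t) (\<lambda>t. X' t - Y' t) I"
proof (rule mat_curveI[where f = "\<lambda>i j t. X t $$ (i, j) - Y t $$ (i, j)"])
  fix t assume t: "t \<in> I"
  note c = mat_curve_carrier[OF X t] mat_curve_carrier[OF Y t]
  show "X t - Y t \<in> carrier_mat p q" "X' t - Y' t \<in> carrier_mat p q" using c by auto
  fix i j assume ij: "i < p" "j < q"
  show "(X t - Y t) $$ (i, j) = X t $$ (i, j) - Y t $$ (i, j)" using c ij by auto
  have "((\<lambda>t. X t $$ (i, j) - Y t $$ (i, j)) has_real_derivative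
      X' t $$ (i, j) - Y' t $$ (i, j)) (at t within I)"
    by (rule DERIV_diff[OF mat_curve_entry[OF X t ij] mat_curve_entry[OF Y t ij]])
  then show "((\<lambda>t. X t $$ (i, j) - Y t $$ (i, j)) has_real_derivative
      (X' t - Y' t) $$ (i, j)) (at t within I)"
    using c ij by auto
qed

lemma mat_curve_const:
  assumes "C \<in> carrier_mat p q"
  shows "mat_curve p q (\<lambda>t. C) (\<lambda>t. 0\<^sub>m p q) I"
  by (rule mat_curveI[where f = "\<lambda>i j t. C $$ (i, j)"]) (use assms in auto)

lemma mat_curve_linear:
  assumes "C \<in> carrier_mat p q"
  shows "mat_curve p q (\<lambda>t. t \<cdot>\<^sub>m C) (\<lambda>t. C) I"
  by (rule mat_curveI[where f = "\<lambda>i j t. t * C $$ (i, j)"])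
    (use assms in \<open>auto intro!: derivative_eq_intros\<close>)

lemma mat_curve_transpose:
  assumes X: "mat_curve p q X X' I"
  shows "mat_curve q p (\<lambda>t. (X t)\<^sup>T) (\<lambda>t. (X' t)\<^sup>T) I"
proof (rule mat_curveI[where f = "\<lambda>i j t. X t $$ (j, i)"])
  fix t assume t: "t \<in> I"
  note c = mat_curve_carrier[OF X t]
  show "(X t)\<^sup>T \<in> carrier_mat q p" "(X' t)\<^sup>T \<in> carrier_mat q p" using c by auto
  fix i j assume ij: "i < q" "j < p"
  show "(X t)\<^sup>T $$ (i, j) = X t $$ (j, i)" using c ij by auto
  show "((\<lambda>t. X t $$ (j, i)) has_real_derivative (X' t)\<^sup>T $$ (i, j)) (at t within I)"
    using mat_curve_entry[OF X t ij(2) ij(1)] c ij by auto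
qed

lemma mat_curve_mult_left:
  assumes X: "mat_curve p q X X' I" and W: "W \<in> carrier_mat r p"
  shows "mat_curve r q (\<lambda>t. W * X t) (\<lambda>t. W * X' t) I"
proof (rule mat_curveI[where f = "\<lambda>i j t. \<Sum>k<p. W $$ (i, k) * X t $$ (k, j)"])
  fix t assume t: "t \<in> I"
  note c = mat_curve_carrier[OF X t]
  show "W * X t \<in> carrier_mat r q" "W * X' t \<in> carrier_mat r q" using c W by auto
  fix i j assume ij: "i < r" "j < q"
  show "(W * X t) $$ (i, j) = (\<Sum>k<p. W $$ (i, k) * X t $$ (k, j))"
    using c ij W by (simp add: scalar_prod_def atLeast0LessThan)
  have "((\<lambda>t. \<Sum>k<p. W $$ (i, k) * X t $$ (k, j)) has_real_derivative
      (\<Sum>k<p. W $$ (i, k) * X' t $$ (k, j))) (at t within I)"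
    by (intro DERIV_sum DERIV_cmult mat_curve_entry[OF X t]) (use ij in auto)
  then show "((\<lambda>t. \<Sum>k<p. W $$ (i, k) * X t $$ (k, j)) has_real_derivative
      (W * X' t) $$ (i, j)) (at t within I)"
    using c ij W by (simp add: scalar_prod_def atLeast0LessThan)
qed

lemma mat_curve_mult_right:
  assumes X: "mat_curve p q X X' I" and W: "W \<in> carrier_mat q r"
  shows "mat_curve p r (\<lambda>t. X t * W) (\<lambda>t. X' t * W) I"
proof (rule mat_curveI[where f = "\<lambda>i j t. \<Sum>k<q. X t $$ (i, k) * W $$ (k, j)"])
  fix t assume t: "t \<in> I"
  note c = mat_curve_carrier[OF X t]
  show "X t * W \<in> carrier_mat p r" "X' t * W \<in> carrier_mat p r" using c W by auto
  fix i j assume ij: "i < p" "j < r"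
  show "(X t * W) $$ (i, j) = (\<Sum>k<q. X t $$ (i, k) * W $$ (k, j))"
    using c ij W by (simp add: scalar_prod_def atLeast0LessThan)
  have "((\<lambda>t. \<Sum>k<q. X t $$ (i, k) * W $$ (k, j)) has_real_derivative
      (\<Sum>k<q. X' t $$ (i, k) * W $$ (k, j))) (at t within I)"
    by (intro DERIV_sum DERIV_cmult_right mat_curve_entry[OF X t]) (use ij in auto)
  then show "((\<lambda>t. \<Sum>k<q. X t $$ (i, k) * W $$ (k, j)) has_real_derivative
      (X' t * W) $$ (i, j)) (at t within I)"
    using c ij W by (simp add: scalar_prod_def atLeast0LessThan)
qed

lemma mat_curve_affine:
  assumes X: "mat_curve p q X X' I" and J: "\<And>s. s \<in> J \<Longrightarrow> c + \<sigma> * s \<in> I"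
  shows "mat_curve p q (\<lambda>s. X (c + \<sigma> * s)) (\<lambda>s. \<sigma> \<cdot>\<^sub>m X' (c + \<sigma> * s)) J"
proof (rule mat_curveI[where f = "\<lambda>i j s. X (c + \<sigma> * s) $$ (i, j)"])
  fix s assume s: "s \<in> J"
  note c = mat_curve_carrier[OF X J[OF s]]
  show "X (c + \<sigma> * s) \<in> carrier_mat p q" "\<sigma> \<cdot>\<^sub>m X' (c + \<sigma> * s) \<in> carrier_mat p q" using c by auto
  fix i j assume ij: "i < p" "j < q"
  have "((\<lambda>s. c + \<sigma> * s) has_real_derivative \<sigma>) (at s within J)"
    by (auto intro!: derivative_eq_intros)
  moreover have "((\<lambda>t. X t $$ (i, j)) has_real_derivative X' (c + \<sigma> * s) $$ (i, j))
      (at (c + \<sigma> * s) within (\<lambda>s. c + \<sigma> * s) ` J)"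
    by (rule has_field_derivative_subset[OF mat_curve_entry[OF X J[OF s] ij]]) (use J in auto)
  ultimately have "((\<lambda>s. X (c + \<sigma> * s) $$ (i, j)) has_real_derivative
      X' (c + \<sigma> * s) $$ (i, j) * \<sigma>) (at s within J)"
    using DERIV_image_chain[of "\<lambda>t. X t $$ (i, j)" _ "\<lambda>s. c + \<sigma> * s" s J \<sigma>] by (simp add: o_def)
  then show "((\<lambda>s. X (c + \<sigma> * s) $$ (i, j)) has_real_derivative
      (\<sigma> \<cdot>\<^sub>m X' (c + \<sigma> * s)) $$ (i, j)) (at s within J)"
    using c ij by (simp add: mult.commute)
qed simp

text \<open>Pairing the curve with its own increment \<open>E\<close> reduces the claim to the scalar mean value theorem,
  and Cauchy-Schwarz leaves one factor \<open>frob E\<close> to cancel. This keeps the constant free of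
  the dimensions.\<close>

lemma mean_value_inequality:
  assumes X: "mat_curve p q X X' {a..b}" and ab: "a \<le> b"
    and bound: "\<And>t. t \<in> {a..b} \<Longrightarrow> frob (X' t) \<le> M"
  shows "frob (X b - X a) \<le> M * (b - a)"
proof (cases "a = b")
  case True
  then have "X a \<in> carrier_mat p q" using mat_curve_carrier(1)[OF X] by auto
  then show ?thesis using True by simp
next
  case False
  then have ab: "a < b" using ab by simp
  define E where "E = X b - X a"
  have c: "X a \<in> carrier_mat p q" "X b \<in> carrier_mat p q"
    using mat_curve_carrier(1)[OF X] ab by auto
  then have E: "E \<in> carrier_mat p q" by (simp add: E_def)
  define g where "g = (\<lambda>t. frob_inner E (X t))"
  have g: "(g has_real_derivative frob_inner E (X' t)) (at t within {a..b})" if "t \<in> {a..b}" for t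
    unfolding g_def frob_inner_def using that E
    by (intro DERIV_sum DERIV_cmult mat_curve_entry[OF X]) auto
  have "continuous_on {a..b} g" using g by (rule DERIV_continuous_on)
  moreover have "(g has_derivative (\<lambda>y. frob_inner E (X' t) * y)) (at t)" if "a < t" "t < b" for t
    using g[of t] that at_within_Icc_at[of a t b] by (simp add: has_field_derivative_def)
  ultimately obtain \<xi> where \<xi>: "a < \<xi>" "\<xi> < b" "g b - g a = frob_inner E (X' \<xi>) * (b - a)"
    using mvt[OF ab, of g "\<lambda>t y. frob_inner E (X' t) * y"] by blast
  have "frob E * frob E = g b - g a"
    using frob_inner_minus_right[OF E c(2) c(1)] frob_power2[of E]
    by (simp add: g_def E_def power2_eq_square)
  also have "\<dots> \<le> frob E * M * (b - a)"
  proof -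
    have "frob_inner E (X' \<xi>) \<le> frob E * frob (X' \<xi>)"
      using E mat_curve_carrier(2)[OF X] \<xi> by (intro frob_inner_le) auto
    also have "\<dots> \<le> frob E * M" using bound \<xi> by (intro mult_left_mono) auto
    finally show ?thesis unfolding \<xi>(3) using ab by (intro mult_right_mono) auto
  qed
  finally have *: "frob E * frob E \<le> frob E * (M * (b - a))" by (simp add: mult.assoc)
  show ?thesis
  proof (cases "frob E = 0")
    case True
    have "0 \<le> M" using order_trans[OF frob_nonneg bound[of a]] ab by simp
    then show ?thesis using True ab by (simp add: E_def)
  next
    case False
    then have "0 < frob E" using frob_nonneg[of E] by linarith
    then show ?thesis using * by (simp add: E_def)
  qed
qed

text \<open>The remainder, as a function of half the length of the interval around the fixed midpoint, vanishes
  at \<open>0\<close>. The mean value inequality is applied to it, to its derivative, and to the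
  second derivative of the curve, each application giving one power of the length.\<close>

lemma midpoint_rule:
  assumes X: "mat_curve p q X X1 {a..b}" and X1: "mat_curve p q X1 X2 {a..b}"
    and X2: "mat_curve p q X2 X3 {a..b}" and ab: "a \<le> b"
    and bound: "\<And>t. t \<in> {a..b} \<Longrightarrow> frob (X3 t) \<le> D"
  shows "frob (X b - X a - (b - a) \<cdot>\<^sub>m X1 ((a + b) / 2)) \<le> D * (b - a) ^ 3 / 4"
proof -
  define c H where "c = (a + b) / 2" and "H = (b - a) / 2"
  have H: "0 \<le> H" and ends: "a = c - H" "b = c + H" using ab by (auto simp: c_def H_def field_simps)
  have D0: "0 \<le> D" using order_trans[OF frob_nonneg bound[of a]] ab by simp
  have plus: "c + 1 * s \<in> {a..b}" and minus: "c + (-1) * s \<in> {a..b}" if "s \<in> {0..H}" for s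
    using that H by (auto simp: ends)
  have cc: "c \<in> {a..b}" using H by (auto simp: ends)
  note C = mat_curve_carrier[OF X] mat_curve_carrier[OF X1] mat_curve_carrier[OF X2]
  have C1: "X1 c \<in> carrier_mat p q" using C cc by simp
  have second: "frob ((X1 (c + 1 * s) - (- 1) \<cdot>\<^sub>m X1 (c + (-1) * s)) - 2 \<cdot>\<^sub>m X1 c) \<le> 2 * D * H * H"
    if s: "s \<in> {0..H}" for s
  proof -
    have curve: "mat_curve p q (\<lambda>s. X1 (c + 1 * s) - (0\<^sub>m p q - X1 (c + (-1) * s)))
        (\<lambda>s. 1 \<cdot>\<^sub>m X2 (c + 1 * s) - (0\<^sub>m p q - (-1) \<cdot>\<^sub>m X2 (c + (-1) * s))) {0..s}"
      using plus minus s
      by (intro mat_curve_minus mat_curve_affine[OF X1] mat_curve_const) auto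
    have "frob ((X1 (c + 1 * s) - (0\<^sub>m p q - X1 (c + (-1) * s)))
        - (X1 (c + 1 * 0) - (0\<^sub>m p q - X1 (c + (-1) * 0)))) \<le> 2 * D * H * (s - 0)"
    proof (rule mean_value_inequality[OF curve])
      show "0 \<le> s" using s by simp
      fix u assume "u \<in> {0..s}"
      then have u: "u \<in> {0..H}" using s by auto
      have sub: "{c + (-1) * u..c + 1 * u} \<subseteq> {a..b}" using u by (auto simp: ends)
      have "1 \<cdot>\<^sub>m X2 (c + 1 * u) - (0\<^sub>m p q - (-1) \<cdot>\<^sub>m X2 (c + (-1) * u))
          = X2 (c + 1 * u) - X2 (c + (-1) * u)"
        using C(5)[OF plus[OF u]] C(5)[OF minus[OF u]] by (intro eq_matI) auto
      moreover have "frob (X2 (c + 1 * u) - X2 (c + (-1) * u))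
          \<le> D * (c + 1 * u - (c + (-1) * u))"
        using u sub bound
        by (intro mean_value_inequality[OF mat_curve_subset[OF X2 sub]]) auto
      moreover have "D * (c + 1 * u - (c + (-1) * u)) \<le> 2 * D * H"
        using u D0 by (simp add: algebra_simps mult_left_mono)
      ultimately show "frob (1 \<cdot>\<^sub>m X2 (c + 1 * u) - (0\<^sub>m p q - (-1) \<cdot>\<^sub>m X2 (c + (-1) * u))) \<le> 2 * D * H"
        by simp
    qed
    moreover have "(X1 (c + 1 * s) - (0\<^sub>m p q - X1 (c + (-1) * s)))
        - (X1 (c + 1 * 0) - (0\<^sub>m p q - X1 (c + (-1) * 0)))
        = (X1 (c + 1 * s) - (- 1) \<cdot>\<^sub>m X1 (c + (-1) * s)) - 2 \<cdot>\<^sub>m X1 c"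
      using C(3)[OF plus[OF s]] C(3)[OF minus[OF s]] C1 by (intro eq_matI) auto
    moreover have "2 * D * H * (s - 0) \<le> 2 * D * H * H"
      using s D0 by (simp add: mult_left_mono)
    ultimately show ?thesis by simp
  qed
  have curve: "mat_curve p q (\<lambda>s. (X (c + 1 * s) - X (c + (-1) * s)) - s \<cdot>\<^sub>m (2 \<cdot>\<^sub>m X1 c))
      (\<lambda>s. (1 \<cdot>\<^sub>m X1 (c + 1 * s) - (-1) \<cdot>\<^sub>m X1 (c + (-1) * s)) - 2 \<cdot>\<^sub>m X1 c) {0..H}"
    using plus minus C1
    by (intro mat_curve_minus mat_curve_affine[OF X] mat_curve_linear) auto
  have "frob (((X (c + 1 * H) - X (c + (-1) * H)) - H \<cdot>\<^sub>m (2 \<cdot>\<^sub>m X1 c))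
      - ((X (c + 1 * 0) - X (c + (-1) * 0)) - 0 \<cdot>\<^sub>m (2 \<cdot>\<^sub>m X1 c))) \<le> 2 * D * H * H * (H - 0)"
  proof (rule mean_value_inequality[OF curve H])
    fix s assume s: "s \<in> {0..H}"
    have "1 \<cdot>\<^sub>m X1 (c + 1 * s) = X1 (c + 1 * s)" by (rule eq_matI) auto
    then show "frob ((1 \<cdot>\<^sub>m X1 (c + 1 * s) - (-1) \<cdot>\<^sub>m X1 (c + (-1) * s)) - 2 \<cdot>\<^sub>m X1 c) \<le> 2 * D * H * H"
      using second[OF s] by simp
  qed
  moreover have "((X (c + 1 * H) - X (c + (-1) * H)) - H \<cdot>\<^sub>m (2 \<cdot>\<^sub>m X1 c))
      - ((X (c + 1 * 0) - X (c + (-1) * 0)) - 0 \<cdot>\<^sub>m (2 \<cdot>\<^sub>m X1 c))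
      = X b - X a - (b - a) \<cdot>\<^sub>m X1 c"
    using C(1)[of a] C(1)[of b] C(1)[OF cc] C1 ab
    by (intro eq_matI) (auto simp: ends algebra_simps)
  moreover have "2 * D * H * H * (H - 0) = D * (b - a) ^ 3 / 4"
    by (simp add: H_def power3_eq_cube)
  ultimately show ?thesis by (simp only: c_def[symmetric])
qed

lemma mat_curve_cong_deriv:
  assumes "mat_curve p q X X' I" "\<And>t. t \<in> I \<Longrightarrow> X' t = Z' t"
  shows "mat_curve p q X Z' I"
  using assms by (simp add: mat_curve_def)

lemma mat_curve_derivative_unique:
  assumes X: "mat_curve p q X X' {a..b}" and Z: "mat_curve p q X Z {a..b}" and t: "a < t" "t < b"
  shows "X' t = Z t"
proof (rule eq_matI)
  have ti: "t \<in> {a..b}" using t by simp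
  note c = mat_curve_carrier(2)[OF X ti] mat_curve_carrier(2)[OF Z ti]
  show "dim_row (X' t) = dim_row (Z t)" "dim_col (X' t) = dim_col (Z t)" using c by auto
  fix i j assume "i < dim_row (Z t)" "j < dim_col (Z t)"
  then have ij: "i < p" "j < q" using c by auto
  show "X' t $$ (i, j) = Z t $$ (i, j)"
    using mat_curve_entry[OF X ti ij] mat_curve_entry[OF Z ti ij]
    by (simp add: at_within_Icc_at[OF t] DERIV_unique)
qed

text \<open>What a complementary projection leaves of the increments of \<open>A\<close> is controlled by what it leaves of
  the derivative at the midpoint: with an error of second order at any time, and of third order at
  the end of the interval, by the midpoint rule.\<close>

lemma increment_residual:
  assumes A: "mat_curve p q A A1 {a..b}" and A1: "mat_curve p q A1 A2 {a..b}"
    and A2: "mat_curve p q A2 A3 {a..b}"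
    and D2: "\<And>t. t \<in> {a..b} \<Longrightarrow> frob (A2 t) \<le> D" and D3: "\<And>t. t \<in> {a..b} \<Longrightarrow> frob (A3 t) \<le> D"
    and W: "orthonormal_cols p k W" and c: "frob (range_coproj W * A1 ((a + b) / 2)) \<le> \<eta>"
    and t: "t \<in> {a..b}"
  shows "frob (range_coproj W * (A t - A a)) \<le> (b - a) * (\<eta> + D * (b - a))"
    and "frob (range_coproj W * (A b - A a)) \<le> (b - a) * \<eta> + D * (b - a) ^ 3 / 4"
proof -
  define Q where "Q = range_coproj W"
  define mid where "mid = (a + b) / 2"
  have ab: "a \<le> b" using t by auto
  have mid: "mid \<in> {a..b}" using ab by (auto simp: mid_def field_simps)
  have ends: "a \<in> {a..b}" "b \<in> {a..b}" using ab by auto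
  have Qc: "Q \<in> carrier_mat p p"
    unfolding Q_def by (rule range_proj_carrier(2)[OF orthonormal_colsD(1)[OF W]])
  have Qle: "frob (Q * X) \<le> frob X" if "X \<in> carrier_mat p q" for X
    unfolding Q_def by (rule contraction_frob_left[OF contraction_range_coproj[OF W] that])
  have \<eta>: "frob (Q * A1 mid) \<le> \<eta>" using c by (simp add: Q_def mid_def)
  have \<eta>0: "0 \<le> \<eta>" by (rule order_trans[OF frob_nonneg \<eta>])
  have D0: "0 \<le> D" by (rule order_trans[OF frob_nonneg D2[OF t]])
  note C = mat_curve_carrier[OF A] mat_curve_carrier[OF A1]
  have A1diff: "frob (A1 s - A1 mid) \<le> D * (b - a)" if s: "s \<in> {a..b}" for s
  proof (cases "mid \<le> s")
    case True
    then have sub: "{mid..s} \<subseteq> {a..b}" using s mid by auto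
    have "frob (A1 s - A1 mid) \<le> D * (s - mid)"
      using sub D2 by (intro mean_value_inequality[OF mat_curve_subset[OF A1 sub] True]) auto
    also have "\<dots> \<le> D * (b - a)" using s mid D0 by (intro mult_left_mono) auto
    finally show ?thesis .
  next
    case False
    then have le: "s \<le> mid" and sub: "{s..mid} \<subseteq> {a..b}" using s mid by auto
    have "frob (A1 s - A1 mid) = frob (A1 mid - A1 s)"
      by (rule frob_minus_commute[OF C(3)[OF s] C(3)[OF mid]])
    also have "\<dots> \<le> D * (mid - s)"
      using sub D2 by (intro mean_value_inequality[OF mat_curve_subset[OF A1 sub] le]) auto
    also have "\<dots> \<le> D * (b - a)" using s mid D0 by (intro mult_left_mono) auto
    finally show ?thesis .
  qed
  have sub: "{a..t} \<subseteq> {a..b}" using t by auto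
  have "frob (Q * A t - Q * A a) \<le> (\<eta> + D * (b - a)) * (t - a)"
  proof (rule mean_value_inequality[OF mat_curve_mult_left[OF mat_curve_subset[OF A sub] Qc]])
    show "a \<le> t" using t by simp
    fix s assume "s \<in> {a..t}"
    then have s: "s \<in> {a..b}" using sub by auto
    have "frob (Q * A1 s) \<le> frob (Q * A1 mid) + frob (Q * A1 s - Q * A1 mid)"
      by (rule frob_le_add_minus) (use Qc C(3)[OF s] C(3)[OF mid] in auto)
    also have "Q * A1 s - Q * A1 mid = Q * (A1 s - A1 mid)"
      by (rule mult_minus_distrib_mat[OF Qc C(3)[OF s] C(3)[OF mid], symmetric])
    finally show "frob (Q * A1 s) \<le> \<eta> + D * (b - a)"
      using Qle[of "A1 s - A1 mid"] A1diff[OF s] C(3)[OF s] C(3)[OF mid] \<eta> by simp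
  qed
  also have "\<dots> \<le> (\<eta> + D * (b - a)) * (b - a)"
    using t \<eta>0 D0 by (intro mult_left_mono) auto
  finally show "frob (range_coproj W * (A t - A a)) \<le> (b - a) * (\<eta> + D * (b - a))"
    using mult_minus_distrib_mat[OF Qc C(1)[OF t] C(1)[OF ends(1)]]
    by (simp add: Q_def mult.commute)
  define R where "R = A b - A a - (b - a) \<cdot>\<^sub>m A1 mid"
  have R: "R \<in> carrier_mat p q" and M: "(b - a) \<cdot>\<^sub>m A1 mid \<in> carrier_mat p q"
    using C(3)[OF mid] by (auto simp: R_def)
  have "frob R \<le> D * (b - a) ^ 3 / 4"
    unfolding R_def mid_def by (rule midpoint_rule[OF A A1 A2 ab D3])
  moreover have "frob (Q * (A b - A a)) \<le> frob (Q * ((b - a) \<cdot>\<^sub>m A1 mid)) + frob (Q * R)"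
  proof -
    have "A b - A a = (b - a) \<cdot>\<^sub>m A1 mid + R"
      unfolding R_def using C(1)[OF ends(1)] C(1)[OF ends(2)] C(3)[OF mid] by (intro eq_matI) auto
    then have "Q * (A b - A a) = Q * ((b - a) \<cdot>\<^sub>m A1 mid) + Q * R"
      using mult_add_distrib_mat[OF Qc M R] by simp
    then show ?thesis
      using frob_triangle[OF mult_carrier_mat[OF Qc M] mult_carrier_mat[OF Qc R]] by simp
  qed
  moreover have "frob (Q * ((b - a) \<cdot>\<^sub>m A1 mid)) \<le> (b - a) * \<eta>"
    using mult_smult_distrib[OF Qc C(3)[OF mid]] ab \<eta> by (simp add: frob_smult mult_left_mono)
  ultimately show "frob (range_coproj W * (A b - A a)) \<le> (b - a) * \<eta> + D * (b - a) ^ 3 / 4"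
    using Qle[OF R] by (simp add: Q_def)
qed

section \<open>Local errors of the substeps\<close>

text \<open>The field is a parameter because the estimates for the L-step are those for the K-step applied to
  the transposed field.\<close>

locale bounded_lipschitz_field =
  fixes m n :: nat and F :: "real \<Rightarrow> real mat \<Rightarrow> real mat" and I :: "real set" and L B :: real
  assumes field_carrier: "\<And>t X. t \<in> I \<Longrightarrow> X \<in> carrier_mat m n \<Longrightarrow> F t X \<in> carrier_mat m n"
    and field_lipschitz: "\<And>t X Z. t \<in> I \<Longrightarrow> X \<in> carrier_mat m n \<Longrightarrow> Z \<in> carrier_mat m n \<Longrightarrow>
      frob (F t X - F t Z) \<le> L * frob (X - Z)"
    and field_bound: "\<And>t X. t \<in> I \<Longrightarrow> X \<in> carrier_mat m n \<Longrightarrow> frob (F t X) \<le> B"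
    and L_nonneg: "0 \<le> L"
begin

lemma transposed_field: "bounded_lipschitz_field n m (\<lambda>t X. (F t X\<^sup>T)\<^sup>T) I L B"
proof
  fix t and X :: "real mat" assume t: "t \<in> I" and X: "X \<in> carrier_mat n m"
  then have FX: "F t X\<^sup>T \<in> carrier_mat m n" using field_carrier by simp
  then show "(F t X\<^sup>T)\<^sup>T \<in> carrier_mat n m" by simp
  show "frob (F t X\<^sup>T)\<^sup>T \<le> B" using field_bound[OF t, of "X\<^sup>T"] X by simp
  fix Z :: "real mat" assume Z: "Z \<in> carrier_mat n m"
  then have FZ: "F t Z\<^sup>T \<in> carrier_mat m n" using field_carrier t by simp
  have "frob ((F t X\<^sup>T)\<^sup>T - (F t Z\<^sup>T)\<^sup>T) = frob (F t X\<^sup>T - F t Z\<^sup>T)"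
    using transpose_minus[OF FX FZ] frob_transpose by metis
  also have "\<dots> \<le> L * frob (X\<^sup>T - Z\<^sup>T)" using field_lipschitz[OF t] X Z by simp
  also have "X\<^sup>T - Z\<^sup>T = (X - Z)\<^sup>T" using transpose_minus[OF X Z] by simp
  finally show "frob ((F t X\<^sup>T)\<^sup>T - (F t Z\<^sup>T)\<^sup>T) \<le> L * frob (X - Z)" by simp
qed (rule L_nonneg)

context
  fixes a b :: real and A :: "real \<Rightarrow> real mat"
  assumes ab: "a \<le> b" and sub: "{a..b} \<subseteq> I"
    and exact: "mat_curve m n A (\<lambda>t. F t (A t)) {a..b}"
begin

lemma frob_minus_initial_le:
  assumes Y0: "Y0 \<in> carrier_mat m n" and t: "t \<in> {a..b}"
  shows "frob (A t - Y0) \<le> frob (A a - Y0) + B * (t - a)"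
proof -
  have c: "A t \<in> carrier_mat m n" "A a \<in> carrier_mat m n"
    using mat_curve_carrier(1)[OF exact] t by auto
  have st: "{a..t} \<subseteq> {a..b}" using t by auto
  have "frob (A t - A a) \<le> B * (t - a)"
    using t sub field_bound mat_curve_carrier(1)[OF exact]
    by (intro mean_value_inequality[OF mat_curve_subset[OF exact st]]) (auto simp: subset_iff)
  then show ?thesis using frob_minus_triangle[OF c Y0] by simp
qed

text \<open>The complementary projection \<open>Q\<close> of \<open>W\<close> vanishes on \<open>U0\<close> and on the result of the K-step, so that \<open>A\<close> and
  \<open>A - K V0\<^sup>T\<close> have the same increment under \<open>Q\<close>. The derivative of the latter is
  \<open>F(A) - F(K V0\<^sup>T) V0 V0\<^sup>T\<close>; replacing both arguments of \<open>F\<close> by \<open>Y0\<close> costs two Lipschitz terms and leaves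
  \<open>F(Y0) (I - V0 V0\<^sup>T)\<close>, of which \<open>Q\<close> retains only the normal component.\<close>

lemma K_step_increment_residual:
  assumes U0: "U0 \<in> carrier_mat m r" and V0: "orthonormal_cols n r V0" and S0: "S0 \<in> carrier_mat r r"
    and K: "solves_mat_ode m r a b (\<lambda>t K. F t (K * V0\<^sup>T) * V0) K" and Ka: "K a = U0 * S0"
    and W: "orthonormal_cols m k W" and WU: "range_coproj W * U0 = 0\<^sub>m m r"
    and WK: "range_coproj W * K b = 0\<^sub>m m r"
    and normal: "\<And>t. t \<in> {a..b} \<Longrightarrow>
      frob (range_coproj U0 * F t (U0 * S0 * V0\<^sup>T) * range_coproj V0) \<le> \<epsilon>"
  shows "frob (range_coproj W * (A b - A a))
    \<le> (b - a) * (L * (frob (A a - U0 * S0 * V0\<^sup>T) + 2 * B * (b - a)) + \<epsilon>)"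
proof -
  define Y0 where "Y0 = U0 * S0 * V0\<^sup>T"
  define Q where "Q = range_coproj W"
  define G where "G = (\<lambda>t. F t (K t * V0\<^sup>T))"
  note Vc = orthonormal_colsD(1)[OF V0] and Wc = orthonormal_colsD(1)[OF W]
  note P = range_proj_carrier[OF Vc] and Qc = range_proj_carrier(2)[OF Wc, folded Q_def]
  have Y0: "Y0 \<in> carrier_mat m n" using U0 S0 Vc by (auto simp: Y0_def)
  have ends: "a \<in> {a..b}" "b \<in> {a..b}" using ab by auto
  have Kc: "K t \<in> carrier_mat m r" if "t \<in> {a..b}" for t using K that by (auto simp: solves_mat_ode_def)
  have KV: "K t * V0\<^sup>T \<in> carrier_mat m n" if "t \<in> {a..b}" for t using Kc[OF that] Vc by auto
  have Gc: "G t \<in> carrier_mat m n" if "t \<in> {a..b}" for t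
    using that sub field_carrier KV by (auto simp: G_def)
  have F0: "F t Y0 \<in> carrier_mat m n" and FA: "F t (A t) \<in> carrier_mat m n" and At: "A t \<in> carrier_mat m n"
    if "t \<in> {a..b}" for t
    using that sub field_carrier Y0 mat_curve_carrier[OF exact] by auto
  have GP: "G t * V0 * V0\<^sup>T = G t * range_proj V0" if "t \<in> {a..b}" for t
    unfolding range_proj_def by (rule assoc_mult_mat) (use Gc[OF that] Vc in auto)
  have "mat_curve m r K (\<lambda>t. G t * V0) {a..b}"
    unfolding G_def using Gc Vc
    by (intro mat_curve_solves_ode[OF K]) (auto simp: G_def intro!: mult_carrier_mat[of _ m n])
  then have KVc: "mat_curve m n (\<lambda>t. K t * V0\<^sup>T) (\<lambda>t. G t * V0 * V0\<^sup>T) {a..b}"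
    by (rule mat_curve_mult_right) (use Vc in auto)
  have KY: "frob (Y0 - K t * V0\<^sup>T) \<le> B * (b - a)" if t: "t \<in> {a..b}" for t
  proof -
    have st: "{a..t} \<subseteq> {a..b}" using t by auto
    have "frob (K t * V0\<^sup>T - K a * V0\<^sup>T) \<le> B * (t - a)"
    proof (rule mean_value_inequality[OF mat_curve_subset[OF KVc st]])
      fix s assume "s \<in> {a..t}"
      then have s: "s \<in> {a..b}" using t by auto
      have "frob (G s * V0 * V0\<^sup>T) \<le> frob (G s)"
        unfolding GP[OF s]
        using contraction_frob_right[OF contraction_range_proj[OF V0] Gc[OF s]] by simp
      also have "\<dots> \<le> B" unfolding G_def using s sub KV by (intro field_bound) auto
      finally show "frob (G s * V0 * V0\<^sup>T) \<le> B" .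
    qed (use t in auto)
    also have "\<dots> \<le> B * (b - a)"
      using t order_trans[OF frob_nonneg field_bound[OF subsetD[OF sub t] Y0]]
      by (intro mult_left_mono) auto
    finally show ?thesis
      using frob_minus_commute[OF Y0 KV[OF t]] by (simp add: Ka Y0_def)
  qed
  have curve: "mat_curve m n (\<lambda>t. Q * (A t - K t * V0\<^sup>T)) (\<lambda>t. Q * (F t (A t) - G t * V0 * V0\<^sup>T)) {a..b}"
    by (intro mat_curve_mult_left[OF _ Qc] mat_curve_minus exact KVc)
  have "frob (Q * (A b - K b * V0\<^sup>T) - Q * (A a - K a * V0\<^sup>T))
      \<le> (L * (frob (A a - Y0) + 2 * B * (b - a)) + \<epsilon>) * (b - a)"
  proof (rule mean_value_inequality[OF curve ab])
    fix t assume t: "t \<in> {a..b}"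
    have tI: "t \<in> I" using t sub by auto
    have FGc: "(F t Y0 - G t) * range_proj V0 \<in> carrier_mat m n"
      "F t Y0 * range_coproj V0 \<in> carrier_mat m n" "F t (A t) - F t Y0 \<in> carrier_mat m n"
      using F0[OF t] Gc[OF t] P FA[OF t] by auto
    have "(F t Y0 - G t) * range_proj V0 = F t Y0 * range_proj V0 - G t * range_proj V0"
      by (rule minus_mult_distrib_mat) (use F0[OF t] Gc[OF t] P in auto)
    moreover have "F t Y0 * range_coproj V0 = F t Y0 - F t Y0 * range_proj V0"
      by (rule mult_range_coproj) (use F0[OF t] Vc in auto)
    moreover have "F t Y0 * range_proj V0 \<in> carrier_mat m n" "G t * range_proj V0 \<in> carrier_mat m n"
      using F0[OF t] Gc[OF t] P by auto
    ultimately have split: "F t (A t) - G t * V0 * V0\<^sup>T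
        = (F t (A t) - F t Y0) + (F t Y0 * range_coproj V0 + (F t Y0 - G t) * range_proj V0)"
      unfolding GP[OF t] using F0[OF t] Gc[OF t] FA[OF t] by (intro eq_matI) auto
    have "Q * (F t (A t) - G t * V0 * V0\<^sup>T) = Q * (F t (A t) - F t Y0)
        + (Q * (F t Y0 * range_coproj V0) + Q * ((F t Y0 - G t) * range_proj V0))"
      unfolding split using FGc Qc
        mult_add_distrib_mat[OF Qc FGc(3), of "F t Y0 * range_coproj V0 + (F t Y0 - G t) * range_proj V0"]
        mult_add_distrib_mat[OF Qc FGc(2,1)] by auto
    moreover have "frob (Q * (F t (A t) - F t Y0)
        + (Q * (F t Y0 * range_coproj V0) + Q * ((F t Y0 - G t) * range_proj V0)))
        \<le> frob (Q * (F t (A t) - F t Y0))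
          + (frob (Q * (F t Y0 * range_coproj V0)) + frob (Q * ((F t Y0 - G t) * range_proj V0)))"
    proof -
      note c = mult_carrier_mat[OF Qc FGc(3)] mult_carrier_mat[OF Qc FGc(2)] mult_carrier_mat[OF Qc FGc(1)]
      show ?thesis
        using frob_triangle[OF c(1) add_carrier_mat[OF c(3), of "Q * (F t Y0 * range_coproj V0)"]]
          frob_triangle[OF c(2,3)] by linarith
    qed
    moreover have "frob (Q * (F t (A t) - F t Y0)) \<le> L * (frob (A a - Y0) + B * (b - a))"
    proof -
      have "frob (Q * (F t (A t) - F t Y0)) \<le> frob (F t (A t) - F t Y0)"
        unfolding Q_def by (rule contraction_frob_left[OF contraction_range_coproj[OF W] FGc(3)])
      also have "\<dots> \<le> L * frob (A t - Y0)" by (rule field_lipschitz[OF tI At[OF t] Y0])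
      also have "\<dots> \<le> L * (frob (A a - Y0) + B * (t - a))"
        by (rule mult_left_mono[OF frob_minus_initial_le[OF Y0 t] L_nonneg])
      also have "\<dots> \<le> L * (frob (A a - Y0) + B * (b - a))"
        using t order_trans[OF frob_nonneg field_bound[OF tI Y0]]
        by (intro mult_left_mono add_left_mono L_nonneg) auto
      finally show ?thesis .
    qed
    moreover have "frob (Q * (F t Y0 * range_coproj V0)) \<le> \<epsilon>"
      using frob_coproj_residual[OF W U0 Vc F0[OF t] WU] normal[OF t] by (simp add: Q_def Y0_def)
    moreover have "frob (Q * ((F t Y0 - G t) * range_proj V0)) \<le> L * (B * (b - a))"
    proof -
      have "frob (Q * ((F t Y0 - G t) * range_proj V0)) \<le> frob ((F t Y0 - G t) * range_proj V0)"
        unfolding Q_def by (rule contraction_frob_left[OF contraction_range_coproj[OF W] FGc(1)])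
      also have "\<dots> \<le> frob (F t Y0 - G t)"
        using contraction_frob_right[OF contraction_range_proj[OF V0], of "F t Y0 - G t" m]
          F0[OF t] Gc[OF t] by simp
      also have "\<dots> \<le> L * frob (Y0 - K t * V0\<^sup>T)"
        unfolding G_def by (rule field_lipschitz[OF tI Y0 KV[OF t]])
      also have "\<dots> \<le> L * (B * (b - a))" by (rule mult_left_mono[OF KY[OF t] L_nonneg])
      finally show ?thesis .
    qed
    ultimately show "frob (Q * (F t (A t) - G t * V0 * V0\<^sup>T))
        \<le> L * (frob (A a - Y0) + 2 * B * (b - a)) + \<epsilon>"
      by (simp add: algebra_simps)
  qed
  moreover have "Q * (A b - K b * V0\<^sup>T) - Q * (A a - K a * V0\<^sup>T) = Q * (A b - A a)"
  proof -
    have Q0: "Q * (K t * V0\<^sup>T) = 0\<^sub>m m n" if "t \<in> {a..b}" "Q * K t = 0\<^sub>m m r" for t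
      using assoc_mult_mat[OF Qc Kc[OF that(1)], of "V0\<^sup>T" n] that(2) Vc by simp
    have QKa: "Q * K a = 0\<^sub>m m r"
      using assoc_mult_mat[OF Qc U0 S0] WU S0 by (simp add: Ka Q_def)
    have "Q * (A b - K b * V0\<^sup>T) = Q * A b - Q * (K b * V0\<^sup>T)"
      by (rule mult_minus_distrib_mat[OF Qc At[OF ends(2)] KV[OF ends(2)]])
    moreover have "Q * (A a - K a * V0\<^sup>T) = Q * A a - Q * (K a * V0\<^sup>T)"
      by (rule mult_minus_distrib_mat[OF Qc At[OF ends(1)] KV[OF ends(1)]])
    moreover have "Q * (A b - A a) = Q * A b - Q * A a"
      by (rule mult_minus_distrib_mat[OF Qc At[OF ends(2)] At[OF ends(1)]])
    moreover have "Q * A t - 0\<^sub>m m n = Q * A t" if "t \<in> {a..b}" for t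
      by (rule minus_zero_mat) (use Qc At[OF that] in auto)
    ultimately show ?thesis
      using Q0[OF ends(1) QKa] Q0[OF ends(2) WK[folded Q_def]] ends by simp
  qed
  ultimately show ?thesis by (simp add: Q_def Y0_def mult.commute)
qed

lemma L_step_increment_residual:
  assumes V0: "V0 \<in> carrier_mat n r" and U0: "orthonormal_cols m r U0" and S0: "S0 \<in> carrier_mat r r"
    and K: "solves_mat_ode n r a b (\<lambda>t K. (F t (U0 * K\<^sup>T))\<^sup>T * U0) K" and Ka: "K a = V0 * S0\<^sup>T"
    and W: "orthonormal_cols n k W" and WV: "range_coproj W * V0 = 0\<^sub>m n r"
    and WK: "range_coproj W * K b = 0\<^sub>m n r"
    and normal: "\<And>t. t \<in> {a..b} \<Longrightarrow>
      frob (range_coproj U0 * F t (U0 * S0 * V0\<^sup>T) * range_coproj V0) \<le> \<epsilon>"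
  shows "frob (range_coproj W * (A b - A a)\<^sup>T)
    \<le> (b - a) * (L * (frob (A a - U0 * S0 * V0\<^sup>T) + 2 * B * (b - a)) + \<epsilon>)"
proof -
  note Uc = orthonormal_colsD(1)[OF U0]
  note c = range_proj_carrier(2)[OF Uc] range_proj_carrier(2)[OF V0]
  define Y0 where "Y0 = U0 * S0 * V0\<^sup>T"
  have Y0: "Y0 \<in> carrier_mat m n" using Uc S0 V0 by (auto simp: Y0_def)
  have Y0T: "V0 * S0\<^sup>T * U0\<^sup>T = Y0\<^sup>T"
  proof -
    have "Y0\<^sup>T = V0\<^sup>T\<^sup>T * (U0 * S0)\<^sup>T" unfolding Y0_def by (rule transpose_mult) (use Uc S0 V0 in auto)
    also have "(U0 * S0)\<^sup>T = S0\<^sup>T * U0\<^sup>T" by (rule transpose_mult[OF Uc S0])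
    also have "V0\<^sup>T\<^sup>T * (S0\<^sup>T * U0\<^sup>T) = V0 * S0\<^sup>T * U0\<^sup>T"
      using assoc_mult_mat[of V0 n r "S0\<^sup>T" r "U0\<^sup>T" m] Uc S0 V0 by simp
    finally show ?thesis ..
  qed
  interpret tr: bounded_lipschitz_field n m "\<lambda>t X. (F t X\<^sup>T)\<^sup>T" I L B by (rule transposed_field)
  have ex: "mat_curve n m (\<lambda>t. (A t)\<^sup>T) (\<lambda>t. (F t ((A t)\<^sup>T)\<^sup>T)\<^sup>T) {a..b}"
    using mat_curve_transpose[OF exact] by simp
  have UK: "(X * U0\<^sup>T)\<^sup>T = U0 * X\<^sup>T" if "X \<in> carrier_mat n r" for X
    using transpose_mult[OF that, of "U0\<^sup>T" m] Uc by simp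
  have K': "solves_mat_ode n r a b (\<lambda>t K. (F t (K * U0\<^sup>T)\<^sup>T)\<^sup>T * U0) K"
    using K UK by (auto simp: solves_mat_ode_def)
  have norm': "frob (range_coproj V0 * (F t (V0 * S0\<^sup>T * U0\<^sup>T)\<^sup>T)\<^sup>T * range_coproj U0) \<le> \<epsilon>"
    if t: "t \<in> {a..b}" for t
  proof -
    have FY: "F t Y0 \<in> carrier_mat m n" using t sub field_carrier Y0 by auto
    have "frob (range_coproj V0 * (F t Y0)\<^sup>T * range_coproj U0)
        = frob (range_coproj U0 * F t Y0 * range_coproj V0)"
      using frob_transpose_triple[OF c(1) FY c(2)] by simp
    then show ?thesis using normal[OF t] by (simp add: Y0T Y0_def[symmetric])
  qed
  have At: "A a \<in> carrier_mat m n" "A b \<in> carrier_mat m n"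
    using mat_curve_carrier(1)[OF exact] ab by auto
  have "frob (range_coproj W * ((A b)\<^sup>T - (A a)\<^sup>T))
      \<le> (b - a) * (L * (frob ((A a)\<^sup>T - V0 * S0\<^sup>T * U0\<^sup>T) + 2 * B * (b - a)) + \<epsilon>)"
    using S0 by (intro tr.K_step_increment_residual[OF ab sub ex V0 U0 _ K' Ka W WV WK norm']) auto
  moreover have "(A b)\<^sup>T - (A a)\<^sup>T = (A b - A a)\<^sup>T" using transpose_minus[OF At(2,1)] by simp
  moreover have "frob ((A a)\<^sup>T - V0 * S0\<^sup>T * U0\<^sup>T) = frob (A a - Y0)"
    unfolding Y0T using transpose_minus[OF At(1) Y0] frob_transpose by metis
  ultimately show ?thesis by (simp add: Y0_def)
qed

end

end

context bounded_lipschitz_field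
begin

text \<open>In terms of the full matrix, the projected equation is the original one with the two-sided projection
  applied to the right-hand side, and it starts from \<open>Y0\<close> itself as the bases contain those of \<open>Y0\<close>.\<close>

lemma galerkin_solution_curve:
  assumes sub: "{a..b} \<subseteq> I" and ab: "a \<le> b"
    and U: "U \<in> carrier_mat m k" and V: "V \<in> carrier_mat n k" and f: "low_rank_fact m n r U0 S0 V0 Y0"
    and UU0: "range_coproj U * U0 = 0\<^sub>m m r" and VV0: "range_coproj V * V0 = 0\<^sub>m n r"
    and S: "galerkin_solution F a b k U V U0 S0 V0 S"
  shows "mat_curve m n (\<lambda>t. U * S t * V\<^sup>T)
      (\<lambda>t. range_proj U * F t (U * S t * V\<^sup>T) * range_proj V) {a..b}"
    and "U * S a * V\<^sup>T = Y0" and "S b \<in> carrier_mat k k"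
proof -
  note d = low_rank_factD[OF f]
  note P = range_proj_carrier(1)[OF U] range_proj_carrier(1)[OF V]
  have ode: "solves_mat_ode k k a b (\<lambda>t S. U\<^sup>T * F t (U * S * V\<^sup>T) * V) S"
    and init: "S a = (U\<^sup>T * U0) * S0 * (V\<^sup>T * V0)\<^sup>T"
    using S by (auto simp: galerkin_solution_def)
  have Sc: "S t \<in> carrier_mat k k" if "t \<in> {a..b}" for t using ode that by (auto simp: solves_mat_ode_def)
  then show "S b \<in> carrier_mat k k" using ab by auto
  have Y: "U * S t * V\<^sup>T \<in> carrier_mat m n" if "t \<in> {a..b}" for t using Sc[OF that] U V by auto
  have FY: "F t (U * S t * V\<^sup>T) \<in> carrier_mat m n" if "t \<in> {a..b}" for t
    using field_carrier[OF _ Y[OF that]] sub that by auto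
  have "mat_curve k k S (\<lambda>t. U\<^sup>T * F t (U * S t * V\<^sup>T) * V) {a..b}"
  proof (rule mat_curve_solves_ode[OF ode])
    fix t assume "t \<in> {a..b}"
    then have "U\<^sup>T * F t (U * S t * V\<^sup>T) \<in> carrier_mat k n" using FY U by auto
    then show "U\<^sup>T * F t (U * S t * V\<^sup>T) * V \<in> carrier_mat k k" using V by simp
  qed
  from mat_curve_mult_right[OF mat_curve_mult_left[OF this U], of "V\<^sup>T" n]
  have "mat_curve m n (\<lambda>t. U * S t * V\<^sup>T) (\<lambda>t. U * (U\<^sup>T * F t (U * S t * V\<^sup>T) * V) * V\<^sup>T) {a..b}"
    using V by simp
  then show "mat_curve m n (\<lambda>t. U * S t * V\<^sup>T)
      (\<lambda>t. range_proj U * F t (U * S t * V\<^sup>T) * range_proj V) {a..b}"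
    by (rule mat_curve_cong_deriv) (rule mult_transpose_sandwich[OF U V FY])
  have "(V\<^sup>T * V0)\<^sup>T = V0\<^sup>T * V" using transpose_mult[of "V\<^sup>T" k n V0 r] V d by simp
  then have "S a = (U\<^sup>T * U0) * S0 * (V0\<^sup>T * V)" using init by simp
  also have "\<dots> = (U\<^sup>T * U0) * S0 * V0\<^sup>T * V"
    by (rule assoc_mult_mat[symmetric]) (use U V d in auto)
  also have "(U\<^sup>T * U0) * S0 = U\<^sup>T * (U0 * S0)" by (rule assoc_mult_mat) (use U d in auto)
  also have "U\<^sup>T * (U0 * S0) * V0\<^sup>T = U\<^sup>T * (U0 * S0 * V0\<^sup>T)" by (rule assoc_mult_mat) (use U d in auto)
  finally have "U * S a * V\<^sup>T = range_proj U * Y0 * range_proj V"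
    using mult_transpose_sandwich[OF U V d(6)] by (simp add: d(7))
  also have "range_proj U * Y0 = Y0"
  proof -
    have "range_proj U * Y0 = range_proj U * (U0 * S0) * V0\<^sup>T"
      unfolding d(7) by (rule assoc_mult_mat[symmetric]) (use P d in auto)
    also have "range_proj U * (U0 * S0) = range_proj U * U0 * S0"
      by (rule assoc_mult_mat[symmetric]) (use P d in auto)
    finally show ?thesis using range_proj_id[OF U d(3) UU0] d(7) by simp
  qed
  also have "Y0 * range_proj V = Y0"
  proof -
    have "V0\<^sup>T * range_proj V = V0\<^sup>T"
      using transpose_mult[OF P(2) d(4)] range_proj_id[OF V d(4) VV0] by simp
    moreover have "Y0 * range_proj V = U0 * S0 * (V0\<^sup>T * range_proj V)"
      unfolding d(7) by (rule assoc_mult_mat) (use P d in auto)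
    ultimately show ?thesis using d(7) by simp
  qed
  finally show "U * S a * V\<^sup>T = Y0" .
qed

context
  fixes a b :: real and A Y :: "real \<Rightarrow> real mat" and k l :: nat and U V :: "real mat"
  assumes ab: "a \<le> b" and sub: "{a..b} \<subseteq> I"
    and exact: "mat_curve m n A (\<lambda>t. F t (A t)) {a..b}"
    and U: "orthonormal_cols m k U" and V: "orthonormal_cols n l V"
    and galerkin: "mat_curve m n Y (\<lambda>t. range_proj U * F t (Y t) * range_proj V) {a..b}"
begin

lemma galerkin_increment:
  assumes t: "t \<in> {a..b}"
  shows "frob (Y t - Y a) \<le> B * (t - a)"
proof (rule mean_value_inequality)
  show "mat_curve m n Y (\<lambda>t. range_proj U * F t (Y t) * range_proj V) {a..t}"
    by (rule mat_curve_subset[OF galerkin]) (use t in auto)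
  fix s assume "s \<in> {a..t}"
  then have s: "s \<in> {a..b}" using t by auto
  note c = mat_curve_carrier(1)[OF galerkin s]
  show "frob (range_proj U * F s (Y s) * range_proj V) \<le> B"
    using order_trans[OF frob_proj_sandwich_le[OF U V field_carrier[OF _ c]] field_bound[OF _ c]] s sub
    by auto
qed (use t in auto)

text \<open>An a priori bound to start from: both curves move with speed at most \<open>B\<close>.\<close>

lemma galerkin_error_crude:
  assumes t: "t \<in> {a..b}"
  shows "frob (A t - Y t) \<le> frob (A a - Y a) + 2 * B * (b - a)"
proof -
  have aa: "a \<in> {a..b}" using ab by simp
  note c = mat_curve_carrier(1)[OF exact] mat_curve_carrier(1)[OF galerkin]
  have B0: "0 \<le> B" using order_trans[OF frob_nonneg field_bound[OF subsetD[OF sub t] c(1)[OF t]]] .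
  have "frob (A t - Y t) \<le> frob (A t - Y a) + frob (Y a - Y t)"
    by (rule frob_minus_triangle[OF c(1)[OF t] c(2)[OF aa] c(2)[OF t]])
  also have "frob (Y a - Y t) \<le> B * (t - a)"
    using galerkin_increment[OF t] frob_minus_commute[OF c(2)[OF aa] c(2)[OF t]] by simp
  also have "frob (A t - Y a) \<le> frob (A a - Y a) + B * (t - a)"
    by (rule frob_minus_initial_le[OF ab sub exact c(2)[OF aa] t])
  also have "frob (A a - Y a) + B * (t - a) + B * (t - a) \<le> frob (A a - Y a) + 2 * B * (b - a)"
    using t B0 mult_left_mono[of "t - a" "b - a" B] by simp
  finally show ?thesis by simp
qed

text \<open>Any bound \<open>M\<close> of the error on the interval reappears with a factor \<open>L * (t - a)\<close>. Inserting the crude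
  bound, and if necessary the result once more, replaces a Gronwall argument.\<close>

lemma galerkin_error:
  assumes M: "\<And>s. s \<in> {a..b} \<Longrightarrow> frob (A s - Y s) \<le> M" and t: "t \<in> {a..b}"
  shows "frob (A t - Y t) \<le> frob (A a - Y a)
    + (frob (range_coproj U * (A t - A a)) + frob (range_coproj V * (A t - A a)\<^sup>T)) + L * M * (t - a)"
proof -
  define \<Phi> where "\<Phi> = (\<lambda>X. range_proj U * X * range_proj V)"
  have aa: "a \<in> {a..b}" using ab by simp
  note P = range_proj_carrier(1)[OF orthonormal_colsD(1)[OF U]]
    range_proj_carrier(1)[OF orthonormal_colsD(1)[OF V]]
  have \<Phi>c: "\<Phi> X \<in> carrier_mat m n" if "X \<in> carrier_mat m n" for X
    using P that by (auto simp: \<Phi>_def)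
  have \<Phi>minus: "\<Phi> (X - Z) = \<Phi> X - \<Phi> Z" if "X \<in> carrier_mat m n" "Z \<in> carrier_mat m n" for X Z
    unfolding \<Phi>_def by (rule sandwich_minus[OF P that])
  note c = mat_curve_carrier(1)[OF exact] mat_curve_carrier(1)[OF galerkin]
  have st: "{a..t} \<subseteq> {a..b}" using t by auto
  define W where "W = (\<lambda>s. \<Phi> (A s) - Y s)"
  have curve: "mat_curve m n W (\<lambda>s. \<Phi> (F s (A s)) - \<Phi> (F s (Y s))) {a..t}"
    unfolding W_def \<Phi>_def
    by (rule mat_curve_minus[OF mat_curve_mult_right[OF mat_curve_mult_left[OF
            mat_curve_subset[OF exact st] P(1)] P(2)] mat_curve_subset[OF galerkin st]])
  have "frob (W t - W a) \<le> L * M * (t - a)"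
  proof (rule mean_value_inequality[OF curve])
    show "a \<le> t" using t by simp
    fix s assume "s \<in> {a..t}"
    then have s: "s \<in> {a..b}" using st by auto
    then have sI: "s \<in> I" using sub by auto
    note Fc = field_carrier[OF sI c(1)[OF s]] field_carrier[OF sI c(2)[OF s]]
    have "frob (\<Phi> (F s (A s)) - \<Phi> (F s (Y s))) \<le> frob (F s (A s) - F s (Y s))"
      unfolding \<Phi>minus[OF Fc, symmetric] unfolding \<Phi>_def
      by (rule frob_proj_sandwich_le[OF U V]) (use Fc in auto)
    also have "\<dots> \<le> L * frob (A s - Y s)" by (rule field_lipschitz[OF sI c(1)[OF s] c(2)[OF s]])
    also have "\<dots> \<le> L * M" by (rule mult_left_mono[OF M[OF s] L_nonneg])
    finally show "frob (\<Phi> (F s (A s)) - \<Phi> (F s (Y s))) \<le> L * M" .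
  qed
  moreover define \<Delta> where "\<Delta> = A t - A a"
  have \<Delta>: "\<Delta> \<in> carrier_mat m n" unfolding \<Delta>_def using c(1)[OF t] c(1)[OF aa] by auto
  note cs = c(1)[OF t] c(1)[OF aa] c(2)[OF t] c(2)[OF aa] \<Phi>c[OF c(1)[OF t]] \<Phi>c[OF c(1)[OF aa]]
  \<comment> \<open>initial error, projection defect of the increment, and accumulated difference of the fields\<close>
  have split: "A t - Y t = ((A a - Y a) + (\<Delta> - \<Phi> \<Delta>)) + (W t - W a)"
    unfolding \<Delta>_def \<Phi>minus[OF cs(1,2)] W_def using cs by (intro eq_matI) auto
  have "W t - W a \<in> carrier_mat m n" unfolding W_def using cs by auto
  then have "frob (A t - Y t) \<le> frob (A a - Y a) + frob (\<Delta> - \<Phi> \<Delta>) + frob (W t - W a)"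
    unfolding split
    using frob_triangle[of "(A a - Y a) + (\<Delta> - \<Phi> \<Delta>)" m n "W t - W a"]
      frob_triangle[of "A a - Y a" m n "\<Delta> - \<Phi> \<Delta>"] cs \<Delta> \<Phi>c[OF \<Delta>] by simp
  moreover have "frob (\<Delta> - \<Phi> \<Delta>) \<le> frob (range_coproj U * \<Delta>) + frob (range_coproj V * \<Delta>\<^sup>T)"
    unfolding \<Phi>_def by (rule frob_proj_defect_le[OF U V \<Delta>])
  ultimately show ?thesis by (simp add: \<Delta>_def)
qed

end

end

section \<open>Local error of one step\<close>

context bounded_lipschitz_field
begin

text \<open>Both K-step and L-step residuals have the same bound. The last summand of the error is the crude
  bound multiplied by the Lipschitz constant and the length \<open>h / 2\<close>.\<close>

lemma midpoint_approx_error: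
  assumes h: "0 < h" and sub: "{a..a + h} \<subseteq> I"
    and exact: "mat_curve m n A (\<lambda>t. F t (A t)) {a..a + h}"
    and f: "low_rank_fact m n r U0 S0 V0 Y0"
    and normal: "\<And>t. t \<in> {a..a + h} \<Longrightarrow>
      frob (range_coproj U0 * F t Y0 * range_coproj V0) \<le> \<epsilon>"
    and mid: "midpoint_approx m n F a h U0 S0 V0 rhat Uh Vh Yh"
    and e: "e = frob (A a - Y0)"
  shows "orthonormal_cols m rhat Uh" and "orthonormal_cols n rhat Vh"
    and "range_coproj Uh * U0 = 0\<^sub>m m r" and "range_coproj Vh * V0 = 0\<^sub>m n r"
    and "\<exists>Sh\<in>carrier_mat rhat rhat. Yh = Uh * Sh * Vh\<^sup>T"
    and "frob (Yh - Y0) \<le> B * (h / 2)"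
    and "frob (A (a + h / 2) - Yh) \<le> e + h * (L * (e + B * h) + \<epsilon>) + h / 2 * (L * (e + B * h))"
proof -
  note d = low_rank_factD[OF f]
  have dims: "dim_col U0 = r" "dim_col V0 = r" "dim_row U0 = m" "dim_row V0 = n" using d by auto
  from mid obtain K Lc S where
    K: "solves_mat_ode m r a (a + h/2) (\<lambda>t K. F t (K * V0\<^sup>T) * V0) K" and Ka: "K a = U0 * S0"
    and Uh: "is_orth m rhat [U0, K (a + h/2)] Uh"
    and Lo: "solves_mat_ode n r a (a + h/2) (\<lambda>t L. (F t (U0 * L\<^sup>T))\<^sup>T * U0) Lc" and La: "Lc a = V0 * S0\<^sup>T"
    and Vh: "is_orth n rhat [V0, Lc (a + h/2)] Vh"
    and S: "galerkin_solution F a (a + h/2) rhat Uh Vh U0 S0 V0 S"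
    and Yh: "Yh = Uh * S (a + h/2) * Vh\<^sup>T"
    unfolding midpoint_approx_def dims by blast
  have ends: "a + h/2 \<in> {a..a + h/2}" "a \<le> a + h/2" using h by auto
  have Kb: "K (a + h/2) \<in> carrier_mat m r" and Lb: "Lc (a + h/2) \<in> carrier_mat n r"
    using K Lo ends by (auto simp: solves_mat_ode_def)
  show Uho: "orthonormal_cols m rhat Uh" and Vho: "orthonormal_cols n rhat Vh"
    using is_orthD[OF Uh] is_orthD[OF Vh] .
  show UU0: "range_coproj Uh * U0 = 0\<^sub>m m r" and VV0: "range_coproj Vh * V0 = 0\<^sub>m n r"
    using is_orth_pair_annihilates(1)[OF Uh d(3) Kb] is_orth_pair_annihilates(1)[OF Vh d(4) Lb] .
  have UK: "range_coproj Uh * K (a + h/2) = 0\<^sub>m m r" and VL: "range_coproj Vh * Lc (a + h/2) = 0\<^sub>m n r"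
    using is_orth_pair_annihilates(2)[OF Uh d(3) Kb] is_orth_pair_annihilates(2)[OF Vh d(4) Lb] .
  have half: "{a..a + h/2} \<subseteq> {a..a + h}" using h by auto
  have sub': "{a..a + h/2} \<subseteq> I" using half sub by auto
  note exact' = mat_curve_subset[OF exact half]
  have normal': "frob (range_coproj U0 * F t (U0 * S0 * V0\<^sup>T) * range_coproj V0) \<le> \<epsilon>"
    if "t \<in> {a..a + h/2}" for t
    using normal[of t] that half by (auto simp: d(7)[symmetric])
  note G = galerkin_solution_curve[OF sub' ends(2) orthonormal_colsD(1)[OF Uho]
      orthonormal_colsD(1)[OF Vho] f UU0 VV0 S]
  show "\<exists>Sh\<in>carrier_mat rhat rhat. Yh = Uh * Sh * Vh\<^sup>T" using G(3) Yh by blast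
  show "frob (Yh - Y0) \<le> B * (h / 2)"
    using galerkin_increment[OF ends(2) sub' exact' Uho Vho G(1) ends(1)] G(2) by (simp add: Yh)
  have crude: "frob (A s - Uh * S s * Vh\<^sup>T) \<le> e + B * h" if "s \<in> {a..a + h/2}" for s
    using galerkin_error_crude[OF ends(2) sub' exact' Uho Vho G(1) that] G(2) by (simp add: e)
  have "frob (range_coproj Uh * (A (a + h/2) - A a)) \<le> h / 2 * (L * (e + B * h) + \<epsilon>)"
    using K_step_increment_residual[OF ends(2) sub' exact' d(3,2,5) K Ka Uho UU0 UK normal']
    by (simp add: e d(7))
  moreover have "frob (range_coproj Vh * (A (a + h/2) - A a)\<^sup>T) \<le> h / 2 * (L * (e + B * h) + \<epsilon>)"
    using L_step_increment_residual[OF ends(2) sub' exact' d(4,1,5) Lo La Vho VV0 VL normal']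
    by (simp add: e d(7))
  moreover have "frob (A (a + h/2) - Yh) \<le> e
    + (frob (range_coproj Uh * (A (a + h/2) - A a)) + frob (range_coproj Vh * (A (a + h/2) - A a)\<^sup>T))
    + L * (e + B * h) * (h / 2)"
    using galerkin_error[OF ends(2) sub' exact' Uho Vho G(1) crude ends(1)] G(2)
    by (simp add: e Yh)
  ultimately show "frob (A (a + h / 2) - Yh)
      \<le> e + h * (L * (e + B * h) + \<epsilon>) + h / 2 * (L * (e + B * h))"
    by (simp add: algebra_simps)
qed

text \<open>Here \<open>\<mu>\<close> bounds the error of the midpoint value, \<open>\<eta>\<close> what the final bases miss of the exact derivative at
  the midpoint, and \<open>M\<close> the error of the second Galerkin solution at all times of the step.\<close>

lemma midpoint_bug_step_error:
  assumes h: "0 < h" and sub: "{a..a + h} \<subseteq> I" and \<theta>: "0 \<le> \<theta>"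
    and exact: "mat_curve m n A (\<lambda>t. F t (A t)) {a..a + h}"
    and A: "mat_curve m n A A1 {a..a + h}" and A1: "mat_curve m n A1 A2 {a..a + h}"
    and A2: "mat_curve m n A2 A3 {a..a + h}"
    and D2: "\<And>t. t \<in> {a..a + h} \<Longrightarrow> frob (A2 t) \<le> D"
    and D3: "\<And>t. t \<in> {a..a + h} \<Longrightarrow> frob (A3 t) \<le> D"
    and A1mid: "A1 (a + h / 2) = F (a + h / 2) (A (a + h / 2))"
    and f: "low_rank_fact m n r U0 S0 V0 Y0"
    and e: "e = frob (A a - Y0)" and near: "e + B * h < \<rho>"
    and small: "\<And>t X. t \<in> {a..a + h} \<Longrightarrow> X \<in> fixed_rank_mats m n r \<Longrightarrow>
      frob (X - A t) < \<rho> \<Longrightarrow> frob (tangent_proj_perp r X (F t X)) \<le> \<epsilon>"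
    and small_hat: "\<And>t X. t \<in> {a..a + h} \<Longrightarrow> X \<in> fixed_rank_mats m n rhat \<Longrightarrow>
      frob (X - A t) < \<rho> \<Longrightarrow> frob (tangent_proj_perp rhat X (F t X)) \<le> \<epsilon>hat"
    and step: "midpoint_bug_step m n F a h \<theta> U0 S0 V0 rhat U1 S1 V1"
    and \<mu>: "\<mu> = e + h * (L * (e + B * h) + \<epsilon>) + h / 2 * (L * (e + B * h))"
    and \<eta>: "\<eta> = \<epsilon>hat + L * \<mu>"
    and M: "M = e + 2 * (h * (\<eta> + D * h)) + L * (e + 2 * B * h) * h"
  shows "low_rank_fact m n (dim_col U1) U1 S1 V1 (U1 * S1 * V1\<^sup>T)"
    and "frob (U1 * S1 * V1\<^sup>T - A (a + h))
      \<le> e + 2 * (h * \<eta> + D * h ^ 3 / 4) + L * M * h + \<theta>"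
proof -
  from step obtain Uh Vh Yh rbar Ub Vb S where
    mid: "midpoint_approx m n F a h U0 S0 V0 rhat Uh Vh Yh"
    and Ub: "is_orth m rbar [Uh, h \<cdot>\<^sub>m (F (a + h/2) Yh * Vh)] Ub"
    and Vb: "is_orth n rbar [Vh, h \<cdot>\<^sub>m ((F (a + h/2) Yh)\<^sup>T * Uh)] Vb"
    and S: "galerkin_solution F a (a + h) rbar Ub Vb U0 S0 V0 S"
    and svd: "svd_truncation \<theta> rbar Ub (S (a + h)) Vb U1 S1 V1"
    unfolding midpoint_bug_step_def by blast
  note d = low_rank_factD[OF f]
  define c where "c = a + h / 2"
  have cI: "c \<in> {a..a + h}" "c \<in> I" and ends: "a \<in> {a..a + h}" "a + h \<in> {a..a + h}" "a \<le> a + h"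
    using h sub by (auto simp: c_def)
  note At = mat_curve_carrier(1)[OF exact]
  have B0: "0 \<le> B" using order_trans[OF frob_nonneg field_bound[OF cI(2) At[OF cI(1)]]] .
  have drift: "frob (Y0 - A t) \<le> e + B * (t - a)" if t: "t \<in> {a..a + h}" for t
    using frob_minus_initial_le[OF ends(3) sub exact d(6) t] frob_minus_commute[OF d(6) At[OF t]]
    by (simp add: e)
  have normal: "frob (range_coproj U0 * F t Y0 * range_coproj V0) \<le> \<epsilon>" if t: "t \<in> {a..a + h}" for t
  proof -
    have "B * (t - a) \<le> B * h" using t B0 by (intro mult_left_mono) auto
    then have "frob (Y0 - A t) < \<rho>" using drift[OF t] near by simp
    moreover have "Y0 \<in> fixed_rank_mats m n r"
      using d(6) low_rank_fact_rank[OF f] by (simp add: fixed_rank_mats_def)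
    ultimately have "frob (tangent_proj_perp r Y0 (F t Y0)) \<le> \<epsilon>" using small[OF t] by simp
    then show ?thesis using tangent_proj_perp_eq[OF f field_carrier[OF _ d(6)]] t sub by auto
  qed
  note half = midpoint_approx_error[OF h sub exact f normal mid e]
  note Uh = orthonormal_colsD(1)[OF half(1)] and Vh = orthonormal_colsD(1)[OF half(2)]
  obtain Sh where Sh: "Sh \<in> carrier_mat rhat rhat" "Yh = Uh * Sh * Vh\<^sup>T" using half(5) by blast
  have Yh: "Yh \<in> carrier_mat m n" unfolding Sh(2) using Uh Vh Sh(1) by auto
  have err_mid: "frob (A c - Yh) \<le> \<mu>" using half(7) by (simp add: c_def \<mu>)
  define Fh where "Fh = F c Yh"
  have Fh: "Fh \<in> carrier_mat m n" unfolding Fh_def by (rule field_carrier[OF cI(2) Yh])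
  \<comment> \<open>The numerical and the exact value each move by at most \<open>B * h / 2\<close> in half a step.\<close>
  have near_mid: "frob (Yh - A c) < \<rho>"
  proof -
    have "frob (Yh - A c) \<le> frob (Yh - Y0) + frob (Y0 - A c)"
      by (rule frob_minus_triangle[OF Yh d(6) At[OF cI(1)]])
    then show ?thesis using half(6) drift[OF cI(1)] near by (simp add: c_def)
  qed
  have Fh_normal: "frob (range_coproj Uh * Fh * range_coproj Vh) \<le> \<epsilon>hat"
    unfolding Fh_def Sh(2)
    by (rule frob_normal_component_le[OF half(1,2) Sh(1) field_carrier[OF cI(2)]
          field_lipschitz[OF cI(2)] At[OF cI(1)] near_mid[unfolded Sh(2)] small_hat[OF cI(1)]])
  have FhV: "Fh * Vh \<in> carrier_mat m rhat" and FhU: "Fh\<^sup>T * Uh \<in> carrier_mat n rhat"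
    using Fh Uh Vh by auto
  note Ub' = Ub[folded c_def, folded Fh_def] and Vb' = Vb[folded c_def, folded Fh_def]
  note Ubo = is_orthD[OF Ub] and Vbo = is_orthD[OF Vb]
  note Qc = range_proj_carrier(2)[OF orthonormal_colsD(1)[OF Ubo]]
    range_proj_carrier(2)[OF orthonormal_colsD(1)[OF Vbo]]
  note hFV = smult_carrier_mat[OF FhV, of h] and hFU = smult_carrier_mat[OF FhU, of h]
  note UbUh = is_orth_pair_annihilates(1)[OF Ub' Uh hFV]
    and VbVh = is_orth_pair_annihilates(1)[OF Vb' Vh hFU]
  have UbF: "range_coproj Ub * (Fh * Vh) = 0\<^sub>m m rhat"
  proof (rule smult_eq_0_mat)
    show "h \<cdot>\<^sub>m (range_coproj Ub * (Fh * Vh)) = 0\<^sub>m m rhat"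
      using is_orth_pair_annihilates(2)[OF Ub' Uh hFV]
      unfolding mult_smult_distrib[OF Qc(1) FhV] .
  qed (use h mult_carrier_mat[OF Qc(1) FhV] in auto)
  have VbF: "range_coproj Vb * (Fh\<^sup>T * Uh) = 0\<^sub>m n rhat"
  proof (rule smult_eq_0_mat)
    show "h \<cdot>\<^sub>m (range_coproj Vb * (Fh\<^sup>T * Uh)) = 0\<^sub>m n rhat"
      using is_orth_pair_annihilates(2)[OF Vb' Vh hFU]
      unfolding mult_smult_distrib[OF Qc(2) FhU] .
  qed (use h mult_carrier_mat[OF Qc(2) FhU] in auto)
  note FA = field_carrier[OF cI(2) At[OF cI(1)]]
  have FA_diff: "frob (F c (A c) - Fh) \<le> L * \<mu>"
    unfolding Fh_def
    using order_trans[OF field_lipschitz[OF cI(2) At[OF cI(1)] Yh] mult_left_mono[OF err_mid L_nonneg]] .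
  have etaU: "frob (range_coproj Ub * F c (A c)) \<le> \<eta>"
  proof -
    have "frob (range_coproj Ub * F c (A c))
        \<le> frob (range_coproj Ub * Fh) + frob (range_coproj Ub * F c (A c) - range_coproj Ub * Fh)"
      by (rule frob_le_add_minus[OF mult_carrier_mat[OF Qc(1) FA] mult_carrier_mat[OF Qc(1) Fh]])
    also have "range_coproj Ub * F c (A c) - range_coproj Ub * Fh = range_coproj Ub * (F c (A c) - Fh)"
      by (rule mult_minus_distrib_mat[OF Qc(1) FA Fh, symmetric])
    also have "frob (range_coproj Ub * (F c (A c) - Fh)) \<le> frob (F c (A c) - Fh)"
      by (rule contraction_frob_left[OF contraction_range_coproj[OF Ubo]]) (use FA Fh in auto)
    also have "frob (range_coproj Ub * Fh) \<le> \<epsilon>hat"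
      using frob_coproj_residual_range[OF Ubo Uh Vh Fh UbUh UbF] Fh_normal by simp
    finally show ?thesis using FA_diff by (simp add: \<eta>)
  qed
  have etaV: "frob (range_coproj Vb * (F c (A c))\<^sup>T) \<le> \<eta>"
  proof -
    have T: "(F c (A c))\<^sup>T \<in> carrier_mat n m" "Fh\<^sup>T \<in> carrier_mat n m" using FA Fh by auto
    have "frob (range_coproj Vb * (F c (A c))\<^sup>T)
        \<le> frob (range_coproj Vb * Fh\<^sup>T) + frob (range_coproj Vb * (F c (A c))\<^sup>T - range_coproj Vb * Fh\<^sup>T)"
      by (rule frob_le_add_minus[OF mult_carrier_mat[OF Qc(2) T(1)] mult_carrier_mat[OF Qc(2) T(2)]])
    also have "range_coproj Vb * (F c (A c))\<^sup>T - range_coproj Vb * Fh\<^sup>T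
        = range_coproj Vb * ((F c (A c))\<^sup>T - Fh\<^sup>T)"
      by (rule mult_minus_distrib_mat[OF Qc(2) T, symmetric])
    also have "(F c (A c))\<^sup>T - Fh\<^sup>T = (F c (A c) - Fh)\<^sup>T" by (rule transpose_minus[OF FA Fh, symmetric])
    also have "frob (range_coproj Vb * (F c (A c) - Fh)\<^sup>T) \<le> frob (F c (A c) - Fh)\<^sup>T"
      by (rule contraction_frob_left[OF contraction_range_coproj[OF Vbo], where n = m])
        (use FA Fh in auto)
    also have "frob (range_coproj Vb * Fh\<^sup>T) \<le> \<epsilon>hat"
    proof -
      have "frob (range_coproj Vb * Fh\<^sup>T) \<le> frob (range_coproj Vh * Fh\<^sup>T * range_coproj Uh)"
        by (rule frob_coproj_residual_range[OF Vbo Vh Uh T(2) VbVh VbF])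
      also have "\<dots> = frob (range_coproj Uh * Fh * range_coproj Vh)"
        using frob_transpose_triple[OF range_proj_carrier(2)[OF Uh] Fh range_proj_carrier(2)[OF Vh]]
        by simp
      finally show ?thesis using Fh_normal by simp
    qed
    finally show ?thesis using FA_diff by (simp add: \<eta>)
  qed
  have cmid: "(a + (a + h)) / 2 = c" by (simp add: c_def field_simps)
  have etaU': "frob (range_coproj Ub * A1 ((a + (a + h)) / 2)) \<le> \<eta>"
    and etaV': "frob (range_coproj Vb * (A1 ((a + (a + h)) / 2))\<^sup>T) \<le> \<eta>"
    using etaU etaV A1mid unfolding cmid by (simp_all add: c_def)
  have incU: "frob (range_coproj Ub * (A t - A a)) \<le> h * (\<eta> + D * h)"
    "frob (range_coproj Ub * (A (a + h) - A a)) \<le> h * \<eta> + D * h ^ 3 / 4"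
    if "t \<in> {a..a + h}" for t
    using increment_residual[OF A A1 A2 D2 D3 Ubo etaU' that] by simp_all
  have incV: "frob (range_coproj Vb * (A t - A a)\<^sup>T) \<le> h * (\<eta> + D * h)"
    "frob (range_coproj Vb * (A (a + h) - A a)\<^sup>T) \<le> h * \<eta> + D * h ^ 3 / 4"
    if t: "t \<in> {a..a + h}" for t
  proof -
    have "frob ((A2 s)\<^sup>T) \<le> D" "frob ((A3 s)\<^sup>T) \<le> D" if "s \<in> {a..a + h}" for s
      using D2[OF that] D3[OF that] by simp_all
    note * = increment_residual[OF mat_curve_transpose[OF A] mat_curve_transpose[OF A1]
        mat_curve_transpose[OF A2] this Vbo etaV' t]
    show "frob (range_coproj Vb * (A t - A a)\<^sup>T) \<le> h * (\<eta> + D * h)"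
      using *(1) transpose_minus[OF At[OF t] At[OF ends(1)]] by simp
    show "frob (range_coproj Vb * (A (a + h) - A a)\<^sup>T) \<le> h * \<eta> + D * h ^ 3 / 4"
      using *(2) transpose_minus[OF At[OF ends(2)] At[OF ends(1)]] by simp
  qed
  have UbU0: "range_coproj Ub * U0 = 0\<^sub>m m r"
  proof -
    have "U0 = Uh * (Uh\<^sup>T * U0)"
      using range_proj_id[OF Uh d(3) half(3)] assoc_mult_mat[of Uh m rhat "Uh\<^sup>T" m U0 r] Uh d(3)
      by (simp add: range_proj_def)
    then have "range_coproj Ub * U0 = range_coproj Ub * (Uh * (Uh\<^sup>T * U0))" by simp
    also have "\<dots> = range_coproj Ub * Uh * (Uh\<^sup>T * U0)"
      by (rule assoc_mult_mat[symmetric]) (use Qc Uh d in auto)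
    finally show ?thesis using UbUh Uh d(3) by simp
  qed
  have VbV0: "range_coproj Vb * V0 = 0\<^sub>m n r"
  proof -
    have "V0 = Vh * (Vh\<^sup>T * V0)"
      using range_proj_id[OF Vh d(4) half(4)] assoc_mult_mat[of Vh n rhat "Vh\<^sup>T" n V0 r] Vh d(4)
      by (simp add: range_proj_def)
    then have "range_coproj Vb * V0 = range_coproj Vb * (Vh * (Vh\<^sup>T * V0))" by simp
    also have "\<dots> = range_coproj Vb * Vh * (Vh\<^sup>T * V0)"
      by (rule assoc_mult_mat[symmetric]) (use Qc Vh d in auto)
    finally show ?thesis using VbVh Vh d(4) by simp
  qed
  note G = galerkin_solution_curve[OF sub ends(3) orthonormal_colsD(1)[OF Ubo]
      orthonormal_colsD(1)[OF Vbo] f UbU0 VbV0 S]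
  define Y where "Y t = Ub * S t * Vb\<^sup>T" for t
  note GY = G(1)[folded Y_def]
  have Ya: "Y a = Y0" using G(2) by (simp add: Y_def)
  \<comment> \<open>Two passes: the crude bound alone would leave an error of order \<open>h\<^sup>2\<close> in the step.\<close>
  have crude: "frob (A s - Y s) \<le> e + 2 * B * h" if "s \<in> {a..a + h}" for s
    using galerkin_error_crude[OF ends(3) sub exact Ubo Vbo GY that] by (simp add: Ya e)
  have refined: "frob (A s - Y s) \<le> M" if s: "s \<in> {a..a + h}" for s
  proof -
    have "frob (A s - Y s) \<le> e
      + (frob (range_coproj Ub * (A s - A a)) + frob (range_coproj Vb * (A s - A a)\<^sup>T))
      + L * (e + 2 * B * h) * (s - a)"
      using galerkin_error[OF ends(3) sub exact Ubo Vbo GY crude s] by (simp add: Ya e)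
    moreover have "L * (e + 2 * B * h) * (s - a) \<le> L * (e + 2 * B * h) * h"
      using s h L_nonneg B0 frob_nonneg[of "A a - Y0"] by (intro mult_left_mono) (auto simp: e)
    ultimately show ?thesis using incU(1)[OF s] incV(1)[OF s] by (simp add: M)
  qed
  have "frob (A (a + h) - Y (a + h)) \<le> e
    + (frob (range_coproj Ub * (A (a + h) - A a)) + frob (range_coproj Vb * (A (a + h) - A a)\<^sup>T))
    + L * M * h"
    using galerkin_error[OF ends(3) sub exact Ubo Vbo GY refined ends(2)] by (simp add: Ya e)
  then have final: "frob (A (a + h) - Y (a + h)) \<le> e + 2 * (h * \<eta> + D * h ^ 3 / 4) + L * M * h"
    using incU(2)[OF ends(2)] incV(2)[OF ends(2)] by simp
  note tr = svd_truncation_bounds[OF svd \<theta> Ubo Vbo]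
  show "low_rank_fact m n (dim_col U1) U1 S1 V1 (U1 * S1 * V1\<^sup>T)" by (rule tr(1))
  note Y1 = low_rank_factD(6)[OF tr(1)]
  have Yc: "Y (a + h) \<in> carrier_mat m n" using mat_curve_carrier(1)[OF GY ends(2)] .
  have "frob (U1 * S1 * V1\<^sup>T - A (a + h))
      \<le> frob (U1 * S1 * V1\<^sup>T - Y (a + h)) + frob (Y (a + h) - A (a + h))"
    by (rule frob_minus_triangle[OF Y1 Yc At[OF ends(2)]])
  also have "frob (Y (a + h) - A (a + h)) = frob (A (a + h) - Y (a + h))"
    by (rule frob_minus_commute[OF Yc At[OF ends(2)]])
  finally show "frob (U1 * S1 * V1\<^sup>T - A (a + h))
      \<le> e + 2 * (h * \<eta> + D * h ^ 3 / 4) + L * M * h + \<theta>"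
    using tr(2) final by (simp add: Y_def)
qed

end

section \<open>Global error\<close>

text \<open>This and \<open>local_error\<close> are the coefficients in \<open>step_error_collect\<close>, with the step size bounded by \<open>T\<close>
  in the lower order factors.\<close>

definition growth_rate :: "real \<Rightarrow> real \<Rightarrow> real" where
  "growth_rate L T = 3 * L + 6 * L\<^sup>2 * T + 3 * L ^ 3 * T\<^sup>2"

definition local_error :: "real \<Rightarrow> real \<Rightarrow> real \<Rightarrow> real \<Rightarrow> real \<Rightarrow> real \<Rightarrow> real \<Rightarrow> real" where
  "local_error B L T D \<epsilon>hat \<epsilon> h = (2 + 2 * L * T) * \<epsilon>hat + (2 * L + 2 * L\<^sup>2 * T) * (h * \<epsilon>)
     + (3 * L\<^sup>2 * B + D / 2 + 2 * D * L + 2 * B * L\<^sup>2 + 3 * L ^ 3 * B * T) * h\<^sup>2"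

text \<open>Multiplied out, the bound is an equality for \<open>T = h\<close>, and both coefficients are monotone in \<open>T\<close>.\<close>

lemma step_error_collect:
  assumes h: "0 < h" "h \<le> T" and nonneg: "0 \<le> L" "0 \<le> B" "0 \<le> e" "0 \<le> \<epsilon>" "0 \<le> \<epsilon>hat"
    and \<mu>: "\<mu> = e + h * (L * (e + B * h) + \<epsilon>) + h / 2 * (L * (e + B * h))"
    and \<eta>: "\<eta> = \<epsilon>hat + L * \<mu>"
    and M: "M = e + 2 * (h * (\<eta> + D * h)) + L * (e + 2 * B * h) * h"
  shows "e + 2 * (h * \<eta> + D * h ^ 3 / 4) + L * M * h
    \<le> (1 + growth_rate L T * h) * e + h * local_error B L T D \<epsilon>hat \<epsilon> h"
proof -
  have "e + 2 * (h * \<eta> + D * h ^ 3 / 4) + L * M * h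
      = (1 + growth_rate L h * h) * e + h * local_error B L h D \<epsilon>hat \<epsilon> h"
    unfolding M \<eta> \<mu> growth_rate_def local_error_def
    by (simp add: field_simps power2_eq_square power3_eq_cube)
  also have "growth_rate L h * h \<le> growth_rate L T * h"
    unfolding growth_rate_def using h nonneg
    by (intro mult_right_mono add_mono mult_left_mono power_mono) auto
  then have "(1 + growth_rate L h * h) * e \<le> (1 + growth_rate L T * h) * e"
    using nonneg by (intro mult_right_mono) auto
  moreover have "local_error B L h D \<epsilon>hat \<epsilon> h \<le> local_error B L T D \<epsilon>hat \<epsilon> h"
    unfolding local_error_def using h nonneg
    by (intro add_mono mult_right_mono mult_left_mono order_refl) auto
  then have "h * local_error B L h D \<epsilon>hat \<epsilon> h \<le> h * local_error B L T D \<epsilon>hat \<epsilon> h"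
    using h by (intro mult_left_mono) auto
  ultimately show ?thesis by simp
qed

lemma discrete_gronwall:
  fixes E :: "nat \<Rightarrow> real"
  assumes h: "0 \<le> C * h" and g: "0 \<le> g" and d: "0 \<le> d" "E 0 \<le> d"
    and step: "\<And>k. k < n \<Longrightarrow> E (Suc k) \<le> (1 + C * h) * E k + g"
  shows "E n \<le> exp (C * (real n * h)) * (d + real n * g)"
proof -
  have "k \<le> n \<Longrightarrow> E k \<le> (1 + C * h) ^ k * (d + real k * g)" for k
  proof (induction k)
    case 0
    then show ?case using d by simp
  next
    case (Suc k)
    let ?q = "1 + C * h"
    have "E (Suc k) \<le> ?q * E k + g" using step[of k] Suc by simp
    also have "\<dots> \<le> ?q * (?q ^ k * (d + real k * g)) + ?q ^ Suc k * g"
    proof (intro add_mono mult_left_mono)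
      have "1 \<le> ?q ^ Suc k" using h by (intro one_le_power) simp
      then show "g \<le> ?q ^ Suc k * g" using g mult_right_mono[of 1 "?q ^ Suc k" g] by simp
    qed (use Suc h in auto)
    also have "\<dots> = ?q ^ Suc k * (d + real (Suc k) * g)" by (simp add: algebra_simps)
    finally show ?case .
  qed
  then have "E n \<le> (1 + C * h) ^ n * (d + real n * g)" by simp
  also have "\<dots> \<le> exp (C * (real n * h)) * (d + real n * g)"
  proof (rule mult_right_mono)
    have "(1 + C * h) ^ n \<le> exp (C * h) ^ n" using h by (intro power_mono) auto
    also have "\<dots> = exp (C * (real n * h))" by (simp add: exp_of_nat_mult[symmetric] mult_ac)
    finally show "(1 + C * h) ^ n \<le> exp (C * (real n * h))" .
  qed (use g d in auto)
  finally show ?thesis .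
qed

lemma derivs_bounded_curves:
  assumes X: "derivs_bounded m n T D X" and c: "\<And>t. t \<in> {0..T} \<Longrightarrow> X t \<in> carrier_mat m n"
  obtains X1 X2 X3 where "mat_curve m n X X1 {0..T}" "mat_curve m n X1 X2 {0..T}"
    "mat_curve m n X2 X3 {0..T}" "\<And>t. t \<in> {0..T} \<Longrightarrow> frob (X2 t) \<le> D"
    "\<And>t. t \<in> {0..T} \<Longrightarrow> frob (X3 t) \<le> D"
proof -
  from X obtain d where d0: "d 0 = X"
    and d: "\<And>k t. k < 3 \<Longrightarrow> t \<in> {0..T} \<Longrightarrow> d (Suc k) t \<in> carrier_mat m n \<and>
      has_mat_derivative m n (d k) (d (Suc k) t) t {0..T} \<and> frob (d (Suc k) t) \<le> D"
    unfolding derivs_bounded_def by blast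
  have dc: "d k t \<in> carrier_mat m n" if "k < 4" "t \<in> {0..T}" for k t
    using that c d0 d[of "k - 1" t] by (cases k) auto
  have curve: "mat_curve m n (d k) (d (Suc k)) {0..T}" if "k < 3" for k
    using that dc d by (auto simp: mat_curve_def)
  show ?thesis
    by (rule that[of "d 1" "d 2" "d 3"])
      (use curve[of 0] curve[of 1] curve[of 2] d0 d[of 1] d[of 2] in \<open>auto simp: numeral_eq_Suc\<close>)
qed

text \<open>The induction also carries along that every \<open>Y k\<close> is given with an invertible middle factor, so that the
  rank occurring in the smallness assumption is the number of columns of its bases.\<close>

lemma midpoint_bug_run_error:
  assumes F: "bounded_lipschitz_field m n F {0..T} L B" and h: "0 < h" and \<theta>: "0 \<le> \<theta>"
    and nonneg: "0 \<le> \<delta>" "0 \<le> \<epsilon>" "0 \<le> \<epsilon>hat"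
    and A: "solves_mat_ode m n 0 T F A" and derivs: "derivs_bounded m n T D A"
    and run: "midpoint_bug_run m n F T h \<theta> Y rhat"
    and small: "\<And>k t X. real (Suc k) * h \<le> T \<Longrightarrow> t \<in> {real k * h..real k * h + h} \<Longrightarrow>
      X \<in> fixed_rank_mats m n (vec_space.rank m (Y k)) \<Longrightarrow> frob (X - A t) < \<rho> \<Longrightarrow>
      frob (tangent_proj_perp (vec_space.rank m (Y k)) X (F t X)) \<le> \<epsilon>"
    and small_hat: "\<And>k t X. real (Suc k) * h \<le> T \<Longrightarrow> t \<in> {real k * h..real k * h + h} \<Longrightarrow>
      X \<in> fixed_rank_mats m n (rhat k) \<Longrightarrow> frob (X - A t) < \<rho> \<Longrightarrow>
      frob (tangent_proj_perp (rhat k) X (F t X)) \<le> \<epsilon>hat"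
    and init: "frob (Y 0 - A 0) \<le> \<delta>"
    and near: "\<And>k. real k * h \<le> T \<Longrightarrow> frob (Y k - A (real k * h)) + B * h < \<rho>"
    and N: "real N * h \<le> T"
  shows "frob (Y N - A (real N * h)) \<le> exp (growth_rate L T * T) *
    (\<delta> + T * local_error B L T D \<epsilon>hat \<epsilon> h + real N * \<theta>)"
proof -
  interpret bounded_lipschitz_field m n F "{0..T}" L B by (rule F)
  have T: "0 \<le> T" using N h by (meson mult_nonneg_nonneg of_nat_0_le_iff less_imp_le order_trans)
  have Ac: "A t \<in> carrier_mat m n" if "t \<in> {0..T}" for t using A that by (simp add: solves_mat_ode_def)
  have exact: "mat_curve m n A (\<lambda>t. F t (A t)) {0..T}"
    by (rule mat_curve_solves_ode[OF A]) (use field_carrier Ac in auto)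
  obtain A1 A2 A3 where A1: "mat_curve m n A A1 {0..T}" and A2: "mat_curve m n A1 A2 {0..T}"
    and A3: "mat_curve m n A2 A3 {0..T}" and D2: "\<And>t. t \<in> {0..T} \<Longrightarrow> frob (A2 t) \<le> D"
    and D3: "\<And>t. t \<in> {0..T} \<Longrightarrow> frob (A3 t) \<le> D"
    using derivs_bounded_curves[OF derivs Ac] by blast
  have T0: "0 \<in> {0..T}" using T by simp
  have B0: "0 \<le> B" by (rule order_trans[OF frob_nonneg field_bound[OF T0 Ac[OF T0]]])
  have D0: "0 \<le> D" by (rule order_trans[OF frob_nonneg D2[OF T0]])
  define C where "C = growth_rate L T"
  define G where "G = local_error B L T D \<epsilon>hat \<epsilon> h"
  have C0: "0 \<le> C" unfolding C_def growth_rate_def using L_nonneg T by auto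
  have G0: "0 \<le> G" unfolding G_def local_error_def using L_nonneg T B0 D0 nonneg h by auto
  from run obtain U S V where f0: "low_rank_fact m n (dim_col (U 0)) (U 0) (S 0) (V 0) (Y 0)"
    and step: "\<And>k. real (Suc k) * h \<le> T \<Longrightarrow>
      midpoint_bug_step m n F (real k * h) h \<theta> (U k) (S k) (V k) (rhat k)
        (U (Suc k)) (S (Suc k)) (V (Suc k))"
    and Y: "\<And>k. real (Suc k) * h \<le> T \<Longrightarrow> Y (Suc k) = U (Suc k) * S (Suc k) * (V (Suc k))\<^sup>T"
    unfolding midpoint_bug_run_def by blast
  define E where "E k = frob (Y k - A (real k * h))" for k
  have one_step: "low_rank_fact m n (dim_col (U (Suc k))) (U (Suc k)) (S (Suc k)) (V (Suc k)) (Y (Suc k))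
      \<and> E (Suc k) \<le> (1 + C * h) * E k + (h * G + \<theta>)"
    if f: "low_rank_fact m n (dim_col (U k)) (U k) (S k) (V k) (Y k)" and k: "real (Suc k) * h \<le> T" for k
  proof -
    define a where "a = real k * h"
    have a: "0 \<le> a" "a + h = real (Suc k) * h" using h by (auto simp: a_def algebra_simps)
    have sub: "{a..a + h} \<subseteq> {0..T}" using a k by auto
    have aT: "a \<in> {0..T}" using sub h by auto
    have hT: "h \<le> T" using a k by simp
    note Yc = low_rank_factD(6)[OF f]
    have e: "E k = frob (A a - Y k)"
      unfolding E_def a_def[symmetric] by (rule frob_minus_commute[OF Yc Ac[OF aT]])
    have near': "E k + B * h < \<rho>" using near[of k] aT by (simp add: E_def a_def)
    have mid: "A1 (a + h / 2) = F (a + h / 2) (A (a + h / 2))"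
      by (rule mat_curve_derivative_unique[OF A1 exact]) (use a k h in auto)
    note rk = low_rank_fact_rank[OF f]
    define \<mu> where "\<mu> = E k + h * (L * (E k + B * h) + \<epsilon>) + h / 2 * (L * (E k + B * h))"
    define \<eta> where "\<eta> = \<epsilon>hat + L * \<mu>"
    define M where "M = E k + 2 * (h * (\<eta> + D * h)) + L * (E k + 2 * B * h) * h"
    have D2': "frob (A2 t) \<le> D" and D3': "frob (A3 t) \<le> D" if "t \<in> {a..a + h}" for t
      using D2 D3 that sub by auto
    note err = midpoint_bug_step_error[OF h sub \<theta> mat_curve_subset[OF exact sub]
        mat_curve_subset[OF A1 sub] mat_curve_subset[OF A2 sub] mat_curve_subset[OF A3 sub]
        D2' D3' mid f e near' small[OF k, folded a_def, unfolded rk]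
        small_hat[OF k, folded a_def] step[OF k, folded a_def] \<mu>_def \<eta>_def M_def]
    have "E (Suc k) \<le> E k + 2 * (h * \<eta> + D * h ^ 3 / 4) + L * M * h + \<theta>"
      using err(2) unfolding E_def[of "Suc k"] Y[OF k] a(2) .
    also have "\<dots> \<le> (1 + C * h) * E k + h * G + \<theta>"
      unfolding C_def G_def
      using step_error_collect[OF h hT L_nonneg B0 _ nonneg(2,3) \<mu>_def \<eta>_def M_def] frob_nonneg
      by (simp add: E_def)
    finally show ?thesis using err(1) Y[OF k] by simp
  qed
  have fact: "low_rank_fact m n (dim_col (U k)) (U k) (S k) (V k) (Y k)" if "real k * h \<le> T" for k
    using that
  proof (induction k)
    case (Suc k)
    have "real k * h \<le> real (Suc k) * h" using h by (intro mult_right_mono) auto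
    then show ?case using Suc one_step by simp
  qed (rule f0)
  have rec: "E (Suc k) \<le> (1 + C * h) * E k + (h * G + \<theta>)" if "k < N" for k
  proof -
    have "real (Suc k) * h \<le> real N * h" "real k * h \<le> real N * h"
      using that h by (auto intro!: mult_right_mono)
    then show ?thesis using N fact one_step by (meson order_trans)
  qed
  have "E N \<le> exp (C * (real N * h)) * (\<delta> + real N * (h * G + \<theta>))"
    by (rule discrete_gronwall) (use C0 G0 h \<theta> nonneg init rec in \<open>auto simp: E_def\<close>)
  also have "\<dots> \<le> exp (C * T) * (\<delta> + T * G + real N * \<theta>)"
  proof (rule mult_mono)
    show "exp (C * (real N * h)) \<le> exp (C * T)" using C0 N by (simp add: mult_left_mono)
    have "real N * h * G \<le> T * G" using N G0 by (rule mult_right_mono)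
    then show "\<delta> + real N * (h * G + \<theta>) \<le> \<delta> + T * G + real N * \<theta>" by (simp add: algebra_simps)
    show "0 \<le> \<delta> + real N * (h * G + \<theta>)" using G0 h \<theta> nonneg by simp
  qed simp
  finally show ?thesis by (simp add: E_def C_def G_def)
qed

theorem theorem2:
  shows "\<exists>(h0 :: real \<Rightarrow> real \<Rightarrow> real) (c0 :: real \<Rightarrow> real \<Rightarrow> real \<Rightarrow> real \<Rightarrow> real) c1 c2 c3 c4.
    (\<forall>B \<rho>. 0 \<le> B \<longrightarrow> 0 < \<rho> \<longrightarrow> 0 < h0 B \<rho>) \<and>
    (\<forall>m n F A A0 Y rhat N T h \<theta> \<delta> \<epsilon> \<epsilon>hat \<rho> B L D.
       (\<forall>t\<in>{0..T}. \<forall>X\<in>carrier_mat m n. F t X \<in> carrier_mat m n) \<and>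
       mat_field_continuous m n T F \<and>
       solves_mat_ode m n 0 T F A \<and> A 0 = A0 \<and>
       0 < h \<and> 0 \<le> \<theta> \<and> 0 \<le> \<delta> \<and> 0 \<le> \<epsilon> \<and> 0 \<le> \<epsilon>hat \<and> 0 < \<rho> \<and>
       midpoint_bug_run m n F T h \<theta> Y rhat \<and>
       (\<forall>t\<in>{0..T}. \<forall>X\<in>carrier_mat m n. \<forall>Z\<in>carrier_mat m n.
          frob (F t X - F t Z) \<le> L * frob (X - Z) \<and> frob (F t X) \<le> B) \<and>
       (\<forall>k. real k * h \<le> T \<longrightarrow>
          (\<exists>J\<subseteq>{0..T}.
             (\<forall>\<^sub>F t in at (real k * h) within {0..T}. t \<in> J) \<and>
             {real k * h..real (Suc k) * h} \<inter> {0..T} \<subseteq> J \<and>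
             (\<forall>t\<in>J. \<forall>X\<in>fixed_rank_mats m n (vec_space.rank m (Y k)).
                frob (X - A t) < \<rho> \<longrightarrow>
                frob (tangent_proj_perp (vec_space.rank m (Y k)) X (F t X)) \<le> \<epsilon>) \<and>
             (real (Suc k) * h \<le> T \<longrightarrow>
               (\<forall>t\<in>J. \<forall>X\<in>fixed_rank_mats m n (rhat k).
                  frob (X - A t) < \<rho> \<longrightarrow>
                  frob (tangent_proj_perp (rhat k) X (F t X)) \<le> \<epsilon>hat)))) \<and>
       frob (Y 0 - A0) \<le> \<delta> \<and>
       (\<forall>k. real k * h \<le> T \<longrightarrow> frob (Y k - A (real k * h)) \<le> \<rho> / 2) \<and>
       h \<le> h0 B \<rho> \<and>
       (\<exists>\<eta>>0. {X \<in> carrier_mat m n. frob (X - A0) < \<eta>} \<subseteq> N) \<and>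
       (\<forall>k Z. real k * h \<le> T \<longrightarrow> solves_mat_ode m n 0 T F Z \<longrightarrow> Z (real k * h) = Y k \<longrightarrow>
          Z 0 \<in> N) \<and>
       (\<forall>Z. solves_mat_ode m n 0 T F Z \<longrightarrow> Z 0 \<in> N \<longrightarrow> derivs_bounded m n T D Z)
       \<longrightarrow>
       (\<forall>k. real k * h \<le> T \<longrightarrow>
          frob (Y k - A (real k * h))
            \<le> c0 B L T D * \<delta> + c1 B L T D * \<epsilon>hat + c2 B L T D * h * \<epsilon>
              + c3 B L T D * h\<^sup>2 + c4 B L T D * real k * \<theta>))"
proof -
  \<comment> \<open>With \<open>B * h \<le> \<rho> / 4\<close> nothing can leave the ball of radius \<open>\<rho>\<close> within a step that starts from
    distance at most \<open>\<rho> / 2\<close>.\<close>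
  define h0 where "h0 B \<rho> = \<rho> / (4 * (\<bar>B\<bar> + 1))" for B \<rho> :: real
  define c0 where "c0 B L T D = exp (growth_rate \<bar>L\<bar> T * T)" for B L T D :: real
  define c1 where "c1 B L T D = c0 B L T D * (T * (2 + 2 * \<bar>L\<bar> * T))" for B L T D :: real
  define c2 where "c2 B L T D = c0 B L T D * (T * (2 * \<bar>L\<bar> + 2 * \<bar>L\<bar>\<^sup>2 * T))" for B L T D :: real
  define c3 where "c3 B L T D = c0 B L T D * (T * (3 * \<bar>L\<bar>\<^sup>2 * B + D / 2
    + 2 * D * \<bar>L\<bar> + 2 * B * \<bar>L\<bar>\<^sup>2 + 3 * \<bar>L\<bar> ^ 3 * B * T))" for B L T D :: real
  show ?thesis
  proof (rule exI[of _ h0], rule exI[of _ c0], rule exI[of _ c1], rule exI[of _ c2], rule exI[of _ c3],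
      rule exI[of _ c0], intro conjI allI impI, goal_cases)
    case (1 B \<rho>)
    then show ?case by (simp add: h0_def)
  next
    case (2 m n F A A0 Y rhat N T h \<theta> \<delta> \<epsilon> \<epsilon>hat \<rho> B L D k)
    note kT = 2(2)
    from 2(1) show ?case
    proof (elim conjE, goal_cases)
      case hyps: 1
      note nonneg = hyps(5-10)
      note A = hyps(3) and A0 = hyps(4) and run = hyps(11) and init = hyps(14)
      have carrier: "F t X \<in> carrier_mat m n" if "t \<in> {0..T}" "X \<in> carrier_mat m n" for t X
        using hyps(1) that by blast
      have F: "frob (F t X - F t Z) \<le> L * frob (X - Z) \<and> frob (F t X) \<le> B"
        if "t \<in> {0..T}" "X \<in> carrier_mat m n" "Z \<in> carrier_mat m n" for t X Z
        using hyps(12) that by blast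
      have near: "frob (Y k - A (real k * h)) \<le> \<rho> / 2" if "real k * h \<le> T" for k
        using hyps(15) that by blast
      note h0 = hyps(16) and N = hyps(17)
      have derivs: "derivs_bounded m n T D Z" if "solves_mat_ode m n 0 T F Z" "Z 0 \<in> N" for Z
        using hyps(19) that by blast
      have T: "0 \<in> {0..T}"
        using kT nonneg(1) by (simp, meson mult_nonneg_nonneg of_nat_0_le_iff less_imp_le order_trans)
      have A0c: "A0 \<in> carrier_mat m n" using A T A0 by (auto simp: solves_mat_ode_def)
      have field: "bounded_lipschitz_field m n F {0..T} \<bar>L\<bar> B"
      proof
        fix t and X Z :: "real mat" assume "t \<in> {0..T}" "X \<in> carrier_mat m n" "Z \<in> carrier_mat m n"
        then have "frob (F t X - F t Z) \<le> L * frob (X - Z)" using F by blast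
        also have "\<dots> \<le> \<bar>L\<bar> * frob (X - Z)" by (intro mult_right_mono) auto
        finally show "frob (F t X - F t Z) \<le> \<bar>L\<bar> * frob (X - Z)" .
      qed (use carrier F in auto)
      have "A0 \<in> N" using N A0c by auto
      then have dA: "derivs_bounded m n T D A" using derivs[OF A] A0 by simp
      have small: "t \<in> {real k * h..real k * h + h} \<Longrightarrow>
          (X \<in> fixed_rank_mats m n (vec_space.rank m (Y k)) \<longrightarrow> frob (X - A t) < \<rho> \<longrightarrow>
            frob (tangent_proj_perp (vec_space.rank m (Y k)) X (F t X)) \<le> \<epsilon>) \<and>
          (X \<in> fixed_rank_mats m n (rhat k) \<longrightarrow> frob (X - A t) < \<rho> \<longrightarrow>
            frob (tangent_proj_perp (rhat k) X (F t X)) \<le> \<epsilon>hat)"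
        if k: "real (Suc k) * h \<le> T" for k t X
      proof -
        assume t: "t \<in> {real k * h..real k * h + h}"
        have eq: "real (Suc k) * h = real k * h + h" by (simp add: algebra_simps)
        have k': "real k * h \<le> T" "0 \<le> real k * h" using k nonneg(1) unfolding eq by auto
        have "t \<in> {real k * h..real (Suc k) * h} \<inter> {0..T}" using t k k' unfolding eq by auto
        moreover obtain J where "{real k * h..real (Suc k) * h} \<inter> {0..T} \<subseteq> J"
          and "\<forall>t\<in>J. \<forall>X\<in>fixed_rank_mats m n (vec_space.rank m (Y k)). frob (X - A t) < \<rho> \<longrightarrow>
             frob (tangent_proj_perp (vec_space.rank m (Y k)) X (F t X)) \<le> \<epsilon>"
          and "real (Suc k) * h \<le> T \<longrightarrow>
            (\<forall>t\<in>J. \<forall>X\<in>fixed_rank_mats m n (rhat k). frob (X - A t) < \<rho> \<longrightarrow>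
               frob (tangent_proj_perp (rhat k) X (F t X)) \<le> \<epsilon>hat)"
          using hyps(13)[THEN spec, THEN mp, OF k'(1)] by (elim exE conjE) (rule that)
        ultimately show ?thesis using k by blast
      qed
      have Bh: "B * h \<le> \<rho> / 4"
      proof -
        have "B * h \<le> \<bar>B\<bar> * h0 B \<rho>" using h0 nonneg(1) by (intro mult_mono) auto
        also have "\<dots> \<le> \<rho> / 4" using nonneg(6) by (simp add: h0_def field_simps)
        finally show ?thesis .
      qed
      have near': "frob (Y k - A (real k * h)) + B * h < \<rho>" if "real k * h \<le> T" for k
        using near[OF that] Bh nonneg(6) by simp
      have "frob (Y k - A (real k * h)) \<le> exp (growth_rate \<bar>L\<bar> T * T) *
          (\<delta> + T * local_error B \<bar>L\<bar> T D \<epsilon>hat \<epsilon> h + real k * \<theta>)"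
        by (rule midpoint_bug_run_error[OF field nonneg(1-5) A dA run])
          (use small init A0 near' kT in \<open>blast+\<close>)
      also have "\<dots> = c0 B L T D * \<delta> + c1 B L T D * \<epsilon>hat + c2 B L T D * h * \<epsilon>
          + c3 B L T D * h\<^sup>2 + c0 B L T D * real k * \<theta>"
        unfolding c1_def c2_def c3_def local_error_def c0_def[symmetric]
        by (simp add: c0_def ring_distribs)
      finally show ?case .
    qed
  qed
qed

end
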